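(* Let $\mathbb{F}$ be an algebraically closed field of characteristic $0$ and let $\mathcal{A}=(E,V,L)$ be a linear space over $\mathbb{F}$. For all integers $k$ with $-(\rho+1)\leq k\leq 0$, we have $$H^0(\mathcal{O}_{Y_\mathcal{A}}(D_k))=C_{\mathcal{A},k}$$ as subspaces of $\operatorname{Sym}L^*$.
   Context: A linear space over $\mathbb{F}$ is a triple $\mathcal{A}=(E,V,L)$, where $E$ is a finite set, $V=\bigoplus_{e\in E}V_e$ is a vector space with a decomposition into lines indexed by $E$, and $L\subset V$ is a linear subspace. For $S\subset E$ let $V_S=\bigoplus_{e\in S}V_e$, let $\pi_S:V\to V_S$ be the projection and $L_S=\pi_S(L)$. The matroid $M_\mathcal{A}$ on $E$ has rank function $S\mapsto\dim L_S$. For $\alpha\in L$, let $m(\alpha)$ be the number of $e\in E$ such that the projection $\alpha_e\in V_e$ is nonzero, and let $\rho$ be the minimum of $m(\alpha)$ over $0\neq\alpha\in L$. For $k\geq-(\rho+1)$, set $$C_{\mathcal{A},k}:=\{f\in\operatorname{Sym}L^*\mid\alpha^{m(\alpha)+k+1}\cdot f=0\text{ for all }0\neq\alpha\in L\},$$ where elements of $\operatorname{Sym}L^*$ are polynomials on $L$ and elements of $\operatorname{Sym}L$ act on them as constant-coefficient differential operators. (Equivalently, $C_{\mathcal{A},k}$ is the linear dual of $R_{\mathcal{A},k}=\operatorname{Sym}L/\langle\alpha^{m(\alpha)+k+1}\mid0\neq\alpha\in L\rangle$.) Let $\overline{V_e}:=V_e\sqcup\{\infty\}=\mathbb{P}(V_e\oplus\mathbb{F})\cong\mathbb{P}^1$.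 The Schubert variety $Y_\mathcal{A}$ is the closure of $L\subset V$ inside $\mathbb{P}_\mathcal{A}:=\prod_{e\in E}\overline{V_e}$; it is a normal variety. The translation action of $L$ on itself extends to $Y_\mathcal{A}$, with finitely many orbits indexed by flats of $M_\mathcal{A}$: the flat $F$ corresponds to the orbit of the point $p_F$ with coordinate $0$ in positions $e\in F$ and $\infty$ in positions $e\notin F$, and this orbit is isomorphic to $L_F$. For a flat $F$ of corank $1$, the orbit has codimension $1$; let $D_F$ be its closure, let $\alpha_F$ span the line $L\cap V_{E\setminus F}$ (the stabilizer of the orbit), and let $m(F):=m(\alpha_F)$. For an integer $k$, let $D_k:=\sum_F(m(F)+k)D_F$, a Weil divisor, the sum being over all corank $1$ flats $F$ of $M_\mathcal{A}$. A section of $\mathcal{O}_{Y_\mathcal{A}}(D_k)$ is a rational function on $Y_\mathcal{A}$ that is regular on $L$ and has a pole of order at most $m(F)+k$ along $D_F$ for each $F$; restriction to $L$ gives an inclusion $H^0(\mathcal{O}_{Y_\mathcal{A}}(D_k))\subset H^0(\mathcal{O}_L)\cong\operatorname{Sym}L^*$. *)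

theory Defs
  imports "HOL-Analysis.Analysis" "HOL-Computational_Algebra.Computational_Algebra"
begin

(* The algebra of functions generated by a set Phi of functions.  Over an infinite field, taking
   for Phi the linear functionals on W gives Sym W^*, regarded as polynomial functions on W. *)
inductive_set generated_algebra :: "('x \<Rightarrow> 'a::comm_ring_1) set \<Rightarrow> ('x \<Rightarrow> 'a) set"
  for \<Phi> :: "('x \<Rightarrow> 'a) set" where
  const: "(\<lambda>_. c) \<in> generated_algebra \<Phi>"
| gen: "\<phi> \<in> \<Phi> \<Longrightarrow> \<phi> \<in> generated_algebra \<Phi>"
| add: "f \<in> generated_algebra \<Phi> \<Longrightarrow> g \<in> generated_algebra \<Phi> \<Longrightarrow>
    (\<lambda>x. f x + g x) \<in> generated_algebra \<Phi>"
| mult: "f \<in> generated_algebra \<Phi> \<Longrightarrow> g \<in> generated_algebra \<Phi> \<Longrightarrow>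
    (\<lambda>x. f x * g x) \<in> generated_algebra \<Phi>"

(* Points of V_e together with a point at infinity. *)
datatype 'v proj_point = Fin 'v | Infty

locale linear_space = vector_space scale
  for scale :: "'a::{alg_closed_field,field_char_0} \<Rightarrow> 'v::ab_group_add \<Rightarrow> 'v" +
  fixes E :: "'e set" and Vl :: "'e \<Rightarrow> 'v set" and L :: "'v set"
  assumes finite_E: "finite E"
    and line_subspace: "\<And>e. e \<in> E \<Longrightarrow> subspace (Vl e)"
    and line_dim: "\<And>e. e \<in> E \<Longrightarrow> dim (Vl e) = 1"
    and direct_sum: "\<And>v. \<exists>!c. c \<in> (\<Pi>\<^sub>E e\<in>E. Vl e) \<and> v = (\<Sum>e\<in>E. c e)"
    and L_subspace: "subspace L"
begin

definition component :: "'v \<Rightarrow> 'e \<Rightarrow> 'v" where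
  "component v = (THE c. c \<in> (\<Pi>\<^sub>E e\<in>E. Vl e) \<and> v = (\<Sum>e\<in>E. c e))"

definition proj :: "'e set \<Rightarrow> 'v \<Rightarrow> 'v" where
  "proj S v = (\<Sum>e\<in>S. component v e)"

definition coord_subspace :: "'e set \<Rightarrow> 'v set" where
  "coord_subspace S = {v. \<forall>e\<in>E - S. component v e = 0}"

definition rk :: "'e set \<Rightarrow> nat" where
  "rk S = dim (proj S ` L)"

definition flat :: "'e set \<Rightarrow> bool" where
  "flat F \<longleftrightarrow> F \<subseteq> E \<and> (\<forall>e\<in>E - F. rk F < rk (insert e F))"

definition corank1_flat :: "'e set \<Rightarrow> bool" where
  "corank1_flat F \<longleftrightarrow> flat F \<and> rk F + 1 = rk E"

definition mult_supp :: "'v \<Rightarrow> nat" where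
  "mult_supp \<alpha> = card {e \<in> E. component \<alpha> e \<noteq> 0}"

definition rho :: nat where
  "rho = Min (mult_supp ` (L - {0}))"

definition L_dual :: "('v \<Rightarrow> 'a) set" where
  "L_dual = {\<phi>. (\<forall>x\<in>L. \<forall>y\<in>L. \<phi> (x + y) = \<phi> x + \<phi> y) \<and> (\<forall>c. \<forall>x\<in>L. \<phi> (scale c x) = c * \<phi> x)}"

(* Functions on L are represented as functions on V that are undefined outside L. *)
definition Sym_L_dual :: "('v \<Rightarrow> 'a) set" where
  "Sym_L_dual = {restrict f L | f. f \<in> generated_algebra L_dual}"

(* The action of alpha in L as a differential operator: the derivative of f at x in direction
   alpha is the coefficient of t in the polynomial f (x + t alpha) in t. *)
definition deriv_along :: "'v \<Rightarrow> ('v \<Rightarrow> 'a) \<Rightarrow> ('v \<Rightarrow> 'a)" where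
  "deriv_along \<alpha> f = (\<lambda>x\<in>L. coeff (THE p. \<forall>t. poly p t = f (x + scale t \<alpha>)) 1)"

definition C_space :: "int \<Rightarrow> ('v \<Rightarrow> 'a) set" where
  "C_space k = {f \<in> Sym_L_dual. \<forall>\<alpha>\<in>L - {0}.
     (deriv_along \<alpha> ^^ nat (int (mult_supp \<alpha>) + k + 1)) f = (\<lambda>x\<in>L. 0)}"

definition PA :: "('e \<Rightarrow> 'v proj_point) set" where
  "PA = (\<Pi>\<^sub>E e\<in>E. insert Infty (Fin ` Vl e))"

(* A pair (v, s) is an element of the direct sum of the planes V_e + F, with e-th entry (v_e, s_e).
   It is a lift of P if for every e, (v_e, s_e) are homogeneous coordinates of the point P e of
   the projective line P(V_e + F). *)
definition is_lift :: "('e \<Rightarrow> 'v proj_point) \<Rightarrow> 'v \<times> ('e \<Rightarrow> 'a) \<Rightarrow> bool" where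
  "is_lift P = (\<lambda>(v, s). \<forall>e\<in>E. (component v e \<noteq> 0 \<or> s e \<noteq> 0) \<and>
     P e = (if s e = 0 then Infty else Fin (scale (inverse (s e)) (component v e))))"

definition homog_coord_ring :: "('v \<times> ('e \<Rightarrow> 'a) \<Rightarrow> 'a) set" where
  "homog_coord_ring = generated_algebra
     ({\<lambda>(v, s). \<phi> v | \<phi>. Vector_Spaces.linear scale (*) \<phi>} \<union> {\<lambda>(v, s). s e | e. e \<in> E})"

definition multihomogeneous :: "('e \<Rightarrow> nat) \<Rightarrow> ('v \<times> ('e \<Rightarrow> 'a) \<Rightarrow> 'a) \<Rightarrow> bool" where
  "multihomogeneous d G \<longleftrightarrow> G \<in> homog_coord_ring \<and>
     (\<forall>c v s. G (\<Sum>e\<in>E. scale (c e) (component v e), \<lambda>e. c e * s e)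
            = (\<Prod>e\<in>E. c e ^ d e) * G (v, s))"

definition zariski :: "('e \<Rightarrow> 'v proj_point) topology" where
  "zariski = topology_generated_by
     {{P \<in> PA. \<forall>z. is_lift P z \<longrightarrow> G z \<noteq> 0} | G d. multihomogeneous d G}"

definition embed :: "'v \<Rightarrow> ('e \<Rightarrow> 'v proj_point)" where
  "embed x = (\<lambda>e\<in>E. Fin (component x e))"

definition Y :: "('e \<Rightarrow> 'v proj_point) set" where
  "Y = zariski closure_of (embed ` L)"

definition open_Y :: "('e \<Rightarrow> 'v proj_point) set \<Rightarrow> bool" where
  "open_Y U \<longleftrightarrow> openin (subtopology zariski Y) U"

definition regular_on :: "('e \<Rightarrow> 'v proj_point) set \<Rightarrow> (('e \<Rightarrow> 'v proj_point) \<Rightarrow> 'a) \<Rightarrow> bool" where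
  "regular_on U f \<longleftrightarrow> (\<forall>P\<in>U. \<exists>W G H d. open_Y W \<and> P \<in> W \<and> W \<subseteq> U \<and>
     multihomogeneous d G \<and> multihomogeneous d H \<and>
     (\<forall>Q\<in>W. \<forall>z. is_lift Q z \<longrightarrow> H z \<noteq> 0 \<and> f Q = G z / H z))"

(* A rational function on Y is represented by a regular function f on a nonempty open subset U.
   Two pairs represent the same one if they agree on a nonempty open subset. *)
definition rational_fun ::
    "('e \<Rightarrow> 'v proj_point) set \<Rightarrow> (('e \<Rightarrow> 'v proj_point) \<Rightarrow> 'a) \<Rightarrow> bool" where
  "rational_fun U f \<longleftrightarrow> open_Y U \<and> U \<noteq> {} \<and> regular_on U f"

(* The local ring of Y along an irreducible closed subset D, and its maximal ideal. *)
definition local_ring :: "('e \<Rightarrow> 'v proj_point) set \<Rightarrow>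
    (('e \<Rightarrow> 'v proj_point) set \<times> (('e \<Rightarrow> 'v proj_point) \<Rightarrow> 'a)) set" where
  "local_ring D = {(W, g). open_Y W \<and> W \<inter> D \<noteq> {} \<and> regular_on W g}"

definition max_ideal :: "('e \<Rightarrow> 'v proj_point) set \<Rightarrow>
    (('e \<Rightarrow> 'v proj_point) set \<times> (('e \<Rightarrow> 'v proj_point) \<Rightarrow> 'a)) set" where
  "max_ideal D = {(W, g) \<in> local_ring D. \<forall>P\<in>W \<inter> D. g P = 0}"

definition uniformizer :: "('e \<Rightarrow> 'v proj_point) set \<Rightarrow>
    ('e \<Rightarrow> 'v proj_point) set \<Rightarrow> (('e \<Rightarrow> 'v proj_point) \<Rightarrow> 'a) \<Rightarrow> bool" where
  "uniformizer D W t \<longleftrightarrow> (W, t) \<in> max_ideal D \<and>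
     (\<forall>(W', g)\<in>max_ideal D. \<exists>(W'', h)\<in>local_ring D. \<forall>P\<in>W \<inter> W' \<inter> W''. g P = t P * h P)"

(* The valuation of the discrete valuation ring of Y along D: the order of a nonzero rational
   function f is the n with f = t^n h, for a uniformizer t and a unit h of the local ring.
   The identity is required where t is nonzero, since t^n may be undefined elsewhere. *)
definition ord_along :: "('e \<Rightarrow> 'v proj_point) set \<Rightarrow>
    ('e \<Rightarrow> 'v proj_point) set \<Rightarrow> (('e \<Rightarrow> 'v proj_point) \<Rightarrow> 'a) \<Rightarrow> int" where
  "ord_along D U f = (THE n. \<exists>W t. uniformizer D W t \<and>
     (\<exists>(W', h)\<in>local_ring D - max_ideal D.
        \<forall>P\<in>U \<inter> W \<inter> W'. t P \<noteq> 0 \<longrightarrow> f P = t P powi n * h P))"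

definition translate :: "'v \<Rightarrow> ('e \<Rightarrow> 'v proj_point) \<Rightarrow> ('e \<Rightarrow> 'v proj_point)" where
  "translate x P =
     (\<lambda>e\<in>E. case P e of Fin v \<Rightarrow> Fin (v + component x e) | Infty \<Rightarrow> Infty)"

definition flat_point :: "'e set \<Rightarrow> ('e \<Rightarrow> 'v proj_point)" where
  "flat_point F = (\<lambda>e\<in>E. if e \<in> F then Fin 0 else Infty)"

definition flat_orbit :: "'e set \<Rightarrow> ('e \<Rightarrow> 'v proj_point) set" where
  "flat_orbit F = (\<lambda>x. translate x (flat_point F)) ` L"

definition D_flat :: "'e set \<Rightarrow> ('e \<Rightarrow> 'v proj_point) set" where
  "D_flat F = zariski closure_of (flat_orbit F)"

definition alpha_flat :: "'e set \<Rightarrow> 'v" where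
  "alpha_flat F = (SOME \<alpha>. \<alpha> \<noteq> 0 \<and> span {\<alpha>} = L \<inter> coord_subspace (E - F))"

(* The Weil divisor D_k, given by its coefficients along the divisors D_flat F. *)
definition D_coeff :: "int \<Rightarrow> 'e set \<Rightarrow> int" where
  "D_coeff k F = int (mult_supp (alpha_flat F)) + k"

definition is_section :: "int \<Rightarrow>
    ('e \<Rightarrow> 'v proj_point) set \<Rightarrow> (('e \<Rightarrow> 'v proj_point) \<Rightarrow> 'a) \<Rightarrow> bool" where
  "is_section k U f \<longleftrightarrow> rational_fun U f \<and> embed ` L \<subseteq> U \<and>
     ((\<forall>P\<in>U. f P = 0) \<or> (\<forall>F. corank1_flat F \<longrightarrow> - D_coeff k F \<le> ord_along (D_flat F) U f))"

(* Global sections of O(D_k), restricted to L. *)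
definition H0 :: "int \<Rightarrow> ('v \<Rightarrow> 'a) set" where
  "H0 k = {(\<lambda>x\<in>L. f (embed x)) | U f. is_section k U f}"

end

end

theory Submission
  imports Defs
begin

text \<open>
  A polynomial function \<open>f\<close> on \<open>L\<close> has a degree in each direction \<open>\<alpha>\<close>: the largest degree in \<open>t\<close> of
  \<open>f (x + t \<alpha>)\<close> for \<open>x\<close> in \<open>L\<close>. Both sides of the theorem are described by bounds on such degrees. In
  characteristic 0, the \<open>n\<close>-th power of the derivative in direction \<open>\<alpha>\<close> kills \<open>f\<close> if and only if the degree is
  less than \<open>n\<close>, so \<open>C_space k\<close> consists of the \<open>f\<close> whose degree in direction \<open>\<alpha>\<close> is at most \<open>m(\<alpha>) + k\<close> for
  all nonzero \<open>\<alpha>\<close> in \<open>L\<close> (\<open>C_space_iff\<close>), where \<open>m(\<alpha>)\<close> is the size of the support of \<open>\<alpha>\<close>.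

  A section restricts to a regular function on the affine space \<open>L\<close>, hence to a polynomial \<open>f\<close>
  (\<open>locally_fraction_imp_polyfun\<close>). Near the orbit of a flat \<open>F\<close> of corank 1 the points \<open>y + \<alpha> / u\<close>, where \<open>\<alpha>\<close> spans
  the stabilizer, have limits for \<open>u = 0\<close>, namely the points of the orbit. So \<open>u\<close> is a uniformizer, and substituting
  \<open>t = 1 / u\<close> in \<open>f (y + t \<alpha>)\<close> shows that the order of the pole of \<open>f\<close> is its degree in direction \<open>\<alpha>\<close>
  (\<open>ord_along_polyfun\<close>). Identities between regular functions are checked on the dense subset \<open>L\<close>, so
  that only the points of \<open>L\<close> and of the orbit enter. Thus \<open>H0 k\<close> is given by the same
  bounds as \<open>C_space k\<close>, but only for the directions \<open>alpha_flat F\<close>. Up to scalars these are the nonzero vectors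
  of \<open>L\<close> of minimal support.

  It remains to see that the bounds in these directions imply all others if \<open>k \<le> 0\<close>
  (\<open>deg_below_all_directions\<close>). If the support of \<open>\<alpha>\<close> is not minimal, choose \<open>\<beta>\<close> in \<open>L\<close>, not a multiple of \<open>\<alpha>\<close>, with
  support inside that of \<open>\<alpha>\<close>. For the finitely many quotients \<open>c\<close> of coordinates of \<open>\<beta>\<close> and \<open>\<alpha>\<close>, the vector
  \<open>\<beta> - c \<alpha>\<close> has support of size \<open>m(\<alpha>) - n c\<close> with \<open>n c > 0\<close>, the numbers \<open>n c\<close> add up to \<open>m(\<alpha>)\<close>, and there are \<open>r \<ge> 2\<close>
  such \<open>c\<close>. By induction the degree of \<open>f\<close> along \<open>\<beta> - c \<alpha>\<close> is at most \<open>m(\<alpha>) - n c + k\<close>. On a translate of the plane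
  spanned by \<open>\<alpha>\<close> and \<open>\<beta>\<close>, the homogeneous part of degree \<open>D > m(\<alpha>) + k\<close> of \<open>f\<close> is a binary form that is therefore divisible by
  the power with exponent \<open>D - m(\<alpha>) - k + n c\<close> of the linear form vanishing on \<open>\<beta> - c \<alpha>\<close> (\<open>plane_degree\<close>). The exponents add up
  to \<open>r (D - m(\<alpha>) - k) + m(\<alpha>) > D\<close>, so this part is 0, and the degree of \<open>f\<close> in direction \<open>\<alpha>\<close> is at
  most \<open>m(\<alpha>) + k\<close>.
\<close>

section \<open>Algebras generated by functions\<close>

text \<open>The workhorse for moving between algebras: restricting a function along \<open>\<kappa>\<close> only has to be
  checked on generators.\<close>
lemma generated_algebra_pullback:
  assumes "f \<in> generated_algebra \<Phi>"
    and "\<And>\<phi>. \<phi> \<in> \<Phi> \<Longrightarrow> (\<lambda>x. \<phi> (\<kappa> x)) \<in> generated_algebra \<Psi>"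
  shows "(\<lambda>x. f (\<kappa> x)) \<in> generated_algebra \<Psi>"
  using assms(1)
proof induction
  case (const c) show ?case by (rule generated_algebra.const)
next
  case (gen \<phi>) then show ?case by (rule assms(2))
next
  case (add f g)
  from generated_algebra.add[OF add.IH] show ?case .
next
  case (mult f g)
  from generated_algebra.mult[OF mult.IH] show ?case .
qed

lemma generated_algebra_mono:
  assumes "f \<in> generated_algebra \<Phi>" "\<Phi> \<subseteq> \<Psi>"
  shows "f \<in> generated_algebra \<Psi>"
  using generated_algebra_pullback[OF assms(1), of "\<lambda>x. x" \<Psi>] assms(2)
  by (auto intro: generated_algebra.gen)

lemma generated_algebra_sum:
  assumes "\<And>i. i \<in> I \<Longrightarrow> f i \<in> generated_algebra \<Phi>"
  shows "(\<lambda>x. \<Sum>i\<in>I. f i x) \<in> generated_algebra \<Phi>"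
  using assms
  by (induction I rule: infinite_finite_induct)
     (auto intro: generated_algebra.const generated_algebra.add)

lemma generated_algebra_power:
  assumes "f \<in> generated_algebra \<Phi>"
  shows "(\<lambda>x. f x ^ n) \<in> generated_algebra \<Phi>"
  by (induction n) (auto intro: generated_algebra.const generated_algebra.mult assms)

lemma generated_algebra_poly:
  assumes "f \<in> generated_algebra \<Phi>"
  shows "(\<lambda>x. poly p (f x)) \<in> generated_algebra \<Phi>"
  by (induction p) (auto intro!: generated_algebra.const generated_algebra.mult generated_algebra.add assms)

lemma generated_algebra_cmult:
  assumes "f \<in> generated_algebra \<Phi>"
  shows "(\<lambda>x. c * f x) \<in> generated_algebra \<Phi>"
  using generated_algebra.mult[OF generated_algebra.const assms] .

lemma generated_algebra_id_poly:
  assumes "f \<in> generated_algebra {\<lambda>t::'a::comm_ring_1. t}"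
  shows "\<exists>p. \<forall>t. f t = poly p t"
  using assms
proof induction
  case (const c) show ?case by (rule exI[of _ "[:c:]"]) auto
next
  case (gen \<phi>) then show ?case by (intro exI[of _ "[:0,1:]"]) auto
next
  case (add f g)
  then obtain p q where "\<forall>t. f t = poly p t" "\<forall>t. g t = poly q t" by blast
  then show ?case by (intro exI[of _ "p + q"]) auto
next
  case (mult f g)
  then obtain p q where "\<forall>t. f t = poly p t" "\<forall>t. g t = poly q t" by blast
  then show ?case by (intro exI[of _ "p * q"]) auto
qed

section \<open>Polynomials in one variable\<close>

lemma poly_two_nonzero:
  fixes p q :: "'a::field_char_0 poly"
  assumes "poly p a \<noteq> 0" "poly q b \<noteq> 0"
  shows "\<exists>t. t \<noteq> c \<and> poly p t \<noteq> 0 \<and> poly q t \<noteq> 0"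
proof -
  have "p \<noteq> 0" "q \<noteq> 0" "[:-c,1:] \<noteq> 0" using assms by auto
  then have "p * q * [:-c,1:] \<noteq> 0" by (simp only: mult_eq_0_iff) blast
  then obtain t where "poly (p * q * [:-c,1:]) t \<noteq> 0"
    using poly_all_0_iff_0 by blast
  then show ?thesis by (intro exI[of _ t]) auto
qed

lemma poly_of_coeffs:
  fixes c :: "nat \<Rightarrow> 'a::comm_ring_1"
  shows "\<exists>p. degree p \<le> N \<and> (\<forall>t. poly p t = (\<Sum>j\<le>N. c j * t ^ j)) \<and>
     (\<forall>j. coeff p j = (if j \<le> N then c j else 0))"
proof -
  define p where "p = (\<Sum>j\<le>N. monom (c j) j)"
  have "degree p \<le> N" unfolding p_def
    by (rule degree_sum_le) (auto intro: order.trans[OF degree_monom_le])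
  moreover have "poly p t = (\<Sum>j\<le>N. c j * t ^ j)" for t by (simp add: p_def poly_sum poly_monom)
  moreover have "coeff p j = (if j \<le> N then c j else 0)" for j
    by (simp add: p_def coeff_sum)
  ultimately show ?thesis by blast
qed

lemma poly_eq_except:
  fixes p q :: "'a::field_char_0 poly"
  assumes "\<And>t. t \<noteq> c \<Longrightarrow> poly p t = poly q t"
  shows "p = q"
proof (rule ccontr)
  assume "p \<noteq> q"
  then obtain a where "poly (p - q) a \<noteq> 0" using poly_all_0_iff_0[of "p - q"] by auto
  from poly_two_nonzero[OF this this, of c] show False using assms by auto
qed

text \<open>Used to restrict polynomial functions on a vector space to lines, where the theory of
  polynomials in one variable is available.\<close>
lemma generated_algebra_poly_curve:
  assumes "f \<in> generated_algebra \<Phi>"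
    and "\<And>\<phi>. \<phi> \<in> \<Phi> \<Longrightarrow> \<exists>a b. \<forall>t. \<phi> (\<gamma> t) = a + b * t"
  shows "\<exists>p. \<forall>t. f (\<gamma> t) = poly p (t::'a::comm_ring_1)"
proof (rule generated_algebra_id_poly, rule generated_algebra_pullback[OF assms(1)])
  fix \<phi> assume "\<phi> \<in> \<Phi>"
  then obtain a b where "\<forall>t. \<phi> (\<gamma> t) = a + b * t" using assms(2) by blast
  then have "(\<lambda>t. \<phi> (\<gamma> t)) = (\<lambda>t. a + b * t)" by auto
  then show "(\<lambda>t. \<phi> (\<gamma> t)) \<in> generated_algebra {\<lambda>t. t}"
    by (simp, intro generated_algebra.add generated_algebra.mult generated_algebra.const
          generated_algebra.gen) simp
qed

text \<open>Among the denominators \<open>q\<close> with \<open>\<phi> q = p\<close> for a polynomial \<open>p\<close>, one of minimal degree is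
  constant: at a root \<open>r\<close> of \<open>q\<close> the numerator vanishes as well, so that \<open>t - r\<close> can be cancelled
  from both. Away from \<open>r\<close> the cancelled identity is clear; at \<open>r\<close> it follows by comparison with
  a fraction whose denominator does not vanish at \<open>r\<close>.\<close>
lemma locally_fraction_imp_poly:
  fixes \<phi> :: "'a::{alg_closed_field,field_char_0} \<Rightarrow> 'a"
  assumes loc: "\<And>s. \<exists>p q. poly q s \<noteq> 0 \<and> (\<forall>t. \<phi> t * poly q t = poly p t)"
  shows "\<exists>p. \<forall>t. \<phi> t = poly p t"
proof -
  let ?R = "\<lambda>q. q \<noteq> 0 \<and> (\<exists>p. \<forall>t. \<phi> t * poly q t = poly p t)"
  obtain p0 q0 where "poly q0 0 \<noteq> 0" "\<forall>t. \<phi> t * poly q0 t = poly p0 t"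
    using loc[of 0] by blast
  then have q0: "?R q0" by (metis poly_0)
  define q where "q = (ARG_MIN degree q. ?R q)"
  have q: "?R q" and qmin: "\<And>q'. ?R q' \<Longrightarrow> degree q \<le> degree q'"
    unfolding q_def using arg_min_natI[of ?R, OF q0] arg_min_nat_le[of ?R] by blast+
  from q obtain p where p: "\<And>t. \<phi> t * poly q t = poly p t" by blast
  have "degree q = 0"
  proof (rule ccontr)
    assume "degree q \<noteq> 0"
    then obtain r where r: "poly q r = 0" using alg_closed_imp_poly_has_root[of q] by auto
    then have "poly p r = 0" using p[of r] by auto
    with r obtain q' p' where q': "q = [:-r,1:] * q'" and p': "p = [:-r,1:] * p'"
      by (auto simp: poly_eq_0_iff_dvd elim!: dvdE)
    from loc[of r] obtain p2 q2 where r2: "poly q2 r \<noteq> 0"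
      and pq2: "\<And>t. \<phi> t * poly q2 t = poly p2 t" by blast
    have off: "\<phi> t * poly q' t = poly p' t" if "t \<noteq> r" for t
    proof -
      have "(t - r) * (\<phi> t * poly q' t) = (t - r) * poly p' t"
        using p[of t] unfolding q' p' by (simp add: algebra_simps)
      then show ?thesis using that by simp
    qed
    have "p' * q2 = q' * p2"
    proof (rule poly_eq_except[of r])
      fix t assume "t \<noteq> r"
      show "poly (p' * q2) t = poly (q' * p2) t"
        using off[OF \<open>t \<noteq> r\<close>] pq2[of t] by (simp flip: pq2 off add: mult_ac)
    qed
    then have "poly p' r * poly q2 r = poly q' r * (\<phi> r * poly q2 r)"
      using pq2[of r] by (metis poly_mult)
    then have "\<phi> r * poly q' r = poly p' r" using r2 by auto
    with off have "?R q'" using q q' by (metis mult_zero_right)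
    from qmin[OF this] have "degree q \<le> degree q'" .
    moreover have "degree q = Suc (degree q')"
      using \<open>?R q'\<close> unfolding q' by (subst degree_mult_eq) auto
    ultimately show False by simp
  qed
  then obtain c where c: "q = [:c:]" by (auto elim: degree_eq_zeroE)
  with q have "c \<noteq> 0" by auto
  then have "\<forall>t. \<phi> t = poly (smult (inverse c) p) t" using p c by (auto simp: field_simps simp flip: p)
  then show ?thesis by blast
qed

definition lagrange_basis :: "nat \<Rightarrow> nat \<Rightarrow> 'a::field_char_0 poly" where
  "lagrange_basis D j = (\<Prod>i\<in>{..D} - {j}. smult (inverse (of_nat j - of_nat i)) [:- of_nat i, 1:])"

lemma lagrange_basis_value:
  assumes "j \<le> D" "i \<le> D"
  shows "poly (lagrange_basis D j) (of_nat i :: 'a::field_char_0) = (if i = j then 1 else 0)"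
proof (cases "i = j")
  case True
  have "poly (smult (inverse (of_nat j - of_nat k)) [:- of_nat k, 1:]) (of_nat j) = (1::'a)"
    if "k \<noteq> j" for k
  proof -
    have "poly (smult (inverse (of_nat j - of_nat k)) [:- of_nat k, 1:]) (of_nat j)
        = inverse (of_nat j - of_nat k) * (of_nat j - of_nat k :: 'a)"
      by (simp add: algebra_simps)
    with that show ?thesis by simp
  qed
  with True show ?thesis
    unfolding lagrange_basis_def poly_prod by (auto intro!: prod.neutral simp del: poly_smult)
next
  case False
  then show ?thesis using assms by (auto simp: lagrange_basis_def poly_prod intro!: prod_zero)
qed

lemma degree_lagrange_basis: "j \<le> D \<Longrightarrow> degree (lagrange_basis D j :: 'a::field_char_0 poly) \<le> D"
  unfolding lagrange_basis_def
  by (rule order.trans[OF degree_prod_sum_le])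
     (auto intro!: order.trans[OF sum_bounded_above[where K = 1]] order.trans[OF degree_smult_le])

lemma lagrange_interpolation:
  fixes p :: "'a::field_char_0 poly"
  assumes "degree p \<le> D"
  shows "p = (\<Sum>j\<le>D. smult (poly p (of_nat j)) (lagrange_basis D j))"
proof (rule poly_eqI_degree[of "of_nat ` {..D}"])
  show "poly p x = poly (\<Sum>j\<le>D. smult (poly p (of_nat j)) (lagrange_basis D j)) x"
    if "x \<in> of_nat ` {..D}" for x
  proof -
    from that obtain i where i: "i \<le> D" "x = of_nat i" by auto
    have "poly (\<Sum>j\<le>D. smult (poly p (of_nat j)) (lagrange_basis D j)) x
      = (\<Sum>j\<le>D. if j = i then poly p (of_nat j) else 0)"
      unfolding poly_sum using i by (intro sum.cong) (auto simp: lagrange_basis_value)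
    then show ?thesis using i by simp
  qed
  have "card (of_nat ` {..D} :: 'a set) = Suc D" by (subst card_image) (auto simp: inj_on_def)
  moreover have "degree (\<Sum>j\<le>D. smult (poly p (of_nat j)) (lagrange_basis D j)) \<le> D"
    by (intro degree_sum_le) (auto intro: degree_lagrange_basis)
  ultimately show "degree p < card (of_nat ` {..D} :: 'a set)"
    "degree (\<Sum>j\<le>D. smult (poly p (of_nat j)) (lagrange_basis D j)) < card (of_nat ` {..D} :: 'a set)"
    using assms by auto
qed

section \<open>Polynomial functions on a vector space\<close>

context linear_space
begin

abbreviation functional :: "('v \<Rightarrow> 'a) \<Rightarrow> bool" where
  "functional \<equiv> Vector_Spaces.linear scale (*)"

interpretation FF: vector_space "(*) :: 'a \<Rightarrow> 'a \<Rightarrow> 'a"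
  by unfold_locales (auto simp: algebra_simps)
interpretation VF: vector_space_pair scale "(*) :: 'a \<Rightarrow> 'a \<Rightarrow> 'a" ..

lemma functionalI:
  assumes "\<And>x y. \<phi> (x + y) = \<phi> x + \<phi> y" "\<And>c x. \<phi> (scale c x) = c * \<phi> x"
  shows "functional \<phi>"
  using assms by unfold_locales auto

lemma functionalD:
  assumes "functional \<phi>"
  shows "\<phi> (x + y) = \<phi> x + \<phi> y" "\<phi> (scale c x) = c * \<phi> x" "\<phi> 0 = 0"
    "\<phi> (x - y) = \<phi> x - \<phi> y" "\<phi> (sum h I) = (\<Sum>i\<in>I. \<phi> (h i))"
proof -
  interpret Vector_Spaces.linear scale "(*)" \<phi> by (rule assms)
  show "\<phi> (x + y) = \<phi> x + \<phi> y" "\<phi> (scale c x) = c * \<phi> x" "\<phi> 0 = 0"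
    "\<phi> (x - y) = \<phi> x - \<phi> y" "\<phi> (sum h I) = (\<Sum>i\<in>I. \<phi> (h i))"
    by (auto simp: add scale diff sum)
qed

lemma component_PiE: "component v \<in> (\<Pi>\<^sub>E e\<in>E. Vl e)"
  and sum_component: "(\<Sum>e\<in>E. component v e) = v"
  using theI'[OF direct_sum[of v]] unfolding component_def by auto

lemma component_in: "e \<in> E \<Longrightarrow> component v e \<in> Vl e"
  using component_PiE[of v] by auto

lemma component_unique:
  assumes "\<And>e. e \<in> E \<Longrightarrow> c e \<in> Vl e" "v = (\<Sum>e\<in>E. c e)" "e \<in> E"
  shows "component v e = c e"
proof -
  have "restrict c E \<in> (\<Pi>\<^sub>E e\<in>E. Vl e) \<and> v = (\<Sum>e\<in>E. restrict c E e)" using assms by auto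
  then have "component v = restrict c E"
    using direct_sum[of v] component_PiE[of v] sum_component[of v] by metis
  then show ?thesis using assms by simp
qed

lemma component_add: "e \<in> E \<Longrightarrow> component (v + w) e = component v e + component w e"
  by (rule component_unique[where c = "\<lambda>e. component v e + component w e"])
     (auto simp: sum.distrib sum_component component_in line_subspace subspace_add)

lemma component_scale: "e \<in> E \<Longrightarrow> component (scale c v) e = scale c (component v e)"
  by (rule component_unique[where c = "\<lambda>e. scale c (component v e)"])
     (auto simp: scale_sum_right[symmetric] sum_component component_in line_subspace subspace_scale)

definition bvec :: "'e \<Rightarrow> 'v" where
  "bvec e = (SOME b. b \<noteq> 0 \<and> Vl e = span {b})"

lemma bvec: assumes "e \<in> E" shows "bvec e \<noteq> 0" "Vl e = span {bvec e}"
proof -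
  obtain B where B: "B \<subseteq> Vl e" "independent B" "Vl e \<subseteq> span B" "card B = dim (Vl e)"
    using basis_exists by blast
  then obtain b where b: "B = {b}" using line_dim[OF assms] by (auto simp: card_1_singleton_iff)
  have "b \<noteq> 0 \<and> Vl e = span {b}"
    using B b line_subspace[OF assms] by (metis dependent_single span_subspace)
  then show "bvec e \<noteq> 0" "Vl e = span {bvec e}"
    unfolding bvec_def by (metis (mono_tags, lifting) someI)+
qed

definition coord :: "'e \<Rightarrow> 'v \<Rightarrow> 'a" where
  "coord e v = (THE c. component v e = scale c (bvec e))"

lemma component_coord: assumes "e \<in> E" shows "component v e = scale (coord e v) (bvec e)"
proof -
  have "component v e \<in> span {bvec e}" using component_in bvec assms by blast
  then obtain c where "component v e = scale c (bvec e)" by (auto simp: span_singleton)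
  then have "\<exists>!c. component v e = scale c (bvec e)" using bvec(1)[OF assms] by auto
  from theI'[OF this] show ?thesis unfolding coord_def .
qed

lemma component_eq_0_iff: "e \<in> E \<Longrightarrow> component v e = 0 \<longleftrightarrow> coord e v = 0"
  by (simp add: component_coord bvec)

lemma functional_coord: assumes "e \<in> E" shows "functional (coord e)"
proof (rule functionalI)
  show "coord e (x + y) = coord e x + coord e y" for x y
    using component_add[OF assms, of x y] bvec(1)[OF assms]
    by (simp add: component_coord assms flip: scale_left_distrib)
  show "coord e (scale c x) = c * coord e x" for c x
    using component_scale[OF assms, of c x] bvec(1)[OF assms]
    by (simp add: component_coord assms)
qed

lemma coord_add: "e \<in> E \<Longrightarrow> coord e (x + y) = coord e x + coord e y"
  and coord_scale: "e \<in> E \<Longrightarrow> coord e (scale c x) = c * coord e x"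
  and coord_diff: "e \<in> E \<Longrightarrow> coord e (x - y) = coord e x - coord e y"
  and coord_zero [simp]: "e \<in> E \<Longrightarrow> coord e 0 = 0"
  using functionalD[OF functional_coord] by auto

lemma coord_sum:
  assumes "e \<in> E" "finite S" "S \<subseteq> E"
  shows "coord e (\<Sum>i\<in>S. scale (c i) (bvec i)) = (if e \<in> S then c e else 0)"
proof -
  define c' where "c' i = (if i \<in> S then c i else 0)" for i
  have "(\<Sum>i\<in>S. scale (c i) (bvec i)) = (\<Sum>i\<in>E. scale (c' i) (bvec i))"
    unfolding c'_def using assms finite_E by (intro sum.mono_neutral_cong_left) auto
  then have "component (\<Sum>i\<in>S. scale (c i) (bvec i)) e = scale (c' e) (bvec e)"
    using assms bvec by (intro component_unique) (auto simp: span_base span_scale)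
  then show ?thesis using assms bvec by (auto simp: component_coord c'_def)
qed

lemma sum_coord: "(\<Sum>e\<in>E. scale (coord e v) (bvec e)) = v"
  using sum_component[of v] by (simp add: component_coord)

lemma coord_eqI: "(\<And>e. e \<in> E \<Longrightarrow> coord e v = coord e w) \<Longrightarrow> v = w"
  using sum_coord[of v] sum_coord[of w] by (metis (no_types, lifting) sum.cong)

lemma finite_independent: assumes "independent B" shows "finite B"
proof -
  have "v \<in> span (bvec ` E)" for v
    using sum_coord[of v] by (metis (no_types, lifting) image_eqI span_base span_scale span_sum)
  then show ?thesis using independent_span_bound[of "bvec ` E" B] assms finite_E by auto
qed

lemma exists_functional:
  assumes "independent B"
  shows "\<exists>\<phi>. functional \<phi> \<and> (\<forall>b\<in>B. \<phi> b = h b)"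
  using VF.linear_independent_extend[OF assms, of h] .

text \<open>Coordinates on a subspace that are restrictions of functionals on the whole space.\<close>
lemma dual_basis:
  assumes S: "subspace S"
  shows "\<exists>B \<kappa>. finite B \<and> B \<subseteq> S \<and> (\<forall>b\<in>B. functional (\<kappa> b)) \<and>
    (\<forall>x\<in>S. x = (\<Sum>b\<in>B. scale (\<kappa> b x) b))"
proof -
  obtain B where B: "B \<subseteq> S" "independent B" "S \<subseteq> span B" by (metis basis_exists)
  have fin: "finite B" using B(2) by (rule finite_independent)
  have "\<forall>b. \<exists>\<phi>. functional \<phi> \<and> (\<forall>b'\<in>B. \<phi> b' = (if b' = b then 1 else 0))"
    by (intro allI exists_functional[OF B(2)])
  then obtain \<kappa> where \<kappa>: "\<And>b. functional (\<kappa> b)"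
    and \<kappa>b: "\<And>b b'. b' \<in> B \<Longrightarrow> \<kappa> b b' = (if b' = b then 1 else 0)" by metis
  have "x = (\<Sum>b\<in>B. scale (\<kappa> b x) b)" if "x \<in> span B" for x
    using that
  proof (induction rule: span_induct_alt)
    case base
    show ?case by (simp add: functionalD(3)[OF \<kappa>])
  next
    case (step c x y)
    have "scale c x = (\<Sum>b\<in>B. if b = x then scale c b else 0)" using step fin by simp
    also have "\<dots> = (\<Sum>b\<in>B. scale (c * \<kappa> b x) b)"
      using step by (intro sum.cong) (auto simp: \<kappa>b)
    finally have 1: "scale c x = (\<Sum>b\<in>B. scale (c * \<kappa> b x) b)" .
    have "(\<Sum>b\<in>B. scale (\<kappa> b (scale c x + y)) b)
        = (\<Sum>b\<in>B. scale (c * \<kappa> b x) b) + (\<Sum>b\<in>B. scale (\<kappa> b y) b)"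
      by (simp add: functionalD(1,2)[OF \<kappa>] scale_left_distrib sum.distrib)
    also have "\<dots> = scale c x + y" using 1 step.IH by metis
    finally show ?case by (rule sym)
  qed
  with B fin \<kappa> show ?thesis by (intro exI[of _ B] exI[of _ \<kappa>]) auto
qed

abbreviation polyfuns :: "('v \<Rightarrow> 'a) set" where
  "polyfuns \<equiv> generated_algebra (Collect functional)"

lemma L_closed: "x \<in> L \<Longrightarrow> y \<in> L \<Longrightarrow> x + y \<in> L" "x \<in> L \<Longrightarrow> scale c x \<in> L"
  "x \<in> L \<Longrightarrow> y \<in> L \<Longrightarrow> x - y \<in> L" "0 \<in> L"
  using L_subspace by (auto simp: subspace_add subspace_scale subspace_diff subspace_0)

text \<open>Elements of \<open>L_dual\<close> are constrained on \<open>L\<close> only. Replacing them by functionals on the whole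
  space makes every function below total, without conditions of membership in \<open>L\<close>.\<close>
lemma generated_L_dual_extends:
  assumes "f \<in> generated_algebra L_dual"
  shows "\<exists>g\<in>polyfuns. \<forall>x\<in>L. f x = g x"
  using assms
proof induction
  case (const c) show ?case by (rule bexI[OF _ generated_algebra.const[of c]]) auto
next
  case (gen \<phi>)
  obtain B \<kappa> where B: "finite B" "B \<subseteq> L" "\<And>b. b \<in> B \<Longrightarrow> functional (\<kappa> b)"
    "\<And>x. x \<in> L \<Longrightarrow> x = (\<Sum>b\<in>B. scale (\<kappa> b x) b)"
    using dual_basis[OF L_subspace] by metis
  have sums0: "\<phi> (sum h S) = (\<Sum>b\<in>S. \<phi> (h b)) \<and> sum h S \<in> L"
    if "finite S" "\<And>b. b \<in> S \<Longrightarrow> h b \<in> L" for S and h :: "'v \<Rightarrow> 'v"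
    using that
  proof (induction S rule: finite_induct)
    case empty
    have "\<phi> (scale 0 0) = 0 * \<phi> 0" using gen L_closed unfolding L_dual_def by blast
    then show ?case using L_closed by simp
  next
    case (insert b S)
    then show ?case using gen L_closed unfolding L_dual_def by auto
  qed
  have sums: "\<phi> (\<Sum>b\<in>B. scale (\<kappa> b x) b) = (\<Sum>b\<in>B. \<phi> (scale (\<kappa> b x) b))" for x
    using sums0[OF B(1), of "\<lambda>b. scale (\<kappa> b x) b"] B(2) L_closed(2) by blast
  have "\<phi> x = (\<Sum>b\<in>B. \<kappa> b x * \<phi> b)" if "x \<in> L" for x
  proof -
    have "\<phi> x = (\<Sum>b\<in>B. \<phi> (scale (\<kappa> b x) b))" using B(4)[OF that] sums by metis
    also have "\<dots> = (\<Sum>b\<in>B. \<kappa> b x * \<phi> b)"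
      using B gen unfolding L_dual_def by (intro sum.cong) auto
    finally show ?thesis .
  qed
  moreover have "(\<lambda>x. \<Sum>b\<in>B. \<kappa> b x * \<phi> b) \<in> polyfuns"
    using B by (intro generated_algebra_sum generated_algebra.mult generated_algebra.gen
        generated_algebra.const) auto
  ultimately show ?case by (intro bexI) auto
next
  case (add f g)
  then obtain f' g' where "f' \<in> polyfuns" "\<forall>x\<in>L. f x = f' x" "g' \<in> polyfuns" "\<forall>x\<in>L. g x = g' x"
    by blast
  then show ?case by (intro bexI[OF _ generated_algebra.add[of f' _ g']]) auto
next
  case (mult f g)
  then obtain f' g' where "f' \<in> polyfuns" "\<forall>x\<in>L. f x = f' x" "g' \<in> polyfuns" "\<forall>x\<in>L. g x = g' x"
    by blast
  then show ?case by (intro bexI[OF _ generated_algebra.mult[of f' _ g']]) auto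
qed

lemma Sym_L_dual_iff: "f \<in> Sym_L_dual \<longleftrightarrow> (\<exists>g\<in>polyfuns. f = restrict g L)"
proof
  assume "f \<in> Sym_L_dual"
  then obtain h where h: "h \<in> generated_algebra L_dual" "f = restrict h L"
    unfolding Sym_L_dual_def by blast
  then obtain g where "g \<in> polyfuns" "\<forall>x\<in>L. h x = g x" using generated_L_dual_extends by blast
  with h show "\<exists>g\<in>polyfuns. f = restrict g L" by (metis restrict_ext)
next
  assume "\<exists>g\<in>polyfuns. f = restrict g L"
  moreover have "polyfuns \<subseteq> generated_algebra L_dual"
    by (auto intro!: generated_algebra_mono[where \<Phi> = "Collect functional"] simp: L_dual_def functionalD)
  ultimately show "f \<in> Sym_L_dual" unfolding Sym_L_dual_def by blast
qed

text \<open>The coefficients are again polynomial functions of the base point; this is what later allows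
  them to be used as functions on a chart. They are required to vanish above \<open>N\<close> so that two
  expansions can be multiplied by the Cauchy product.\<close>
lemma polyfun_expand_along:
  assumes "f \<in> polyfuns"
  shows "\<exists>N c. (\<forall>j. c j \<in> polyfuns) \<and> (\<forall>j>N. \<forall>y. c j y = 0) \<and>
    (\<forall>y t. f (y + scale t \<alpha>) = (\<Sum>j\<le>N. c j y * t ^ j))"
  using assms
proof induction
  case (const a)
  show ?case
    by (intro exI[of _ 0] exI[of _ "\<lambda>j y. if j = 0 then a else 0"])
       (auto intro: generated_algebra.const)
next
  case (gen \<phi>)
  have "(\<lambda>y. if j = 0 then \<phi> y else if j = 1 then \<phi> \<alpha> else 0) \<in> polyfuns" for j :: nat
    using gen by (cases "j = 0"; cases "j = 1") (auto intro: generated_algebra.const generated_algebra.gen)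
  with gen show ?case
    by (intro exI[of _ 1] exI[of _ "\<lambda>j y. if j = 0 then \<phi> y else if j = 1 then \<phi> \<alpha> else 0"])
       (auto simp: functionalD)
next
  case (add f g)
  from add.IH(1) obtain N c where C: "(\<forall>j. c j \<in> polyfuns) \<and> (\<forall>j>N. \<forall>y. c j y = 0) \<and>
    (\<forall>y t. f (y + scale t \<alpha>) = (\<Sum>j\<le>N. c j y * t ^ j))" by (elim exE)
  from add.IH(2) obtain M d where D: "(\<forall>j. d j \<in> polyfuns) \<and> (\<forall>j>M. \<forall>y. d j y = 0) \<and>
    (\<forall>y t. g (y + scale t \<alpha>) = (\<Sum>j\<le>M. d j y * t ^ j))" by (elim exE)
  have c: "\<And>j. c j \<in> polyfuns" "\<And>j y. j > N \<Longrightarrow> c j y = 0"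
    "\<And>y t. f (y + scale t \<alpha>) = (\<Sum>j\<le>N. c j y * t ^ j)" using C by auto
  have d: "\<And>j. d j \<in> polyfuns" "\<And>j y. j > M \<Longrightarrow> d j y = 0"
    "\<And>y t. g (y + scale t \<alpha>) = (\<Sum>j\<le>M. d j y * t ^ j)" using D by auto
  have 1: "(\<Sum>j\<le>N. c j y * t ^ j) = (\<Sum>j\<le>max N M. c j y * t ^ j)" for y t
    by (rule sum.mono_neutral_left) (auto simp: c(2))
  have 2: "(\<Sum>j\<le>M. d j y * t ^ j) = (\<Sum>j\<le>max N M. d j y * t ^ j)" for y t
    by (rule sum.mono_neutral_left) (auto simp: d(2))
  show ?case
    by (intro exI[of _ "max N M"] exI[of _ "\<lambda>j y. c j y + d j y"])
       (auto simp: c d 1 2 distrib_right sum.distrib intro: generated_algebra.add)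
next
  case (mult f g)
  from mult.IH(1) obtain N c where C: "(\<forall>j. c j \<in> polyfuns) \<and> (\<forall>j>N. \<forall>y. c j y = 0) \<and>
    (\<forall>y t. f (y + scale t \<alpha>) = (\<Sum>j\<le>N. c j y * t ^ j))" by (elim exE)
  from mult.IH(2) obtain M d where D: "(\<forall>j. d j \<in> polyfuns) \<and> (\<forall>j>M. \<forall>y. d j y = 0) \<and>
    (\<forall>y t. g (y + scale t \<alpha>) = (\<Sum>j\<le>M. d j y * t ^ j))" by (elim exE)
  have c: "\<And>j. c j \<in> polyfuns" "\<And>j y. j > N \<Longrightarrow> c j y = 0"
    "\<And>y t. f (y + scale t \<alpha>) = (\<Sum>j\<le>N. c j y * t ^ j)" using C by auto
  have d: "\<And>j. d j \<in> polyfuns" "\<And>j y. j > M \<Longrightarrow> d j y = 0"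
    "\<And>y t. g (y + scale t \<alpha>) = (\<Sum>j\<le>M. d j y * t ^ j)" using D by auto
  have "(\<Sum>k\<le>j. c k y * d (j - k) y) = 0" if "j > N + M" for j y
  proof (rule sum.neutral, rule ballI)
    fix k assume "k \<in> {..j}"
    then have "k > N \<or> j - k > M" using that by auto
    then show "c k y * d (j - k) y = 0" using c(2) d(2) by auto
  qed
  moreover have "f (y + scale t \<alpha>) * g (y + scale t \<alpha>)
      = (\<Sum>j\<le>N + M. (\<Sum>k\<le>j. c k y * d (j - k) y) * t ^ j)" for y t
    unfolding c(3) d(3) by (rule polynomial_product) (auto simp: c d)
  ultimately show ?case
    by (intro exI[of _ "N + M"] exI[of _ "\<lambda>j y. \<Sum>k\<le>j. c k y * d (j - k) y"])
       (auto intro!: generated_algebra_sum generated_algebra.mult c(1) d(1))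
qed

text \<open>The bound \<open>D\<close> depends on the direction but not on the base point.\<close>
lemma polyfun_line:
  assumes "f \<in> polyfuns"
  shows "\<exists>D. \<forall>x. \<exists>p. degree p \<le> D \<and> (\<forall>t. f (x + scale t \<alpha>) = poly p t)"
proof -
  obtain N c where "\<And>y t. f (y + scale t \<alpha>) = (\<Sum>j\<le>N. c j y * t ^ j)"
    using polyfun_expand_along[OF assms] by metis
  then show ?thesis using poly_of_coeffs by metis
qed

text \<open>The variety \<open>L\<close> is irreducible: both functions restrict to nonzero polynomials on the line
  that joins the two points.\<close>
lemma polyfuns_nonzero_together:
  assumes "f \<in> polyfuns" "g \<in> polyfuns" "x \<in> L" "y \<in> L" "f x \<noteq> 0" "g y \<noteq> 0"
  shows "\<exists>z\<in>L. f z \<noteq> 0 \<and> g z \<noteq> 0"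
proof -
  obtain p where p: "\<And>t. f (x + scale t (y - x)) = poly p t" using polyfun_line[OF assms(1)] by metis
  obtain q where q: "\<And>t. g (x + scale t (y - x)) = poly q t" using polyfun_line[OF assms(2)] by metis
  have "poly p 0 \<noteq> 0" "poly q 1 \<noteq> 0" using p[of 0] q[of 1] assms by auto
  from poly_two_nonzero[OF this] obtain t where "poly p t \<noteq> 0" "poly q t \<noteq> 0" by blast
  then show ?thesis using assms by (intro bexI[of _ "x + scale t (y - x)"]) (auto simp: p q L_closed)
qed

text \<open>Lagrange interpolation in one basis direction after the other: for a direction \<open>b\<close>, the
  function is a combination of its values on the slices through the points \<open>j b\<close>, with
  coefficients that are polynomials in the coordinate \<open>\<kappa> b\<close>. The number of slices is
  finite because the degree on lines parallel to \<open>b\<close> is bounded.\<close>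
lemma polyfun_of_bounded_lines:
  assumes "finite B" "B \<subseteq> L" "\<And>b. b \<in> B \<Longrightarrow> functional (\<kappa> b)"
    and "\<And>b. b \<in> B \<Longrightarrow> \<exists>D. \<forall>x\<in>L. \<exists>p. degree p \<le> D \<and> (\<forall>t. f (x + scale t b) = poly p t)"
    and "z \<in> L"
  shows "(\<lambda>x. f (z + (\<Sum>b\<in>B. scale (\<kappa> b x) b))) \<in> polyfuns"
  using assms
proof (induction B arbitrary: z rule: finite_induct)
  case empty
  show ?case by (simp add: generated_algebra.const)
next
  case (insert b B)
  from insert.prems(3)[of b] obtain D where
    D: "\<And>x. x \<in> L \<Longrightarrow> \<exists>p. degree p \<le> D \<and> (\<forall>t. f (x + scale t b) = poly p t)" by auto
  have expand: "f (x + scale t b) = (\<Sum>j\<le>D. f (x + scale (of_nat j) b) * poly (lagrange_basis D j) t)"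
    if "x \<in> L" for x t
  proof -
    from D[OF that] obtain p where p: "degree p \<le> D" "\<And>t. f (x + scale t b) = poly p t" by blast
    show ?thesis
      by (subst p(2), subst lagrange_interpolation[OF p(1)]) (simp add: poly_sum p(2))
  qed
  have in_L: "(\<Sum>b\<in>B. scale (\<kappa> b x) b) \<in> L" for x
    using insert.prems(1) L_subspace by (auto intro!: subspace_sum simp: L_closed)
  have "f (z + (\<Sum>b\<in>insert b B. scale (\<kappa> b x) b)) =
     (\<Sum>j\<le>D. f ((z + scale (of_nat j) b) + (\<Sum>b\<in>B. scale (\<kappa> b x) b)) * poly (lagrange_basis D j) (\<kappa> b x))"
    for x
    using expand[of "z + (\<Sum>b\<in>B. scale (\<kappa> b x) b)" "\<kappa> b x"] insert in_L[of x]
    by (simp add: L_closed algebra_simps)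
  moreover have "(\<lambda>x. f ((z + scale (of_nat j) b) + (\<Sum>b\<in>B. scale (\<kappa> b x) b))) \<in> polyfuns" for j
    using insert.prems by (intro insert.IH) (auto simp: L_closed)
  moreover have "\<kappa> b \<in> polyfuns" using insert.prems by (auto intro: generated_algebra.gen)
  ultimately show ?case
    by (auto intro!: generated_algebra_sum generated_algebra.mult generated_algebra_poly)
qed

text \<open>On a line that is not contained in the zero set of \<open>h\<close>, the identity \<open>f h = g\<close> bounds the
  degree of \<open>f\<close> by that of \<open>g\<close>, and the interpolation formula with \<open>D + 1\<close> nodes holds. Moving an
  arbitrary line towards the point \<open>x0\<close> with parameter \<open>s\<close> turns both sides of the formula into
  polynomials in \<open>s\<close> that agree for all but finitely many \<open>s\<close>, hence also for \<open>s = 0\<close>.\<close>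
lemma bounded_degree_along:
  assumes lines: "\<And>x v. x \<in> L \<Longrightarrow> v \<in> L \<Longrightarrow> \<exists>p. \<forall>t. f (x + scale t v) = poly p t"
    and g: "g \<in> polyfuns" and h: "h \<in> polyfuns" and fhg: "\<And>x. x \<in> L \<Longrightarrow> f x * h x = g x"
    and x0: "x0 \<in> L" "h x0 \<noteq> 0" and \<alpha>: "\<alpha> \<in> L"
  shows "\<exists>D. \<forall>x\<in>L. \<exists>p. degree p \<le> D \<and> (\<forall>t. f (x + scale t \<alpha>) = poly p t)"
proof -
  from polyfun_line[OF g] obtain D where
    D: "\<And>x. \<exists>p. degree p \<le> D \<and> (\<forall>t. g (x + scale t \<alpha>) = poly p t)" by metis
  have generic: "f (x + scale t \<alpha>) = (\<Sum>j\<le>D. f (x + scale (of_nat j) \<alpha>) * poly (lagrange_basis D j) t)"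
    if x: "x \<in> L" "h x \<noteq> 0" for x t
  proof -
    obtain p where p: "\<And>t. f (x + scale t \<alpha>) = poly p t" using lines[OF x(1) \<alpha>] by blast
    obtain q where q: "\<And>t. h (x + scale t \<alpha>) = poly q t" using polyfun_line[OF h] by metis
    obtain r where r: "degree r \<le> D" "\<And>t. g (x + scale t \<alpha>) = poly r t" using D by metis
    have "p * q = r"
    proof (rule poly_eq_except)
      fix t show "poly (p * q) t = poly r t"
        using fhg[of "x + scale t \<alpha>"] x \<alpha> by (simp add: L_closed flip: p q r(2))
    qed
    moreover have "q \<noteq> 0" using q[of 0] x by auto
    ultimately have deg: "degree p \<le> D" using r(1) by (cases "p = 0") (auto simp: degree_mult_eq)
    show ?thesis
      by (subst p, subst lagrange_interpolation[OF deg]) (simp add: poly_sum p)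
  qed
  have all: "f (x + scale t \<alpha>) = (\<Sum>j\<le>D. f (x + scale (of_nat j) \<alpha>) * poly (lagrange_basis D j) t)"
    if x: "x \<in> L" for x t
  proof -
    define v where "v = x0 - x"
    have v: "v \<in> L" using x x0 by (simp add: v_def L_closed)
    have "\<exists>p. \<forall>s. f ((x + scale s v) + scale t' \<alpha>) = poly p s" for t'
      using lines[of "x + scale t' \<alpha>" v] x v \<alpha> by (simp add: L_closed add_ac)
    then obtain P where P: "\<And>t' s. f ((x + scale s v) + scale t' \<alpha>) = poly (P t') s" by metis
    obtain q where q: "\<And>s. h (x + scale s v) = poly q s" using polyfun_line[OF h] by metis
    define R where "R = P t - (\<Sum>j\<le>D. smult (poly (lagrange_basis D j) t) (P (of_nat j)))"
    \<comment> \<open>Where \<open>q\<close> does not vanish, the interpolation formula has been shown already.\<close>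
    have "R * q = 0"
    proof (rule poly_eq_except)
      fix s
      show "poly (R * q) s = poly 0 s"
      proof (cases "poly q s = 0")
        case False
        have "x + scale s v \<in> L" using x v by (simp add: L_closed)
        from generic[OF this, of t] False have "poly R s = 0"
          by (simp add: q R_def poly_sum P mult.commute)
        then show ?thesis by simp
      qed simp
    qed
    moreover have "q \<noteq> 0" using q[of 1] x0 by (auto simp: v_def)
    ultimately have "poly R 0 = 0" by simp
    then show ?thesis using P[where s = 0] by (simp add: R_def poly_sum mult.commute)
  qed
  have "\<exists>p. degree p \<le> D \<and> (\<forall>t. f (x + scale t \<alpha>) = poly p t)" if "x \<in> L" for x
  proof (intro exI conjI allI)
    let ?p = "\<Sum>j\<le>D. smult (f (x + scale (of_nat j) \<alpha>)) (lagrange_basis D j)"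
    show "degree ?p \<le> D"
      by (rule degree_sum_le) (auto intro: order.trans[OF degree_smult_le] degree_lagrange_basis)
    show "f (x + scale t \<alpha>) = poly ?p t" for t using all[OF that, of t] by (simp add: poly_sum)
  qed
  then show ?thesis by blast
qed

text \<open>On every line the function is a polynomial by \<open>locally_fraction_imp_poly\<close>; the degrees are bounded in each
  direction, because near one point the function is a fixed fraction; and interpolation
  assembles these polynomials.\<close>
theorem locally_fraction_imp_polyfun:
  assumes loc: "\<And>x0. x0 \<in> L \<Longrightarrow> \<exists>g\<in>polyfuns. \<exists>h\<in>polyfuns. h x0 \<noteq> 0 \<and> (\<forall>x\<in>L. f x * h x = g x)"
  shows "\<exists>g\<in>polyfuns. \<forall>x\<in>L. f x = g x"
proof -
  have lines: "\<exists>p. \<forall>t. f (x + scale t v) = poly p t" if xv: "x \<in> L" "v \<in> L" for x v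
  proof (rule locally_fraction_imp_poly)
    fix s
    from xv obtain g h where gh: "g \<in> polyfuns" "h \<in> polyfuns" "h (x + scale s v) \<noteq> 0"
      "\<forall>x\<in>L. f x * h x = g x" using loc[of "x + scale s v"] L_closed(1,2) by blast
    obtain p where p: "\<And>t. g (x + scale t v) = poly p t" using polyfun_line[OF gh(1)] by metis
    obtain q where q: "\<And>t. h (x + scale t v) = poly q t" using polyfun_line[OF gh(2)] by metis
    show "\<exists>p q. poly q s \<noteq> 0 \<and> (\<forall>t. f (x + scale t v) * poly q t = poly p t)"
      using gh xv by (intro exI[of _ p] exI[of _ q]) (auto simp: L_closed simp flip: p q)
  qed
  obtain g h where gh: "g \<in> polyfuns" "h \<in> polyfuns" "h 0 \<noteq> 0" "\<forall>x\<in>L. f x * h x = g x"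
    using loc[of 0] L_closed(4) by blast
  obtain B \<kappa> where B: "finite B" "B \<subseteq> L" "\<And>b. b \<in> B \<Longrightarrow> functional (\<kappa> b)"
    "\<And>x. x \<in> L \<Longrightarrow> x = (\<Sum>b\<in>B. scale (\<kappa> b x) b)"
    using dual_basis[OF L_subspace] by metis
  have "(\<lambda>x. f (0 + (\<Sum>b\<in>B. scale (\<kappa> b x) b))) \<in> polyfuns"
  proof (rule polyfun_of_bounded_lines)
    fix b assume "b \<in> B"
    then show "\<exists>D. \<forall>x\<in>L. \<exists>p. degree p \<le> D \<and> (\<forall>t. f (x + scale t b) = poly p t)"
      using bounded_degree_along[OF lines gh(1,2) bspec[OF gh(4)] L_closed(4) gh(3)] B(2) by blast
  qed (use B L_closed in auto)
  then show ?thesis using B(4) by (intro bexI) auto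
qed

end

section \<open>Zariski topology and regular functions\<close>

context linear_space
begin

text \<open>Homogeneous coordinates of \<open>P\<close> whose second entries are 0 or 1. Conditions on all lifts of a
  point are tested on this one.\<close>
definition std_lift :: "('e \<Rightarrow> 'v proj_point) \<Rightarrow> 'v \<times> ('e \<Rightarrow> 'a)" where
  "std_lift P = (\<Sum>e\<in>E. case P e of Fin v \<Rightarrow> v | Infty \<Rightarrow> bvec e, \<lambda>e. if P e = Infty then 0 else 1)"

lemma homog_coord_ring_cong:
  assumes "G \<in> homog_coord_ring" "\<And>e. e \<in> E \<Longrightarrow> s e = s' e"
  shows "G (v, s) = G (v, s')"
  using assms(1) unfolding homog_coord_ring_def
  by (induction rule: generated_algebra.induct) (use assms(2) in auto)

lemma component_std_lift:
  assumes "P \<in> PA" "e \<in> E"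
  shows "component (fst (std_lift P)) e = (case P e of Fin v \<Rightarrow> v | Infty \<Rightarrow> bvec e)"
proof (rule component_unique[where c = "\<lambda>e. case P e of Fin v \<Rightarrow> v | Infty \<Rightarrow> bvec e"])
  fix i assume "i \<in> E"
  then have "P i \<in> insert Infty (Fin ` Vl i)" using assms unfolding PA_def by auto
  then show "(case P i of Fin v \<Rightarrow> v | Infty \<Rightarrow> bvec i) \<in> Vl i"
    using span_base[of "bvec i" "{bvec i}"] bvec(2)[OF \<open>i \<in> E\<close>] by (cases "P i") auto
qed (auto simp: std_lift_def assms)

lemma is_lift_std_lift:
  assumes "P \<in> PA" shows "is_lift P (std_lift P)"
proof -
  have "(component (fst (std_lift P)) e \<noteq> 0 \<or> snd (std_lift P) e \<noteq> 0) \<and>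
     P e = (if snd (std_lift P) e = 0 then Infty
            else Fin (scale (inverse (snd (std_lift P) e)) (component (fst (std_lift P)) e)))" if "e \<in> E" for e
    using component_std_lift[OF assms that] bvec(1)[OF that]
    by (cases "P e") (auto simp: std_lift_def)
  then show ?thesis unfolding is_lift_def by (auto simp: case_prod_beta)
qed

lemma lifts_proportional:
  assumes "is_lift P (v, s)" "is_lift P (v', s')"
  shows "\<exists>c. \<forall>e\<in>E. c e \<noteq> 0 \<and> component v' e = scale (c e) (component v e) \<and> s' e = c e * s e"
proof -
  have "\<exists>c. c \<noteq> 0 \<and> component v' e = scale c (component v e) \<and> s' e = c * s e" if e: "e \<in> E" for e
  proof (cases "s e = 0")
    case True
    have 1: "component v e \<noteq> 0" "P e = Infty" using True assms(1) e by (auto simp: is_lift_def)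
    then have 2: "s' e = 0" "component v' e \<noteq> 0"
      using assms(2) e by (auto simp: is_lift_def split: if_splits)
    show ?thesis
      using 1 2 True e
      by (intro exI[of _ "coord e v' / coord e v"]) (auto simp: component_coord)
  next
    case False
    have "P e = Fin (scale (inverse (s e)) (component v e))"
      using False assms(1) e by (auto simp: is_lift_def)
    moreover have s': "s' e \<noteq> 0" using assms(2) e calculation by (auto simp: is_lift_def)
    moreover have "P e = Fin (scale (inverse (s' e)) (component v' e))"
      using s' assms(2) e by (auto simp: is_lift_def)
    ultimately have "scale (inverse (s' e)) (component v' e) = scale (inverse (s e)) (component v e)"
      by simp
    then have "scale (s' e) (scale (inverse (s' e)) (component v' e))
       = scale (s' e) (scale (inverse (s e)) (component v e))" by simp
    then have "component v' e = scale (s' e / s e) (component v e)" using s'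
      by (simp add: divide_inverse)
    then show ?thesis using s' False by (intro exI[of _ "s' e / s e"]) auto
  qed
  then show ?thesis by metis
qed

text \<open>The factor \<open>\<kappa>\<close> depends on the multidegree only. So the vanishing of a multihomogeneous function,
  and the quotient of two functions of the same multidegree, do not depend on the lift.\<close>
lemma multihomogeneous_lifts:
  assumes "is_lift P z" "is_lift P z'"
  shows "\<exists>\<kappa>. (\<forall>d. \<kappa> d \<noteq> 0) \<and> (\<forall>G d. multihomogeneous d G \<longrightarrow> G z' = \<kappa> d * G z)"
proof -
  obtain v s v' s' where z: "z = (v, s)" "z' = (v', s')" by (cases z, cases z') auto
  with assms obtain c where c: "\<And>e. e \<in> E \<Longrightarrow> c e \<noteq> 0"
    "\<And>e. e \<in> E \<Longrightarrow> component v' e = scale (c e) (component v e)" "\<And>e. e \<in> E \<Longrightarrow> s' e = c e * s e"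
    using lifts_proportional by metis
  have v': "v' = (\<Sum>e\<in>E. scale (c e) (component v e))"
    using sum_component[of v'] c(2) by (metis (no_types, lifting) sum.cong)
  have "G z' = (\<Prod>e\<in>E. c e ^ d e) * G z" if "multihomogeneous d G" for G d
  proof -
    have "G z' = G (v', \<lambda>e. c e * s e)"
      using homog_coord_ring_cong[of G s' "\<lambda>e. c e * s e" v'] that c(3)
      unfolding multihomogeneous_def z by blast
    then show ?thesis using that unfolding multihomogeneous_def z v' by metis
  qed
  moreover have "(\<Prod>e\<in>E. c e ^ d e) \<noteq> 0" for d using c(1) finite_E by auto
  ultimately show ?thesis by (intro exI[of _ "\<lambda>d. \<Prod>e\<in>E. c e ^ d e"]) auto
qed

lemma multihomogeneous_one: "multihomogeneous (\<lambda>_. 0) (\<lambda>_. 1)"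
  unfolding multihomogeneous_def homog_coord_ring_def by (auto intro: generated_algebra.const)

lemma multihomogeneous_mult:
  assumes "multihomogeneous d G" "multihomogeneous d' G'"
  shows "multihomogeneous (\<lambda>e. d e + d' e) (\<lambda>z. G z * G' z)"
  using assms unfolding multihomogeneous_def homog_coord_ring_def
  by (auto intro: generated_algebra.mult simp: power_add prod.distrib)

lemma multihomogeneous_add:
  assumes "multihomogeneous d G" "multihomogeneous d G'"
  shows "multihomogeneous d (\<lambda>z. G z + G' z)"
  using assms unfolding multihomogeneous_def homog_coord_ring_def
  by (auto intro: generated_algebra.add simp: distrib_left)

lemma multihomogeneous_cmult:
  assumes "multihomogeneous d G"
  shows "multihomogeneous d (\<lambda>z. c * G z)"
  using assms unfolding multihomogeneous_def homog_coord_ring_def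
  by (auto intro: generated_algebra_cmult)

lemma basic_open_eq:
  assumes "multihomogeneous d G"
  shows "{P \<in> PA. \<forall>z. is_lift P z \<longrightarrow> G z \<noteq> 0} = {P \<in> PA. G (std_lift P) \<noteq> 0}"
  using is_lift_std_lift multihomogeneous_lifts assms by (smt (verit) Collect_cong mult_eq_0_iff)

lemma topspace_zariski: "topspace zariski = PA"
proof -
  have "PA = {P \<in> PA. \<forall>z. is_lift P z \<longrightarrow> (\<lambda>_. 1::'a) z \<noteq> 0}" by auto
  then have "PA \<in> {{P \<in> PA. \<forall>z. is_lift P z \<longrightarrow> G z \<noteq> 0} | G d. multihomogeneous d G}"
    using multihomogeneous_one by (intro CollectI exI[of _ "\<lambda>_. 1"] exI[of _ "\<lambda>_. 0"] conjI)
  then show ?thesis unfolding zariski_def topology_generated_by_topspace by auto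
qed

text \<open>The sets that generate the topology are closed under intersection, because the product of
  multihomogeneous functions is multihomogeneous; they form a basis.\<close>
lemma openin_zariski_iff:
  "openin zariski T \<longleftrightarrow> T \<subseteq> PA \<and> (\<forall>P\<in>T. \<exists>G d. multihomogeneous d G \<and> G (std_lift P) \<noteq> 0 \<and>
     (\<forall>Q\<in>PA. G (std_lift Q) \<noteq> 0 \<longrightarrow> Q \<in> T))" (is "_ \<longleftrightarrow> ?R T")
proof
  assume T: "openin zariski T"
  then have "generate_topology_on {{P \<in> PA. \<forall>z. is_lift P z \<longrightarrow> G z \<noteq> 0} | G d. multihomogeneous d G} T"
    unfolding zariski_def openin_topology_generated_by_iff .
  then have "\<forall>P\<in>T. \<exists>G d. multihomogeneous d G \<and> G (std_lift P) \<noteq> 0 \<and> (\<forall>Q\<in>PA. G (std_lift Q) \<noteq> 0 \<longrightarrow> Q \<in> T)"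
  proof induction
    case (Int a b)
    show ?case
    proof
      fix P assume "P \<in> a \<inter> b"
      then have P: "P \<in> a" "P \<in> b" by auto
      obtain G d where G: "multihomogeneous d G" "G (std_lift P) \<noteq> 0" "\<forall>Q\<in>PA. G (std_lift Q) \<noteq> 0 \<longrightarrow> Q \<in> a"
        using bspec[OF Int.IH(1) P(1)] by (elim exE conjE) (rule that)
      obtain G' d' where G': "multihomogeneous d' G'" "G' (std_lift P) \<noteq> 0" "\<forall>Q\<in>PA. G' (std_lift Q) \<noteq> 0 \<longrightarrow> Q \<in> b"
        using bspec[OF Int.IH(2) P(2)] by (elim exE conjE) (rule that)
      show "\<exists>G d. multihomogeneous d G \<and> G (std_lift P) \<noteq> 0 \<and> (\<forall>Q\<in>PA. G (std_lift Q) \<noteq> 0 \<longrightarrow> Q \<in> a \<inter> b)"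
        using multihomogeneous_mult[OF G(1) G'(1)] G(2,3) G'(2,3)
        by (intro exI[of _ "\<lambda>z. G z * G' z"] exI[of _ "\<lambda>e. d e + d' e"]) auto
    qed
  next
    case (Basis S)
    then obtain G d where "multihomogeneous d G" "S = {P \<in> PA. G (std_lift P) \<noteq> 0}"
      using basic_open_eq by auto
    then show ?case by blast
  next
    case Empty
    show ?case by simp
  next
    case (UN K)
    show ?case
    proof
      fix P assume "P \<in> \<Union>K"
      then obtain k where k: "k \<in> K" "P \<in> k" by blast
      obtain G d where G: "multihomogeneous d G" "G (std_lift P) \<noteq> 0" "\<forall>Q\<in>PA. G (std_lift Q) \<noteq> 0 \<longrightarrow> Q \<in> k"
        using bspec[OF UN.IH[OF k(1)] k(2)] by (elim exE conjE) (rule that)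
      then show "\<exists>G d. multihomogeneous d G \<and> G (std_lift P) \<noteq> 0 \<and> (\<forall>Q\<in>PA. G (std_lift Q) \<noteq> 0 \<longrightarrow> Q \<in> \<Union>K)"
        using k(1) by (intro exI[of _ G] exI[of _ d]) auto
    qed
  qed
  then show "?R T" using openin_subset[OF T] topspace_zariski by auto
next
  assume R: "?R T"
  have "\<exists>S. openin zariski S \<and> P \<in> S \<and> S \<subseteq> T" if "P \<in> T" for P
  proof -
    note * = R[THEN conjunct2, THEN bspec, OF that]
    obtain G d where G: "multihomogeneous d G" "G (std_lift P) \<noteq> 0" "\<forall>Q\<in>PA. G (std_lift Q) \<noteq> 0 \<longrightarrow> Q \<in> T"
      using * by (elim exE conjE) (rule that)
    have "openin zariski {P \<in> PA. \<forall>z. is_lift P z \<longrightarrow> G z \<noteq> 0}"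
      unfolding zariski_def using G(1)
      by (intro topology_generated_by_Basis CollectI exI[of _ G] exI[of _ d] conjI refl)
    then show ?thesis using G(2,3) R that unfolding basic_open_eq[OF G(1)]
      by (intro exI[of _ "{P \<in> PA. G (std_lift P) \<noteq> 0}"]) auto
  qed
  then show "openin zariski T" by (subst openin_subopen) simp
qed

lemma embed_PA: "embed x \<in> PA"
  using component_in unfolding embed_def PA_def by auto

lemma Y_subset: "Y \<subseteq> PA"
  unfolding Y_def using closure_of_subset_topspace topspace_zariski by metis

lemma embed_Y: "x \<in> L \<Longrightarrow> embed x \<in> Y"
  unfolding Y_def using closure_of_subset[of "embed ` L" zariski] embed_PA topspace_zariski by auto

lemma open_Y_iff:
  "open_Y W \<longleftrightarrow> W \<subseteq> Y \<and> (\<forall>P\<in>W. \<exists>G d. multihomogeneous d G \<and> G (std_lift P) \<noteq> 0 \<and>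
     (\<forall>Q\<in>Y. G (std_lift Q) \<noteq> 0 \<longrightarrow> Q \<in> W))" (is "_ \<longleftrightarrow> ?R W")
proof
  assume "open_Y W"
  then obtain T where T: "openin zariski T" "W = T \<inter> Y"
    unfolding open_Y_def openin_subtopology by auto
  show "?R W"
  proof (intro conjI ballI)
    show "W \<subseteq> Y" using T by auto
    fix P assume "P \<in> W"
    then have "P \<in> T" using T(2) by simp
    obtain G d where "multihomogeneous d G" "G (std_lift P) \<noteq> 0" "\<forall>Q\<in>PA. G (std_lift Q) \<noteq> 0 \<longrightarrow> Q \<in> T"
      using T(1)[unfolded openin_zariski_iff, THEN conjunct2, THEN bspec, OF \<open>P \<in> T\<close>]
      by (elim exE conjE) (rule that)
    then show "\<exists>G d. multihomogeneous d G \<and> G (std_lift P) \<noteq> 0 \<and> (\<forall>Q\<in>Y. G (std_lift Q) \<noteq> 0 \<longrightarrow> Q \<in> W)"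
      using T(2) Y_subset by (intro exI[of _ G] exI[of _ d]) auto
  qed
next
  assume R: "?R W"
  define T where "T = {P \<in> PA. \<exists>G d. multihomogeneous d G \<and> G (std_lift P) \<noteq> 0 \<and>
     (\<forall>Q\<in>Y. G (std_lift Q) \<noteq> 0 \<longrightarrow> Q \<in> W)}"
  have "openin zariski T" unfolding openin_zariski_iff
  proof (intro conjI ballI)
    show "T \<subseteq> PA" unfolding T_def by simp
    fix P assume "P \<in> T"
    then obtain G d where G: "multihomogeneous d G" "G (std_lift P) \<noteq> 0" "\<forall>Q\<in>Y. G (std_lift Q) \<noteq> 0 \<longrightarrow> Q \<in> W"
      unfolding T_def mem_Collect_eq by (elim exE conjE) (rule that)
    have "\<forall>Q\<in>PA. G (std_lift Q) \<noteq> 0 \<longrightarrow> Q \<in> T"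
      unfolding T_def
    proof (intro ballI impI CollectI conjI)
      fix Q assume "Q \<in> PA" "G (std_lift Q) \<noteq> 0"
      with G(1,3) show "\<exists>G d. multihomogeneous d G \<and> G (std_lift Q) \<noteq> 0 \<and> (\<forall>Q\<in>Y. G (std_lift Q) \<noteq> 0 \<longrightarrow> Q \<in> W)"
        by (intro exI[of _ G] exI[of _ d] conjI)
    qed
    with G(1,2) show "\<exists>G d. multihomogeneous d G \<and> G (std_lift P) \<noteq> 0 \<and>
        (\<forall>Q\<in>PA. G (std_lift Q) \<noteq> 0 \<longrightarrow> Q \<in> T)"
      by (intro exI[of _ G] exI[of _ d] conjI)
  qed
  moreover have "W = T \<inter> Y"
  proof
    show "W \<subseteq> T \<inter> Y" using R Y_subset unfolding T_def by auto
    show "T \<inter> Y \<subseteq> W" unfolding T_def by auto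
  qed
  ultimately show "open_Y W" unfolding open_Y_def openin_subtopology by blast
qed

lemma open_Y_subset: "open_Y W \<Longrightarrow> W \<subseteq> Y"
  unfolding open_Y_def openin_subtopology by auto

lemma open_YE:
  assumes "open_Y W" "P \<in> W"
  obtains G d where "multihomogeneous d G" "G (std_lift P) \<noteq> 0" "\<forall>Q\<in>Y. G (std_lift Q) \<noteq> 0 \<longrightarrow> Q \<in> W"
  using assms(1)[unfolded open_Y_iff, THEN conjunct2, THEN bspec, OF assms(2)]
  by (elim exE conjE) (rule that)

lemma open_Y_Int: "open_Y U \<Longrightarrow> open_Y W \<Longrightarrow> open_Y (U \<inter> W)"
  unfolding open_Y_def by (rule openin_Int)

lemma open_Y_Y: "open_Y Y"
  unfolding open_Y_def using openin_topspace[of "subtopology zariski Y"] topspace_zariski Y_subset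
  by (simp add: Int_absorb1)

lemma open_Y_basic:
  assumes "multihomogeneous d G" shows "open_Y {P \<in> Y. G (std_lift P) \<noteq> 0}"
  unfolding open_Y_iff using assms by (intro conjI ballI exI[of _ G] exI[of _ d]) auto

lemma open_Y_meets_closure:
  assumes "open_Y U" "A \<subseteq> Y" "U \<inter> zariski closure_of A \<noteq> {}"
  shows "U \<inter> A \<noteq> {}"
proof -
  obtain T where T: "openin zariski T" "U = T \<inter> Y"
    using assms(1) unfolding open_Y_def openin_subtopology by auto
  obtain P where "P \<in> T" "P \<in> zariski closure_of A" using assms(3) T by auto
  then obtain Q where "Q \<in> A" "Q \<in> T" using T unfolding in_closure_of by blast
  then show ?thesis using assms(2) T by blast
qed

lemma open_Y_meets_L:
  assumes "open_Y U" "U \<noteq> {}"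
  shows "\<exists>x\<in>L. embed x \<in> U"
proof -
  have "U \<subseteq> Y" using assms(1) by (rule open_Y_subset)
  then have "U \<inter> zariski closure_of (embed ` L) \<noteq> {}" using assms(2) unfolding Y_def by blast
  from open_Y_meets_closure[OF assms(1) _ this] embed_Y show ?thesis by blast
qed

lemma fraction_nbhdI:
  assumes "multihomogeneous d G" "multihomogeneous d H" "H (std_lift P) \<noteq> 0"
    and "\<And>Q. Q \<in> Y \<Longrightarrow> H (std_lift Q) \<noteq> 0 \<Longrightarrow> Q \<in> U \<and> f Q = G (std_lift Q) / H (std_lift Q)"
  shows "\<exists>G H d. multihomogeneous d G \<and> multihomogeneous d H \<and>
     H (std_lift P) \<noteq> 0 \<and> (\<forall>Q\<in>Y. H (std_lift Q) \<noteq> 0 \<longrightarrow> Q \<in> U \<and> f Q = G (std_lift Q) / H (std_lift Q))"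
  by (rule exI[of _ G], rule exI[of _ H], rule exI[of _ d]) (use assms in auto)

text \<open>Multiplying numerator and denominator by a function that cuts out a basic neighbourhood inside
  \<open>U\<close> makes the nonvanishing of the denominator the only condition on the neighbourhood.\<close>
lemma regular_on_iff:
  "regular_on U f \<longleftrightarrow> U \<subseteq> Y \<and> (\<forall>P\<in>U. \<exists>G H d. multihomogeneous d G \<and> multihomogeneous d H \<and>
     H (std_lift P) \<noteq> 0 \<and> (\<forall>Q\<in>Y. H (std_lift Q) \<noteq> 0 \<longrightarrow> Q \<in> U \<and> f Q = G (std_lift Q) / H (std_lift Q)))" (is "_ \<longleftrightarrow> ?R")
proof
  assume reg: "regular_on U f"
  show ?R
  proof (intro conjI ballI subsetI)
    fix P assume P: "P \<in> U"
    obtain W G H d where W: "open_Y W" "P \<in> W" "W \<subseteq> U" and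
      GH: "multihomogeneous d G" "multihomogeneous d H"
      "\<forall>Q\<in>W. \<forall>z. is_lift Q z \<longrightarrow> H z \<noteq> 0 \<and> f Q = G z / H z"
      using reg[unfolded regular_on_def, THEN bspec, OF P] by (elim exE conjE) (rule that)
    have WY: "W \<subseteq> Y" using W(1) by (rule open_Y_subset)
    then show "P \<in> Y" using W by blast
    obtain K d' where K: "multihomogeneous d' K" "K (std_lift P) \<noteq> 0" "\<forall>Q\<in>Y. K (std_lift Q) \<noteq> 0 \<longrightarrow> Q \<in> W"
      using open_YE[OF W(1,2)] .
    have lf: "H (std_lift Q) \<noteq> 0 \<and> f Q = G (std_lift Q) / H (std_lift Q)" if "Q \<in> W" for Q
      using GH(3) that is_lift_std_lift WY Y_subset by blast
    show "\<exists>G H d. multihomogeneous d G \<and> multihomogeneous d H \<and>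
     H (std_lift P) \<noteq> 0 \<and> (\<forall>Q\<in>Y. H (std_lift Q) \<noteq> 0 \<longrightarrow> Q \<in> U \<and> f Q = G (std_lift Q) / H (std_lift Q))"
      by (rule fraction_nbhdI[OF multihomogeneous_mult[OF GH(1) K(1)] multihomogeneous_mult[OF GH(2) K(1)]])
       (use K(2,3) lf W in auto)
  qed
next
  assume R: ?R
  show "regular_on U f"
    unfolding regular_on_def
  proof
    fix P assume P: "P \<in> U"
    obtain G H d where GH: "multihomogeneous d G" "multihomogeneous d H" "H (std_lift P) \<noteq> 0"
      "\<forall>Q\<in>Y. H (std_lift Q) \<noteq> 0 \<longrightarrow> Q \<in> U \<and> f Q = G (std_lift Q) / H (std_lift Q)"
      using R[THEN conjunct2, THEN bspec, OF P] by (elim exE conjE) (rule that)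
    define W where "W = {Q \<in> Y. H (std_lift Q) \<noteq> 0}"
    have "H z \<noteq> 0 \<and> f Q = G z / H z" if Q: "Q \<in> W" "is_lift Q z" for Q z
    proof -
      have "is_lift Q (std_lift Q)" using Q Y_subset is_lift_std_lift unfolding W_def by blast
      from multihomogeneous_lifts[OF this Q(2)] obtain \<kappa> where
        "\<And>d. \<kappa> d \<noteq> 0" "\<And>G d. multihomogeneous d G \<Longrightarrow> G z = \<kappa> d * G (std_lift Q)" by metis
      then have "\<kappa> d \<noteq> 0" "G z = \<kappa> d * G (std_lift Q)" "H z = \<kappa> d * H (std_lift Q)" using GH(1,2) by auto
      then show ?thesis using GH(4) Q unfolding W_def by auto
    qed
    moreover have "open_Y W" unfolding W_def using GH(2) by (rule open_Y_basic)
    moreover have "P \<in> W" "W \<subseteq> U" using GH R P unfolding W_def by auto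
    ultimately show "\<exists>W G H d. open_Y W \<and> P \<in> W \<and> W \<subseteq> U \<and>
     multihomogeneous d G \<and> multihomogeneous d H \<and>
     (\<forall>Q\<in>W. \<forall>z. is_lift Q z \<longrightarrow> H z \<noteq> 0 \<and> f Q = G z / H z)" using GH(1,2)
      by (intro exI[of _ W] exI[of _ G] exI[of _ H] exI[of _ d]) simp
  qed
qed

lemma regular_onE:
  assumes "regular_on U f" "P \<in> U"
  obtains G H d where "multihomogeneous d G" "multihomogeneous d H" "H (std_lift P) \<noteq> 0"
    "\<And>Q. Q \<in> Y \<Longrightarrow> H (std_lift Q) \<noteq> 0 \<Longrightarrow> Q \<in> U" "\<And>Q. Q \<in> Y \<Longrightarrow> H (std_lift Q) \<noteq> 0 \<Longrightarrow> f Q = G (std_lift Q) / H (std_lift Q)"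
proof -
  from assms(1)[unfolded regular_on_iff, THEN conjunct2, THEN bspec, OF assms(2)]
  obtain G H d where 1: "multihomogeneous d G \<and> multihomogeneous d H \<and> H (std_lift P) \<noteq> 0 \<and>
     (\<forall>Q\<in>Y. H (std_lift Q) \<noteq> 0 \<longrightarrow> Q \<in> U \<and> f Q = G (std_lift Q) / H (std_lift Q))"
    by (elim exE)
  show thesis by (rule that[of d G H]) (use 1 in auto)
qed

lemma regular_on_open:
  assumes "regular_on U f" shows "open_Y U"
  unfolding open_Y_iff
proof (intro conjI ballI)
  show "U \<subseteq> Y" using assms unfolding regular_on_iff by (elim conjE)
  fix P assume "P \<in> U"
  from assms this show "\<exists>G d. multihomogeneous d G \<and> G (std_lift P) \<noteq> 0 \<and>
     (\<forall>Q\<in>Y. G (std_lift Q) \<noteq> 0 \<longrightarrow> Q \<in> U)"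
    by (rule regular_onE) (intro exI conjI ballI impI)
qed

lemma regular_on_subset:
  assumes "regular_on U f" "open_Y W" "W \<subseteq> U"
  shows "regular_on W f"
  unfolding regular_on_iff
proof (intro conjI ballI)
  show "W \<subseteq> Y" using assms(2) by (rule open_Y_subset)
  fix P assume P: "P \<in> W"
  then have "P \<in> U" using assms(3) by blast
  obtain G H d where 1: "multihomogeneous d G" "multihomogeneous d H" "H (std_lift P) \<noteq> 0"
    "\<And>Q. Q \<in> Y \<Longrightarrow> H (std_lift Q) \<noteq> 0 \<Longrightarrow> Q \<in> U" "\<And>Q. Q \<in> Y \<Longrightarrow> H (std_lift Q) \<noteq> 0 \<Longrightarrow> f Q = G (std_lift Q) / H (std_lift Q)"
    using regular_onE[OF assms(1) \<open>P \<in> U\<close>] by metis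
  obtain K d' where K: "multihomogeneous d' K" "K (std_lift P) \<noteq> 0" "\<forall>Q\<in>Y. K (std_lift Q) \<noteq> 0 \<longrightarrow> Q \<in> W"
    using open_YE[OF assms(2) P] .
  show "\<exists>G H d. multihomogeneous d G \<and> multihomogeneous d H \<and> H (std_lift P) \<noteq> 0 \<and>
     (\<forall>Q\<in>Y. H (std_lift Q) \<noteq> 0 \<longrightarrow> Q \<in> W \<and> f Q = G (std_lift Q) / H (std_lift Q))"
    by (rule fraction_nbhdI[OF multihomogeneous_mult[OF 1(1) K(1)] multihomogeneous_mult[OF 1(2) K(1)]])
       (use K(2,3) 1(3-5) in auto)
qed

lemma regular_on_const:
  assumes "open_Y U" shows "regular_on U (\<lambda>_. c)"
  unfolding regular_on_iff
proof (intro conjI ballI)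
  show "U \<subseteq> Y" using assms by (rule open_Y_subset)
  fix P assume "P \<in> U"
  obtain K d where K: "multihomogeneous d K" "K (std_lift P) \<noteq> 0" "\<forall>Q\<in>Y. K (std_lift Q) \<noteq> 0 \<longrightarrow> Q \<in> U"
    using open_YE[OF assms \<open>P \<in> U\<close>] .
  then show "\<exists>G H d. multihomogeneous d G \<and> multihomogeneous d H \<and> H (std_lift P) \<noteq> 0 \<and>
     (\<forall>Q\<in>Y. H (std_lift Q) \<noteq> 0 \<longrightarrow> Q \<in> U \<and> c = G (std_lift Q) / H (std_lift Q))"
    by (intro fraction_nbhdI[OF multihomogeneous_cmult[OF K(1), of c] K(1)]) auto
qed

lemma regular_on_add:
  assumes "regular_on U f" "regular_on U g"
  shows "regular_on U (\<lambda>P. f P + g P)"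
  unfolding regular_on_iff
proof (intro conjI ballI)
  show "U \<subseteq> Y" using assms(1) unfolding regular_on_iff by (elim conjE)
  fix P assume P: "P \<in> U"
  obtain G H d where 1: "multihomogeneous d G" "multihomogeneous d H" "H (std_lift P) \<noteq> 0"
    "\<And>Q. Q \<in> Y \<Longrightarrow> H (std_lift Q) \<noteq> 0 \<Longrightarrow> Q \<in> U" "\<And>Q. Q \<in> Y \<Longrightarrow> H (std_lift Q) \<noteq> 0 \<Longrightarrow> f Q = G (std_lift Q) / H (std_lift Q)"
    using regular_onE[OF assms(1) P] by metis
  obtain G' H' d' where 2: "multihomogeneous d' G'" "multihomogeneous d' H'" "H' (std_lift P) \<noteq> 0"
    "\<And>Q. Q \<in> Y \<Longrightarrow> H' (std_lift Q) \<noteq> 0 \<Longrightarrow> Q \<in> U" "\<And>Q. Q \<in> Y \<Longrightarrow> H' (std_lift Q) \<noteq> 0 \<Longrightarrow> g Q = G' (std_lift Q) / H' (std_lift Q)"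
    using regular_onE[OF assms(2) P] by metis
  have *: "multihomogeneous (\<lambda>e. d e + d' e) (\<lambda>z. G z * H' z + H z * G' z)"
    "multihomogeneous (\<lambda>e. d e + d' e) (\<lambda>z. H z * H' z)"
    using 1 2 by (auto intro: multihomogeneous_add multihomogeneous_mult)
  then show "\<exists>G H d. multihomogeneous d G \<and> multihomogeneous d H \<and> H (std_lift P) \<noteq> 0 \<and>
     (\<forall>Q\<in>Y. H (std_lift Q) \<noteq> 0 \<longrightarrow> Q \<in> U \<and> f Q + g Q = G (std_lift Q) / H (std_lift Q))"
    by (intro fraction_nbhdI[OF *]) (use 1 2 in \<open>auto simp: add_divide_distrib mult.commute\<close>)
qed

lemma regular_on_mult:
  assumes "regular_on U f" "regular_on U g"
  shows "regular_on U (\<lambda>P. f P * g P)"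
  unfolding regular_on_iff
proof (intro conjI ballI)
  show "U \<subseteq> Y" using assms(1) unfolding regular_on_iff by (elim conjE)
  fix P assume P: "P \<in> U"
  obtain G H d where 1: "multihomogeneous d G" "multihomogeneous d H" "H (std_lift P) \<noteq> 0"
    "\<And>Q. Q \<in> Y \<Longrightarrow> H (std_lift Q) \<noteq> 0 \<Longrightarrow> Q \<in> U" "\<And>Q. Q \<in> Y \<Longrightarrow> H (std_lift Q) \<noteq> 0 \<Longrightarrow> f Q = G (std_lift Q) / H (std_lift Q)"
    using regular_onE[OF assms(1) P] by metis
  obtain G' H' d' where 2: "multihomogeneous d' G'" "multihomogeneous d' H'" "H' (std_lift P) \<noteq> 0"
    "\<And>Q. Q \<in> Y \<Longrightarrow> H' (std_lift Q) \<noteq> 0 \<Longrightarrow> Q \<in> U" "\<And>Q. Q \<in> Y \<Longrightarrow> H' (std_lift Q) \<noteq> 0 \<Longrightarrow> g Q = G' (std_lift Q) / H' (std_lift Q)"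
    using regular_onE[OF assms(2) P] by metis
  have *: "multihomogeneous (\<lambda>e. d e + d' e) (\<lambda>z. G z * G' z)"
    "multihomogeneous (\<lambda>e. d e + d' e) (\<lambda>z. H z * H' z)"
    using 1 2 by (auto intro: multihomogeneous_add multihomogeneous_mult)
  then show "\<exists>G H d. multihomogeneous d G \<and> multihomogeneous d H \<and> H (std_lift P) \<noteq> 0 \<and>
     (\<forall>Q\<in>Y. H (std_lift Q) \<noteq> 0 \<longrightarrow> Q \<in> U \<and> f Q * g Q = G (std_lift Q) / H (std_lift Q))"
    by (intro fraction_nbhdI[OF *]) (use 1 2 in auto)
qed

lemma regular_on_inverse:
  assumes "regular_on U f"
  shows "regular_on {P \<in> U. f P \<noteq> 0} (\<lambda>P. inverse (f P))"
  unfolding regular_on_iff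
proof (intro conjI ballI)
  show "{P \<in> U. f P \<noteq> 0} \<subseteq> Y" using regular_on_open[OF assms(1)] open_Y_subset by blast
  fix P assume P: "P \<in> {P \<in> U. f P \<noteq> 0}"
  then have "P \<in> U" by simp
  obtain G H d where 1: "multihomogeneous d G" "multihomogeneous d H" "H (std_lift P) \<noteq> 0"
    "\<And>Q. Q \<in> Y \<Longrightarrow> H (std_lift Q) \<noteq> 0 \<Longrightarrow> Q \<in> U" "\<And>Q. Q \<in> Y \<Longrightarrow> H (std_lift Q) \<noteq> 0 \<Longrightarrow> f Q = G (std_lift Q) / H (std_lift Q)"
    using regular_onE[OF assms(1) \<open>P \<in> U\<close>] by metis
  have "P \<in> Y" using \<open>P \<in> U\<close> regular_on_open[OF assms(1)] open_Y_subset by blast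
  then have "G (std_lift P) \<noteq> 0" using 1 P by auto
  then show "\<exists>G H d. multihomogeneous d G \<and> multihomogeneous d H \<and> H (std_lift P) \<noteq> 0 \<and>
     (\<forall>Q\<in>Y. H (std_lift Q) \<noteq> 0 \<longrightarrow> Q \<in> {P \<in> U. f P \<noteq> 0} \<and> inverse (f Q) = G (std_lift Q) / H (std_lift Q))"
    by (intro fraction_nbhdI[OF multihomogeneous_mult[OF 1(2) 1(2)] multihomogeneous_mult[OF 1(1) 1(2)]])
       (use 1 in auto)
qed

lemma open_Y_nonzero: "regular_on U f \<Longrightarrow> open_Y {P \<in> U. f P \<noteq> 0}"
  using regular_on_inverse regular_on_open by blast

lemma regular_on_algebra:
  assumes "A \<in> generated_algebra \<Phi>" "open_Y U" "\<And>\<phi>. \<phi> \<in> \<Phi> \<Longrightarrow> regular_on U (\<lambda>P. \<phi> (\<kappa> P))"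
  shows "regular_on U (\<lambda>P. A (\<kappa> P))"
  using assms(1)
  by induction (auto intro: regular_on_const regular_on_add regular_on_mult assms)

lemma regular_on_sum:
  assumes "open_Y U" "\<And>i. i \<in> I \<Longrightarrow> regular_on U (f i)"
  shows "regular_on U (\<lambda>P. \<Sum>i\<in>I. f i P)"
  using assms(2)
  by (induction I rule: infinite_finite_induct) (auto intro: regular_on_const regular_on_add assms(1))

lemma regular_on_power:
  assumes "regular_on U f" shows "regular_on U (\<lambda>P. f P ^ n)"
  by (induction n) (auto intro: regular_on_const regular_on_mult assms regular_on_open[OF assms])

text \<open>The locus where two regular functions differ is open, and the image of \<open>L\<close> is dense. All
  identities between regular functions below are obtained in this way from identities on \<open>L\<close>.\<close>
lemma regular_on_eq:
  assumes "regular_on U f" "regular_on U g" "\<And>x. x \<in> L \<Longrightarrow> embed x \<in> U \<Longrightarrow> f (embed x) = g (embed x)"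
    and "P \<in> U"
  shows "f P = g P"
proof (rule ccontr)
  assume "f P \<noteq> g P"
  have "regular_on U (\<lambda>P. f P + (-1) * g P)"
    by (intro regular_on_add regular_on_mult regular_on_const assms regular_on_open[OF assms(1)])
  from open_Y_nonzero[OF this] have "open_Y {P \<in> U. f P + (-1) * g P \<noteq> 0}" .
  from open_Y_meets_L[OF this] \<open>f P \<noteq> g P\<close> assms(3,4) show False by auto
qed

lemma std_lift_embed:
  assumes "G \<in> homog_coord_ring"
  shows "G (std_lift (embed x)) = G (x, \<lambda>_. 1)"
proof -
  have 1: "std_lift (embed x) = (x, \<lambda>e. if embed x e = Infty then 0 else 1)"
    using sum_component[of x] by (simp add: std_lift_def embed_def)
  show ?thesis unfolding 1 by (rule homog_coord_ring_cong[OF assms]) (simp add: embed_def)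
qed

lemma homog_coord_ring_polyfun:
  assumes "G \<in> homog_coord_ring"
  shows "(\<lambda>x. G (x, \<lambda>_. 1)) \<in> polyfuns"
  using assms unfolding homog_coord_ring_def
  by (rule generated_algebra_pullback) (auto intro: generated_algebra.gen generated_algebra.const)

lemma regular_on_embed:
  assumes "regular_on U f" "x \<in> L" "embed x \<in> U"
  shows "\<exists>g\<in>polyfuns. \<exists>h\<in>polyfuns. h x \<noteq> 0 \<and>
     (\<forall>y\<in>L. h y \<noteq> 0 \<longrightarrow> embed y \<in> U \<and> f (embed y) = g y / h y)"
proof -
  obtain G H d where 1: "multihomogeneous d G" "multihomogeneous d H" "H (std_lift (embed x)) \<noteq> 0"
    "\<And>Q. Q \<in> Y \<Longrightarrow> H (std_lift Q) \<noteq> 0 \<Longrightarrow> Q \<in> U" "\<And>Q. Q \<in> Y \<Longrightarrow> H (std_lift Q) \<noteq> 0 \<Longrightarrow> f Q = G (std_lift Q) / H (std_lift Q)"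
    using regular_onE[OF assms(1,3)] by metis
  then have "G \<in> homog_coord_ring" "H \<in> homog_coord_ring" by (auto simp: multihomogeneous_def)
  with 1 show ?thesis
    using embed_Y assms(2)
    by (intro bexI[OF _ homog_coord_ring_polyfun[of G]] bexI[OF _ homog_coord_ring_polyfun[of H]])
       (auto simp: std_lift_embed)
qed

text \<open>Near a point of \<open>L\<close> the function is \<open>g / h\<close>. Multiplying by \<open>h\<^sup>2\<close> gives an identity \<open>f h\<^sup>2 = g h\<close>
  on all of \<open>L\<close>, since both sides vanish where \<open>h\<close> does.\<close>
theorem regular_on_L_is_polyfun:
  assumes "regular_on U f" "embed ` L \<subseteq> U"
  shows "\<exists>g\<in>polyfuns. \<forall>x\<in>L. f (embed x) = g x"
proof (rule locally_fraction_imp_polyfun)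
  fix x assume x: "x \<in> L"
  obtain g h where gh: "g \<in> polyfuns" "h \<in> polyfuns" "h x \<noteq> 0"
    "\<forall>y\<in>L. h y \<noteq> 0 \<longrightarrow> embed y \<in> U \<and> f (embed y) = g y / h y"
    using regular_on_embed[OF assms(1) x] x assms(2) by blast
  have *: "\<forall>y\<in>L. f (embed y) * (h y * h y) = g y * h y"
  proof
    fix y assume "y \<in> L"
    with gh(4) show "f (embed y) * (h y * h y) = g y * h y" by (cases "h y = 0") auto
  qed
  show "\<exists>g\<in>polyfuns. \<exists>h\<in>polyfuns. h x \<noteq> 0 \<and> (\<forall>y\<in>L. f (embed y) * h y = g y)"
    by (intro bexI[OF _ generated_algebra.mult[OF gh(1,2)]] bexI[OF _ generated_algebra.mult[OF gh(2,2)]]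
        conjI *) (use gh(3) in simp)
qed

text \<open>The numerator of the coordinate at \<open>e\<close>. At a point with finite entry at \<open>e\<close> it is the coordinate
  itself, since the standard lift has denominator 1 there.\<close>
abbreviation hcoord :: "'e \<Rightarrow> ('e \<Rightarrow> 'v proj_point) \<Rightarrow> 'a" where
  "hcoord e P \<equiv> coord e (fst (std_lift P))"

lemma multihomogeneous_coord:
  assumes "e \<in> E"
  shows "multihomogeneous (\<lambda>i. if i = e then 1 else 0) (\<lambda>(v, s). coord e v)"
proof -
  have "(\<lambda>(v, s). coord e v) \<in> homog_coord_ring"
    unfolding homog_coord_ring_def using functional_coord[OF assms] by (intro generated_algebra.gen) blast
  moreover have "coord e (\<Sum>i\<in>E. scale (c i) (component v i)) = c e * coord e v" for c v
  proof -
    have "(\<Sum>i\<in>E. scale (c i) (component v i)) = (\<Sum>i\<in>E. scale (c i * coord i v) (bvec i))"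
      by (auto simp: component_coord intro!: sum.cong)
    then show ?thesis using coord_sum[OF assms finite_E, of "\<lambda>i. c i * coord i v"] assms by simp
  qed
  moreover have "(\<Prod>i\<in>E. c i ^ (if i = e then 1 else 0)) = c e" for c :: "'e \<Rightarrow> 'a"
  proof -
    have "(\<Prod>i\<in>E. c i ^ (if i = e then 1 else 0)) = (\<Prod>i\<in>E. if i = e then c i else 1)"
      by (auto intro!: prod.cong)
    then show ?thesis using assms finite_E by simp
  qed
  ultimately show ?thesis unfolding multihomogeneous_def by simp
qed

lemma multihomogeneous_scalar:
  assumes "e \<in> E"
  shows "multihomogeneous (\<lambda>i. if i = e then 1 else 0) (\<lambda>(v, s). s e)"
proof -
  have "(\<lambda>(v, s). s e) \<in> homog_coord_ring"
    unfolding homog_coord_ring_def using assms by (intro generated_algebra.gen) blast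
  moreover have "(\<Prod>i\<in>E. c i ^ (if i = e then 1 else 0)) = c e" for c :: "'e \<Rightarrow> 'a"
  proof -
    have "(\<Prod>i\<in>E. c i ^ (if i = e then 1 else 0)) = (\<Prod>i\<in>E. if i = e then c i else 1)"
      by (auto intro!: prod.cong)
    then show ?thesis using assms finite_E by simp
  qed
  ultimately show ?thesis unfolding multihomogeneous_def by simp
qed

lemma snd_std_lift: "snd (std_lift P) e = 0 \<longleftrightarrow> P e = Infty"
  by (simp add: std_lift_def)

lemma regular_on_coord:
  assumes "e \<in> E"
  shows "regular_on {P \<in> Y. P e \<noteq> Infty} (hcoord e)"
  unfolding regular_on_iff
proof (intro conjI ballI)
  fix P assume "P \<in> {P \<in> Y. P e \<noteq> Infty}"
  then show "\<exists>G H d. multihomogeneous d G \<and> multihomogeneous d H \<and> H (std_lift P) \<noteq> 0 \<and>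
     (\<forall>Q\<in>Y. H (std_lift Q) \<noteq> 0 \<longrightarrow> Q \<in> {P \<in> Y. P e \<noteq> Infty} \<and> hcoord e Q = G (std_lift Q) / H (std_lift Q))"
    by (intro fraction_nbhdI[OF multihomogeneous_coord[OF assms] multihomogeneous_scalar[OF assms]])
       (auto simp: std_lift_def split: if_splits)
qed blast

lemma regular_on_inverse_coord:
  assumes "e \<in> E"
  shows "regular_on {P \<in> Y. hcoord e P \<noteq> 0} (\<lambda>P. snd (std_lift P) e / hcoord e P)"
  unfolding regular_on_iff
proof (intro conjI ballI)
  fix P assume "P \<in> {P \<in> Y. hcoord e P \<noteq> 0}"
  then show "\<exists>G H d. multihomogeneous d G \<and> multihomogeneous d H \<and> H (std_lift P) \<noteq> 0 \<and>
     (\<forall>Q\<in>Y. H (std_lift Q) \<noteq> 0 \<longrightarrow> Q \<in> {P \<in> Y. hcoord e P \<noteq> 0} \<and>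
        snd (std_lift Q) e / hcoord e Q = G (std_lift Q) / H (std_lift Q))"
    by (intro fraction_nbhdI[OF multihomogeneous_scalar[OF assms] multihomogeneous_coord[OF assms]])
       (auto simp: case_prod_beta)
qed blast

lemma hcoord_embed: "e \<in> E \<Longrightarrow> hcoord e (embed x) = coord e x"
  using sum_component[of x] by (simp add: std_lift_def embed_def)

lemma open_Y_finite:
  assumes "S \<subseteq> E" shows "open_Y {P \<in> Y. \<forall>e\<in>S. P e \<noteq> Infty}"
  using finite_subset[OF assms finite_E] assms
proof (induction S rule: finite_induct)
  case empty
  then show ?case using open_Y_Y by simp
next
  case (insert e S)
  have "{P \<in> Y. \<forall>i\<in>insert e S. P i \<noteq> Infty}
    = {P \<in> Y. P e \<noteq> Infty} \<inter> {P \<in> Y. \<forall>i\<in>S. P i \<noteq> Infty}" by blast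
  then show ?case using insert regular_on_open[OF regular_on_coord[of e]] by (auto intro: open_Y_Int)
qed

lemma regular_on_functional:
  assumes "functional \<phi>" "S \<subseteq> E"
  shows "regular_on {P \<in> Y. \<forall>e\<in>S. P e \<noteq> Infty} (\<lambda>P. \<phi> (\<Sum>e\<in>S. scale (hcoord e P) (bvec e)))"
proof -
  let ?U = "{P \<in> Y. \<forall>e\<in>S. P e \<noteq> Infty}"
  have "regular_on ?U (\<lambda>P. \<Sum>e\<in>S. hcoord e P * \<phi> (bvec e))"
  proof (intro regular_on_sum regular_on_mult regular_on_const open_Y_finite assms(2))
    fix e assume "e \<in> S"
    then show "regular_on ?U (hcoord e)"
      using assms(2) open_Y_finite[OF assms(2)] by (intro regular_on_subset[OF regular_on_coord]) auto
  qed
  then show ?thesis by (simp add: functionalD[OF assms(1)])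
qed

text \<open>A polynomial in the coordinates is regular wherever all coordinates are finite.\<close>
lemma polyfun_extends_regular:
  assumes "f \<in> polyfuns"
  shows "\<exists>U h. regular_on U h \<and> embed ` L \<subseteq> U \<and> (\<forall>x\<in>L. h (embed x) = f x)"
proof (intro exI conjI)
  let ?U = "{P \<in> Y. \<forall>e\<in>E. P e \<noteq> Infty}"
  show "regular_on ?U (\<lambda>P. f (\<Sum>e\<in>E. scale (hcoord e P) (bvec e)))"
    by (rule regular_on_algebra[OF assms, where \<kappa> = "\<lambda>P. \<Sum>e\<in>E. scale (hcoord e P) (bvec e)"])
       (use open_Y_finite[of E] regular_on_functional[of _ E] in auto)
  show "embed ` L \<subseteq> ?U" using embed_Y by (auto simp: embed_def)
  show "\<forall>x\<in>L. f (\<Sum>e\<in>E. scale (hcoord e (embed x)) (bvec e)) = f x"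
    by (auto simp: hcoord_embed sum_coord)
qed

end

section \<open>The order along the divisor of a flat\<close>

context linear_space
begin

interpretation VV: vector_space_pair scale scale ..

lemma endo_linearI:
  assumes "\<And>x y. \<phi> (x + y) = \<phi> x + \<phi> y" "\<And>c x. \<phi> (scale c x) = scale c (\<phi> x)"
  shows "Vector_Spaces.linear scale scale \<phi>"
  using assms by unfold_locales auto

lemma linear_factors_through:
  assumes "Vector_Spaces.linear scale scale p" "Vector_Spaces.linear scale scale q" "subspace S"
    and "\<And>x. x \<in> S \<Longrightarrow> p x = 0 \<Longrightarrow> q x = 0"
  shows "\<exists>\<sigma>. Vector_Spaces.linear scale scale \<sigma> \<and> (\<forall>x\<in>S. \<sigma> (p x) = q x)"
proof -
  obtain g where g: "g ` UNIV \<subseteq> S" "Vector_Spaces.linear scale scale g" "\<forall>v\<in>p ` S. p (g v) = v"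
    using VV.linear_exists_right_inverse_on[OF assms(1,3)] by blast
  interpret p: Vector_Spaces.linear scale scale p by (rule assms(1))
  interpret q: Vector_Spaces.linear scale scale q by (rule assms(2))
  have "q (g (p x)) = q x" if "x \<in> S" for x
  proof -
    have "g (p x) - x \<in> S" using g that assms(3) by (auto intro: subspace_diff)
    moreover have "p (g (p x) - x) = 0" using g(3) that by (simp add: p.diff)
    ultimately have "q (g (p x) - x) = 0" using assms(4) by blast
    then show ?thesis by (simp add: q.diff)
  qed
  moreover have "Vector_Spaces.linear scale scale (q \<circ> g)"
    using g(2) assms(2) by (rule Vector_Spaces.linear_compose)
  ultimately show ?thesis by (intro exI[of _ "q \<circ> g"]) auto
qed

lemma functional_compose:
  assumes "functional \<phi>" "Vector_Spaces.linear scale scale \<sigma>"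
  shows "functional (\<lambda>x. \<phi> (\<sigma> x))"
  using Vector_Spaces.linear_compose[OF assms(2,1)] by (simp add: o_def)

lemma std_lift_proportional:
  assumes "P \<in> PA" "is_lift P z"
  shows "\<exists>\<kappa>. (\<forall>d. \<kappa> d \<noteq> 0) \<and> (\<forall>G d. multihomogeneous d G \<longrightarrow> G z = \<kappa> d * G (std_lift P))"
  using multihomogeneous_lifts[OF is_lift_std_lift[OF assms(1)] assms(2)] .

lemma nonzero_on_lift_iff:
  assumes "P \<in> PA" "is_lift P z" "multihomogeneous d G"
  shows "G z \<noteq> 0 \<longleftrightarrow> G (std_lift P) \<noteq> 0"
  using std_lift_proportional[OF assms(1,2)] assms(3) by fastforce

lemma fraction_on_lift:
  assumes "P \<in> PA" "is_lift P z" "multihomogeneous d G" "multihomogeneous d H"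
  shows "G (std_lift P) / H (std_lift P) = G z / H z"
proof -
  obtain \<kappa> where "\<forall>d. \<kappa> d \<noteq> 0" "\<forall>G d. multihomogeneous d G \<longrightarrow> G z = \<kappa> d * G (std_lift P)"
    using std_lift_proportional[OF assms(1,2)] by blast
  then have "\<kappa> d \<noteq> 0" "G z = \<kappa> d * G (std_lift P)" "H z = \<kappa> d * H (std_lift P)" using assms(3,4) by auto
  then show ?thesis by simp
qed

lemma regular_on_powi:
  assumes "regular_on U f" "\<And>P. P \<in> U \<Longrightarrow> f P \<noteq> 0"
  shows "regular_on U (\<lambda>P. f P powi n)"
proof (cases n)
  case (nonneg m)
  then show ?thesis using regular_on_power[OF assms(1)] by simp
next
  case (neg m)
  have "{P \<in> U. f P \<noteq> 0} = U" using assms(2) by auto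
  then have "regular_on U (\<lambda>P. inverse (f P))" using regular_on_inverse[OF assms(1)] by simp
  from regular_on_power[OF this, of "Suc m"] show ?thesis
    unfolding neg power_int_minus by (simp only: power_int_of_nat power_inverse)
qed

text \<open>All lines in \<open>L\<close> parallel to \<open>\<alpha>\<close> are considered. For \<open>q = 0\<close> and polynomial \<open>f\<close> this says that \<open>f\<close>
  vanishes on \<open>L\<close>.\<close>
definition deg_below :: "('v \<Rightarrow> 'a) \<Rightarrow> 'v \<Rightarrow> nat \<Rightarrow> bool" where
  "deg_below f \<alpha> q \<longleftrightarrow>
     (\<forall>x\<in>L. \<forall>p. (\<forall>t. f (x + scale t \<alpha>) = poly p t) \<longrightarrow> (\<forall>j\<ge>q. coeff p j = 0))"

end

text \<open>Data for a chart of the Schubert variety around the orbit of a flat \<open>F\<close> of corank 1: a vector \<open>\<alpha>\<close>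
  that spans the stabilizer of the orbit, and a coordinate \<open>e0\<close> that becomes infinite along it.\<close>
locale corank1_chart = linear_space +
  fixes F :: "'c set" and \<alpha> :: 'b and e0 :: 'c
  assumes F_sub: "F \<subseteq> E" and e0: "e0 \<in> E - F" and \<alpha>_L: "\<alpha> \<in> L"
    and \<alpha>_on_F: "\<And>e. e \<in> F \<Longrightarrow> coord e \<alpha> = 0"
    and \<alpha>_off_F: "\<And>e. e \<in> E - F \<Longrightarrow> coord e \<alpha> \<noteq> 0"
    and stabilizer: "\<And>x. x \<in> L \<Longrightarrow> (\<And>e. e \<in> F \<Longrightarrow> coord e x = 0) \<Longrightarrow> \<exists>c. x = scale c \<alpha>"
begin

definition projF where "projF v = (\<Sum>e\<in>F. scale (coord e v) (bvec e))"

text \<open>The projection along \<open>\<alpha>\<close> onto the vectors whose coordinate at \<open>e0\<close> is 0.\<close>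
definition \<tau> where "\<tau> v = v - scale (coord e0 v / coord e0 \<alpha>) \<alpha>"

lemma F_E: "e \<in> F \<Longrightarrow> e \<in> E" using F_sub by blast

lemma e0_E: "e0 \<in> E" "e0 \<notin> F" using e0 by auto

lemma finite_F: "finite F" using F_sub finite_E by (rule finite_subset)

lemma coord_projF: "e \<in> E \<Longrightarrow> coord e (projF v) = (if e \<in> F then coord e v else 0)"
  unfolding projF_def using coord_sum[OF _ finite_F F_sub, of e "\<lambda>e. coord e v"] by simp

lemma linear_projF: "Vector_Spaces.linear scale scale projF"
  by (rule endo_linearI; rule coord_eqI) (auto simp: coord_projF coord_add coord_scale)

lemma linear_\<tau>: "Vector_Spaces.linear scale scale \<tau>"
proof (rule endo_linearI)
  show "\<tau> (x + y) = \<tau> x + \<tau> y" for x y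
    by (simp add: \<tau>_def coord_add e0_E add_divide_distrib scale_left_distrib)
  show "\<tau> (scale c x) = scale c (\<tau> x)" for c x
    by (simp add: \<tau>_def coord_scale e0_E scale_right_diff_distrib)
qed

lemma \<tau>_L: "x \<in> L \<Longrightarrow> \<tau> x \<in> L"
  unfolding \<tau>_def using \<alpha>_L by (simp add: L_closed)

lemma \<tau>_add_\<alpha>: "\<tau> x + scale (coord e0 x / coord e0 \<alpha>) \<alpha> = x"
  by (simp add: \<tau>_def)

text \<open>The coordinates in \<open>F\<close> determine a vector of \<open>L\<close> up to a multiple of \<open>\<alpha>\<close>, which \<open>\<tau>\<close> kills.\<close>
lemma exists_section: "\<exists>\<sigma>. Vector_Spaces.linear scale scale \<sigma> \<and> (\<forall>x\<in>L. \<sigma> (projF x) = \<tau> x)"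
proof (rule linear_factors_through[OF linear_projF linear_\<tau> L_subspace])
  fix x assume x: "x \<in> L" "projF x = 0"
  have "coord e x = 0" if "e \<in> F" for e
    using coord_projF[OF F_E[OF that], of x] x that functionalD(3)[OF functional_coord[OF F_E[OF that]]]
    by simp
  then obtain c where "x = scale c \<alpha>" using stabilizer[OF x(1)] by blast
  then show "\<tau> x = 0" using \<alpha>_off_F[OF e0] by (simp add: \<tau>_def coord_scale e0_E)
qed

definition \<sigma> where
  "\<sigma> = (SOME \<sigma>. Vector_Spaces.linear scale scale \<sigma> \<and> (\<forall>x\<in>L. \<sigma> (projF x) = \<tau> x))"

lemma linear_\<sigma>: "Vector_Spaces.linear scale scale \<sigma>"
  and \<sigma>_projF: "x \<in> L \<Longrightarrow> \<sigma> (projF x) = \<tau> x"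
  using someI_ex[OF exists_section] unfolding \<sigma>_def by blast+

text \<open>On this open set the coordinates in \<open>F\<close> are finite and \<open>1 / coord e0\<close> is regular. It contains the
  orbit of the flat.\<close>
definition W where "W = {P \<in> Y. \<forall>e\<in>F. P e \<noteq> Infty} \<inter> {P \<in> Y. hcoord e0 P \<noteq> 0}"

text \<open>On \<open>L\<close> this is \<open>coord e0 \<alpha> / coord e0 x\<close>, so that \<open>x = \<tau> x + \<alpha> / u\<close>.\<close>
definition chart_u where "chart_u P = coord e0 \<alpha> * (snd (std_lift P) e0 / hcoord e0 P)"

text \<open>The vector \<open>\<tau> x\<close>, recovered from the coordinates in \<open>F\<close> so that it makes sense on the orbit as well.\<close>
definition chart_y where "chart_y P = \<sigma> (\<Sum>e\<in>F. scale (hcoord e P) (bvec e))"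

abbreviation chart_gens :: "('b \<times> 'a \<Rightarrow> 'a) set" where
  "chart_gens \<equiv> insert snd {\<lambda>z. \<phi> (fst z) | \<phi>. functional \<phi>}"

definition chart_algebra where
  "chart_algebra = generated_algebra chart_gens"

lemma chart_snd: "snd \<in> chart_algebra"
  unfolding chart_algebra_def by (intro generated_algebra.gen) blast

lemma chart_fst: "functional \<phi> \<Longrightarrow> (\<lambda>z. \<phi> (fst z)) \<in> chart_algebra"
  unfolding chart_algebra_def by (intro generated_algebra.gen) blast

definition orbit_point where "orbit_point y = translate y (flat_point F)"

text \<open>Homogeneous coordinates of \<open>y + \<alpha> / u\<close>, with the entries outside \<open>F\<close> multiplied by \<open>u\<close>. They remain
  homogeneous coordinates of a point for \<open>u = 0\<close>, namely of the point of the orbit given by \<open>y\<close>.\<close>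
definition chart_lift where
  "chart_lift = (\<lambda>(y, u). (projF y + \<alpha> + scale u (y - projF y), \<lambda>e. if e \<in> F then 1 else u))"

lemma open_W: "open_Y W"
  unfolding W_def using open_Y_finite[OF F_sub] regular_on_open[OF regular_on_inverse_coord] e0_E(1)
  by (intro open_Y_Int)

lemma regular_chart:
  assumes "A \<in> chart_algebra"
  shows "regular_on W (\<lambda>P. A (chart_y P, chart_u P))"
proof -
  have "regular_on W chart_u" unfolding chart_u_def
    using open_W e0_E(1)
    by (intro regular_on_mult regular_on_const regular_on_subset[OF regular_on_inverse_coord[OF e0_E(1)]])
       (auto simp: W_def)
  moreover have "regular_on W (\<lambda>P. \<phi> (chart_y P))" if "functional \<phi>" for \<phi>
    unfolding chart_y_def
    using functional_compose[OF that linear_\<sigma>] open_W F_sub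
    by (intro regular_on_subset[OF regular_on_functional[of "\<lambda>x. \<phi> (\<sigma> x)" F]]) (auto simp: W_def)
  ultimately show ?thesis
    by (intro regular_on_algebra[OF assms[unfolded chart_algebra_def] open_W,
          of "\<lambda>P. (chart_y P, chart_u P)"]) auto
qed

lemma regular_chart_u: "regular_on W chart_u"
  using regular_chart[OF chart_snd] by simp

lemma embed_in_W_iff: "x \<in> L \<Longrightarrow> embed x \<in> W \<longleftrightarrow> coord e0 x \<noteq> 0"
proof -
  assume "x \<in> L"
  moreover have "\<forall>e\<in>F. embed x e \<noteq> Infty" using F_E by (auto simp: embed_def)
  ultimately show ?thesis unfolding W_def using embed_Y hcoord_embed[OF e0_E(1)] by simp
qed

lemma chart_u_embed: "chart_u (embed x) = coord e0 \<alpha> / coord e0 x"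
  unfolding chart_u_def using e0_E(1) by (simp add: hcoord_embed) (simp add: std_lift_def embed_def)

lemma chart_y_embed: "x \<in> L \<Longrightarrow> chart_y (embed x) = \<tau> x"
proof -
  assume "x \<in> L"
  have "(\<Sum>e\<in>F. scale (hcoord e (embed x)) (bvec e)) = projF x"
    unfolding projF_def by (intro sum.cong refl) (simp add: hcoord_embed F_E)
  then show ?thesis unfolding chart_y_def using \<sigma>_projF[OF \<open>x \<in> L\<close>] by simp
qed

lemma orbit_point_PA: "orbit_point y \<in> PA"
  unfolding orbit_point_def translate_def flat_point_def PA_def using component_in by auto

lemma orbit_point_simps: "e \<in> F \<Longrightarrow> orbit_point y e = Fin (component y e)" "e \<in> E - F \<Longrightarrow> orbit_point y e = Infty"
  unfolding orbit_point_def translate_def flat_point_def using F_sub by auto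

lemma coord_chart_lift:
  "e \<in> E \<Longrightarrow> coord e (fst (chart_lift (y, u))) = (if e \<in> F then coord e y else coord e \<alpha> + u * coord e y)"
  by (simp add: chart_lift_def coord_add coord_diff coord_scale coord_projF \<alpha>_on_F)

lemma chart_lift_lifts_embed:
  assumes "u \<noteq> 0"
  shows "is_lift (embed (y + scale (inverse u) \<alpha>)) (chart_lift (y, u))"
proof -
  define v where "v = fst (chart_lift (y, u))"
  have cv: "chart_lift (y, u) = (v, \<lambda>e. if e \<in> F then 1 else u)" unfolding v_def by (simp add: chart_lift_def)
  have "component (y + scale (inverse u) \<alpha>) e
      = scale (inverse (if e \<in> F then 1 else u)) (component v e)" if "e \<in> E" for e
    using that coord_chart_lift[OF that, of y u] assms
    by (auto simp: component_coord v_def[symmetric] coord_add coord_scale \<alpha>_on_F distrib_left)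
  then show ?thesis unfolding cv is_lift_def using assms by (auto simp: embed_def)
qed

lemma chart_lift_lifts_orbit_point: "is_lift (orbit_point y) (chart_lift (y, 0))"
proof -
  define v where "v = fst (chart_lift (y, 0))"
  have cv: "chart_lift (y, 0) = (v, \<lambda>e. if e \<in> F then 1 else 0)" unfolding v_def by (simp add: chart_lift_def)
  have "component v e = (if e \<in> F then component y e else component \<alpha> e)" if "e \<in> E" for e
    using that coord_chart_lift[OF that, of y 0] by (simp add: component_coord v_def[symmetric])
  moreover have "component \<alpha> e \<noteq> 0" if "e \<in> E - F" for e
    using \<alpha>_off_F[OF that] that by (simp add: component_eq_0_iff)
  ultimately show ?thesis unfolding cv is_lift_def using orbit_point_simps by auto
qed

lemma homog_chart_lift:
  assumes "G \<in> homog_coord_ring"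
  shows "(\<lambda>z. G (chart_lift z)) \<in> chart_algebra"
  unfolding chart_algebra_def
proof (rule generated_algebra_pullback[OF assms[unfolded homog_coord_ring_def]])
  note u = chart_snd[unfolded chart_algebra_def] and f = chart_fst[unfolded chart_algebra_def]
  fix \<psi> assume "\<psi> \<in> {\<lambda>(v, s::'c \<Rightarrow> 'a). \<phi> v | \<phi>. functional \<phi>} \<union> {\<lambda>(v::'b, s). s e | e. e \<in> E}"
  then consider \<phi> where "functional \<phi>" "\<psi> = (\<lambda>(v, s). \<phi> v)" | e where "\<psi> = (\<lambda>(v, s). s e)" by blast
  then show "(\<lambda>z. \<psi> (chart_lift z)) \<in> generated_algebra chart_gens"
  proof cases
    case 1
    have p: "functional (\<lambda>y. \<phi> (projF y))" using 1(1) linear_projF by (rule functional_compose)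
    have "(\<lambda>z. \<psi> (chart_lift z)) = (\<lambda>z. (\<phi> (projF (fst z)) + \<phi> \<alpha>) + snd z * (\<phi> (fst z) + (-1) * \<phi> (projF (fst z))))"
      using functionalD[OF 1(1)] unfolding 1(2) chart_lift_def by (auto simp: case_prod_beta)
    moreover have "\<dots> \<in> generated_algebra chart_gens"
      by (intro generated_algebra.add generated_algebra.mult generated_algebra.const u f[OF p] f[OF 1(1)])
    ultimately show ?thesis by simp
  next
    case 2
    have "(\<lambda>z. \<psi> (chart_lift z)) = (\<lambda>z. if e \<in> F then 1 else snd z)"
      unfolding 2 chart_lift_def by (auto simp: case_prod_beta)
    then show ?thesis using u generated_algebra.const[of 1 chart_gens] by (cases "e \<in> F") simp_all
  qed
qed

lemma chart_poly:
  assumes "A \<in> chart_algebra" shows "\<exists>p. \<forall>t. A (y, t) = poly p t"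
proof (rule generated_algebra_poly_curve[OF assms[unfolded chart_algebra_def]])
  fix \<psi> assume "\<psi> \<in> chart_gens"
  then consider \<phi> where "\<psi> = (\<lambda>z. \<phi> (fst z))" | "\<psi> = snd" by blast
  then show "\<exists>a b. \<forall>t. \<psi> (y, t) = a + b * t"
  proof cases
    case 1 then show ?thesis by (intro exI[of _ "\<phi> y"] exI[of _ 0]) auto
  next
    case 2 show ?thesis unfolding 2 by (rule exI[of _ 0], rule exI[of _ 1]) auto
  qed
qed

lemma chart_restrict: "A \<in> chart_algebra \<Longrightarrow> (\<lambda>y. A (y, 0)) \<in> polyfuns"
  unfolding chart_algebra_def
  by (rule generated_algebra_pullback) (auto intro: generated_algebra.const generated_algebra.gen)

text \<open>Division by \<open>u\<close>: a function of the chart that vanishes for \<open>u = 0\<close> is a multiple of \<open>u\<close>.\<close>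
lemma chart_factor:
  assumes "A \<in> chart_algebra"
  shows "(\<lambda>z. A (fst z, 0)) \<in> chart_algebra \<and>
    (\<exists>B\<in>chart_algebra. \<forall>y u. A (y, u) = A (y, 0) + u * B (y, u))"
  using assms unfolding chart_algebra_def
proof induction
  case (const c)
  show ?case
    by (auto intro!: bexI[of _ "\<lambda>_. 0"] generated_algebra.const)
next
  case (gen \<psi>)
  then consider \<phi> where "\<psi> = (\<lambda>z. \<phi> (fst z))" | "\<psi> = snd" by blast
  then show ?case
  proof cases
    case 1
    with generated_algebra.gen[OF gen] show ?thesis
      by (auto intro!: bexI[of _ "\<lambda>_. 0"] generated_algebra.const)
  next
    case 2
    then show ?thesis
      by (auto intro!: bexI[of _ "\<lambda>_. 1"] generated_algebra.const)
  qed
next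
  case (add f g)
  obtain B where B: "B \<in> generated_algebra chart_gens" "\<forall>y u. f (y, u) = f (y, 0) + u * B (y, u)"
    using add.IH(1) by (elim conjE bexE)
  obtain C where C: "C \<in> generated_algebra chart_gens" "\<forall>y u. g (y, u) = g (y, 0) + u * C (y, u)"
    using add.IH(2) by (elim conjE bexE)
  have "f (y, u) + g (y, u) = f (y, 0) + g (y, 0) + u * (B (y, u) + C (y, u))" for y u
    using B(2)[rule_format, of y u] C(2)[rule_format, of y u] by (simp add: algebra_simps)
  then show ?case
    using generated_algebra.add[OF B(1) C(1)] generated_algebra.add[OF add.IH(1)[THEN conjunct1] add.IH(2)[THEN conjunct1]]
    by (intro conjI bexI[of _ "\<lambda>z. B z + C z"] allI)
next
  case (mult f g)
  obtain B where B: "B \<in> generated_algebra chart_gens" "\<forall>y u. f (y, u) = f (y, 0) + u * B (y, u)"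
    using mult.IH(1) by (elim conjE bexE)
  obtain C where C: "C \<in> generated_algebra chart_gens" "\<forall>y u. g (y, u) = g (y, 0) + u * C (y, u)"
    using mult.IH(2) by (elim conjE bexE)
  have "f (y, u) * g (y, u) = f (y, 0) * g (y, 0) +
      u * (B (y, u) * g (y, u) + f (fst (y, u), 0) * C (y, u))" for y u
  proof -
    have "f (y, u) * g (y, u) = f (y, 0) * g (y, u) + u * (B (y, u) * g (y, u))"
      using B(2)[rule_format, of y u] by (metis distrib_right mult.assoc)
    also have "f (y, 0) * g (y, u) = f (y, 0) * g (y, 0) + u * (f (y, 0) * C (y, u))"
      using C(2)[rule_format, of y u] by (metis distrib_left mult.left_commute)
    finally show ?thesis by (simp add: algebra_simps)
  qed
  moreover have "(\<lambda>z. B z * g z + f (fst z, 0) * C z) \<in> generated_algebra chart_gens"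
    using generated_algebra.add[OF generated_algebra.mult[OF B(1) mult.hyps(2)]
        generated_algebra.mult[OF mult.IH(1)[THEN conjunct1] C(1)]] .
  ultimately show ?case
    using generated_algebra.mult[OF mult.IH(1)[THEN conjunct1] mult.IH(2)[THEN conjunct1]]
    by (intro conjI bexI[of _ "\<lambda>z. B z * g z + f (fst z, 0) * C z"] allI)
qed

text \<open>If a multihomogeneous function does not vanish at the point, then it does not vanish for some
  \<open>t \<noteq> 0\<close> on the curve \<open>t \<mapsto> chart_lift (y, t)\<close> either, because it is a polynomial in \<open>t\<close> there;
  and for \<open>t \<noteq> 0\<close> these are homogeneous coordinates of points of \<open>L\<close>.\<close>
lemma orbit_point_Y: assumes "y \<in> L" shows "orbit_point y \<in> Y"
  unfolding Y_def in_closure_of topspace_zariski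
proof (intro conjI allI impI orbit_point_PA)
  fix T assume T: "orbit_point y \<in> T \<and> openin zariski T"
  then have T1: "orbit_point y \<in> T" and T2: "openin zariski T" by auto
  note * = T2[unfolded openin_zariski_iff, THEN conjunct2, THEN bspec, OF T1]
  obtain G d where G: "multihomogeneous d G" "G (std_lift (orbit_point y)) \<noteq> 0" "\<forall>Q\<in>PA. G (std_lift Q) \<noteq> 0 \<longrightarrow> Q \<in> T"
    using * by (elim exE conjE) (rule that)
  have "G \<in> homog_coord_ring" using G(1) unfolding multihomogeneous_def by blast
  from chart_poly[OF homog_chart_lift[OF this]] obtain p where p: "\<And>t. G (chart_lift (y, t)) = poly p t" by blast
  have "poly p 0 \<noteq> 0"
    using nonzero_on_lift_iff[OF orbit_point_PA chart_lift_lifts_orbit_point G(1), of y] G(2) p[of 0] by simp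
  then obtain t where t: "t \<noteq> 0" "poly p t \<noteq> 0" using poly_two_nonzero[of p 0 p 0 0] by blast
  have "G (std_lift (embed (y + scale (inverse t) \<alpha>))) \<noteq> 0"
    using nonzero_on_lift_iff[OF embed_PA chart_lift_lifts_embed[OF t(1)] G(1), of y] t(2) p[of t] by simp
  then have "embed (y + scale (inverse t) \<alpha>) \<in> T" using G(3) embed_PA by blast
  moreover have "y + scale (inverse t) \<alpha> \<in> L" using assms \<alpha>_L L_closed by blast
  ultimately show "\<exists>Q. Q \<in> embed ` L \<and> Q \<in> T" by blast
qed

lemma flat_orbit_eq: "flat_orbit F = orbit_point ` L"
  unfolding flat_orbit_def orbit_point_def by simp

lemma orbit_point_D: "y \<in> L \<Longrightarrow> orbit_point y \<in> D_flat F"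
  unfolding D_flat_def flat_orbit_eq
  using closure_of_subset[of "orbit_point ` L" zariski] orbit_point_PA topspace_zariski by auto

lemma open_meets_D:
  assumes "open_Y U" "U \<inter> D_flat F \<noteq> {}"
  shows "\<exists>y\<in>L. orbit_point y \<in> U"
  using open_Y_meets_closure[of U "orbit_point ` L"] assms orbit_point_Y unfolding D_flat_def flat_orbit_eq by blast

lemma orbit_point_nonzero:
  assumes "multihomogeneous d G"
  shows "(\<lambda>y. G (chart_lift (y, 0))) \<in> polyfuns" "G (chart_lift (y, 0)) \<noteq> 0 \<longleftrightarrow> G (std_lift (orbit_point y)) \<noteq> 0"
  using assms chart_restrict[OF homog_chart_lift] nonzero_on_lift_iff[OF orbit_point_PA chart_lift_lifts_orbit_point assms]
  unfolding multihomogeneous_def by blast+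

text \<open>The orbit is parametrized by the vector space \<open>L\<close>, whose nonempty open subsets meet.\<close>
lemma D_irreducible:
  assumes "open_Y U1" "open_Y U2" "U1 \<inter> D_flat F \<noteq> {}" "U2 \<inter> D_flat F \<noteq> {}"
  shows "U1 \<inter> U2 \<inter> D_flat F \<noteq> {}"
proof -
  obtain y1 where y1: "y1 \<in> L" "orbit_point y1 \<in> U1" using open_meets_D assms by blast
  obtain y2 where y2: "y2 \<in> L" "orbit_point y2 \<in> U2" using open_meets_D assms by blast
  obtain G1 d1 where G1: "multihomogeneous d1 G1" "G1 (std_lift (orbit_point y1)) \<noteq> 0" "\<forall>Q\<in>Y. G1 (std_lift Q) \<noteq> 0 \<longrightarrow> Q \<in> U1"
    using open_YE[OF assms(1) y1(2)] .
  obtain G2 d2 where G2: "multihomogeneous d2 G2" "G2 (std_lift (orbit_point y2)) \<noteq> 0" "\<forall>Q\<in>Y. G2 (std_lift Q) \<noteq> 0 \<longrightarrow> Q \<in> U2"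
    using open_YE[OF assms(2) y2(2)] .
  have "G1 (chart_lift (y1, 0)) \<noteq> 0" "G2 (chart_lift (y2, 0)) \<noteq> 0"
    using orbit_point_nonzero(2) G1(1,2) G2(1,2) by blast+
  from polyfuns_nonzero_together[OF orbit_point_nonzero(1)[OF G1(1)] orbit_point_nonzero(1)[OF G2(1)] y1(1) y2(1) this]
  obtain y where y: "y \<in> L" "G1 (chart_lift (y, 0)) \<noteq> 0" "G2 (chart_lift (y, 0)) \<noteq> 0" by blast
  then have "orbit_point y \<in> U1 \<inter> U2"
    using orbit_point_nonzero(2)[OF G1(1)] orbit_point_nonzero(2)[OF G2(1)] G1(3) G2(3) orbit_point_Y by blast
  then show ?thesis using orbit_point_D y(1) by blast
qed

lemma hcoord_orbit_point: "e \<in> F \<Longrightarrow> hcoord e (orbit_point y) = coord e y" "hcoord e0 (orbit_point y) \<noteq> 0"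
proof -
  assume e: "e \<in> F"
  have "component (fst (std_lift (orbit_point y))) e = component y e"
    using component_std_lift[OF orbit_point_PA F_E[OF e]] orbit_point_simps(1)[OF e] by simp
  then show "hcoord e (orbit_point y) = coord e y" using bvec(1)[OF F_E[OF e]] by (simp add: component_coord F_E[OF e])
next
  have "component (fst (std_lift (orbit_point y))) e0 = bvec e0"
    using component_std_lift[OF orbit_point_PA e0_E(1)] orbit_point_simps(2)[OF e0] by simp
  then show "hcoord e0 (orbit_point y) \<noteq> 0" using bvec(1)[OF e0_E(1)] component_eq_0_iff[OF e0_E(1)] by metis
qed

lemma orbit_point_W: "y \<in> L \<Longrightarrow> orbit_point y \<in> W"
  unfolding W_def using orbit_point_Y hcoord_orbit_point(2) orbit_point_simps(1) by auto

lemma chart_u_orbit_point: "chart_u (orbit_point y) = 0"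
  unfolding chart_u_def using snd_std_lift[of "orbit_point y" e0] orbit_point_simps(2)[OF e0] by simp

lemma chart_y_orbit_point: "y \<in> L \<Longrightarrow> chart_y (orbit_point y) = \<tau> y"
proof -
  assume "y \<in> L"
  have "(\<Sum>e\<in>F. scale (hcoord e (orbit_point y)) (bvec e)) = projF y"
    unfolding projF_def by (intro sum.cong refl) (simp add: hcoord_orbit_point)
  then show ?thesis unfolding chart_y_def using \<sigma>_projF[OF \<open>y \<in> L\<close>] by simp
qed

lemma orbit_point_\<tau>: "orbit_point (\<tau> y) = orbit_point y"
proof
  fix e
  have "component (\<tau> y) e = component y e" if "e \<in> F"
    using that \<alpha>_on_F[OF that] F_E[OF that] by (simp add: component_coord \<tau>_def coord_diff coord_scale)
  then show "orbit_point (\<tau> y) e = orbit_point y e"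
    by (cases "e \<in> F"; cases "e \<in> E") (use orbit_point_simps F_E in \<open>auto simp: orbit_point_def translate_def\<close>)
qed

lemma W_local_ring: "open_Y W" "W \<inter> D_flat F \<noteq> {}"
  using open_W orbit_point_W[of 0] orbit_point_D[of 0] L_closed(4) by blast+

lemma chart_u_max_ideal: "(W, chart_u) \<in> max_ideal (D_flat F)"
proof -
  have "chart_u P = 0" if P: "P \<in> W \<inter> D_flat F" for P
  proof (rule ccontr)
    assume "chart_u P \<noteq> 0"
    then have "{P \<in> W. chart_u P \<noteq> 0} \<inter> D_flat F \<noteq> {}" using P by blast
    from open_meets_D[OF open_Y_nonzero[OF regular_chart_u] this] show False using chart_u_orbit_point by auto
  qed
  then show ?thesis unfolding max_ideal_def local_ring_def using W_local_ring regular_chart_u by auto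
qed

lemma chart_lift_lifts_chart:
  assumes "x \<in> L" "embed x \<in> W"
  shows "is_lift (embed x) (chart_lift (chart_y (embed x), chart_u (embed x)))"
proof -
  have "coord e0 x \<noteq> 0" using assms embed_in_W_iff by blast
  then have u: "chart_u (embed x) \<noteq> 0" using \<alpha>_off_F[OF e0] by (simp add: chart_u_embed)
  have "chart_y (embed x) + scale (inverse (chart_u (embed x))) \<alpha> = x"
    using \<tau>_add_\<alpha>[of x] by (simp add: chart_y_embed[OF assms(1)] chart_u_embed)
  with chart_lift_lifts_embed[OF u, of "chart_y (embed x)"] show ?thesis by simp
qed

text \<open>A function in the maximal ideal is locally \<open>G / H\<close>. In the chart, \<open>G\<close> becomes a polynomial in
  \<open>(y, u)\<close> that vanishes on a nonempty open part of \<open>u = 0\<close>, hence on all of it, so that \<open>u\<close> can be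
  divided out. The resulting identity holds on \<open>L\<close> and extends by density.\<close>
lemma uniformizer_chart_u: "uniformizer (D_flat F) W chart_u"
  unfolding uniformizer_def
proof (intro conjI ballI chart_u_max_ideal, clarify)
  fix W' g assume "(W', g) \<in> max_ideal (D_flat F)"
  then have W': "open_Y W'" "W' \<inter> D_flat F \<noteq> {}" "regular_on W' g"
    and g0: "\<And>P. P \<in> W' \<inter> D_flat F \<Longrightarrow> g P = 0"
    unfolding max_ideal_def local_ring_def by auto
  obtain y0 where y0: "y0 \<in> L" "orbit_point y0 \<in> W'" using open_meets_D[OF W'(1,2)] by blast
  obtain G H d where GH: "multihomogeneous d G" "multihomogeneous d H" "H (std_lift (orbit_point y0)) \<noteq> 0"
    "\<And>Q. Q \<in> Y \<Longrightarrow> H (std_lift Q) \<noteq> 0 \<Longrightarrow> Q \<in> W'"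
    "\<And>Q. Q \<in> Y \<Longrightarrow> H (std_lift Q) \<noteq> 0 \<Longrightarrow> g Q = G (std_lift Q) / H (std_lift Q)"
    using regular_onE[OF W'(3) y0(2)] by metis
  have ring: "G \<in> homog_coord_ring" "H \<in> homog_coord_ring"
    using GH(1,2) unfolding multihomogeneous_def by blast+
  have vanish: "G (chart_lift (y, 0)) = 0" if y: "y \<in> L" for y
  proof (rule ccontr)
    assume "G (chart_lift (y, 0)) \<noteq> 0"
    moreover have "H (chart_lift (y0, 0)) \<noteq> 0" using orbit_point_nonzero(2)[OF GH(2)] GH(3) by blast
    ultimately obtain z where z: "z \<in> L" "G (chart_lift (z, 0)) \<noteq> 0" "H (chart_lift (z, 0)) \<noteq> 0"
      using polyfuns_nonzero_together[OF orbit_point_nonzero(1)[OF GH(1)] orbit_point_nonzero(1)[OF GH(2)] y y0(1)] by blast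
    then have nz: "G (std_lift (orbit_point z)) \<noteq> 0" "H (std_lift (orbit_point z)) \<noteq> 0"
      using orbit_point_nonzero(2)[OF GH(1)] orbit_point_nonzero(2)[OF GH(2)] by blast+
    have "g (orbit_point z) = 0" using g0 GH(4)[OF orbit_point_Y[OF z(1)] nz(2)] orbit_point_D[OF z(1)] by blast
    then show False using GH(5)[OF orbit_point_Y[OF z(1)] nz(2)] nz by simp
  qed
  obtain B where B: "B \<in> chart_algebra"
    "\<And>y u. G (chart_lift (y, u)) = G (chart_lift (y, 0)) + u * B (y, u)"
    using chart_factor[OF homog_chart_lift[OF ring(1)]] by blast
  let ?H = "\<lambda>P. H (chart_lift (chart_y P, chart_u P))"
  have regH: "regular_on W ?H" using regular_chart[OF homog_chart_lift[OF ring(2)]] .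
  define W'' where "W'' = {P \<in> W. ?H P \<noteq> 0}"
  define h where "h P = B (chart_y P, chart_u P) * inverse (?H P)" for P
  have W'': "open_Y W''" unfolding W''_def using open_Y_nonzero[OF regH] .
  have regh: "regular_on W'' h"
    unfolding h_def using regular_on_inverse[OF regH] W''
    by (intro regular_on_mult regular_on_subset[OF regular_chart[OF B(1)]]) (auto simp: W''_def)
  have "H (chart_lift (\<tau> y0, 0)) \<noteq> 0" using orbit_point_nonzero(2)[OF GH(2), of "\<tau> y0"] orbit_point_\<tau> GH(3) by simp
  then have "orbit_point y0 \<in> W''" unfolding W''_def using orbit_point_W[OF y0(1)] chart_u_orbit_point chart_y_orbit_point[OF y0(1)] by simp
  then have "W'' \<inter> D_flat F \<noteq> {}" using orbit_point_D[OF y0(1)] by blast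
  with W'' regh have loc: "(W'', h) \<in> local_ring (D_flat F)" unfolding local_ring_def by blast
  have "g P = chart_u P * h P" if P: "P \<in> W \<inter> W' \<inter> W''" for P
  proof (rule regular_on_eq[of "W \<inter> W' \<inter> W''"])
    have op: "open_Y (W \<inter> W' \<inter> W'')" using open_W W'(1) W'' by (intro open_Y_Int)
    show "regular_on (W \<inter> W' \<inter> W'') g" using op by (rule regular_on_subset[OF W'(3)]) blast
    show "regular_on (W \<inter> W' \<inter> W'') (\<lambda>P. chart_u P * h P)"
      using op by (intro regular_on_mult regular_on_subset[OF regular_chart_u] regular_on_subset[OF regh]) auto
    fix x assume x: "x \<in> L" "embed x \<in> W \<inter> W' \<inter> W''"
    let ?z = "chart_lift (chart_y (embed x), chart_u (embed x))"
    have lift: "is_lift (embed x) ?z" using chart_lift_lifts_chart x by blast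
    have "H ?z \<noteq> 0" using x unfolding W''_def by blast
    then have "H (std_lift (embed x)) \<noteq> 0" using nonzero_on_lift_iff[OF embed_PA lift GH(2)] by blast
    then have "g (embed x) = G ?z / H ?z"
      using GH(5) embed_Y x(1) fraction_on_lift[OF embed_PA lift GH(1,2)] by simp
    also have "G ?z = chart_u (embed x) * B (chart_y (embed x), chart_u (embed x))"
      using B(2)[of "chart_y (embed x)" "chart_u (embed x)"] vanish[OF \<tau>_L[OF x(1)]] chart_y_embed[OF x(1)] by simp
    finally show "g (embed x) = chart_u (embed x) * h (embed x)" by (simp add: h_def divide_inverse)
  qed (rule P)
  with loc show "\<exists>(W'', h)\<in>local_ring (D_flat F). \<forall>P\<in>W \<inter> W' \<inter> W''. g P = chart_u P * h P" by blast
qed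

text \<open>If \<open>t\<close> is another uniformizer, then \<open>u = t a\<close> and \<open>t = u b\<close> with \<open>a b = 1\<close>. Two expressions of \<open>f\<close>
  with exponents \<open>m \<noteq> n\<close> would, after division by the smaller power of \<open>u\<close>, give an equation
  between a unit and a multiple of \<open>u\<close>; evaluating it at a point of the orbit at which
  all functions involved are defined and both units do not vanish is a contradiction.\<close>
lemma ord_along_eq:
  assumes U: "regular_on U f" "embed ` L \<subseteq> U"
    and h: "(W, h) \<in> local_ring (D_flat F) - max_ideal (D_flat F)"
    and fh: "\<And>x. x \<in> L \<Longrightarrow> embed x \<in> W \<Longrightarrow> f (embed x) = chart_u (embed x) powi n * h (embed x)"
  shows "ord_along (D_flat F) U f = n"
  unfolding ord_along_def
proof (rule the_equality)
  have regh: "regular_on W h" using h unfolding local_ring_def by blast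
  have openU: "open_Y U" using regular_on_open[OF U(1)] .
  have embed_u: "chart_u (embed x) \<noteq> 0" if "x \<in> L" "embed x \<in> W" for x
    using that embed_in_W_iff \<alpha>_off_F[OF e0] by (simp add: chart_u_embed)
  have "f P = chart_u P powi n * h P" if P: "P \<in> U \<inter> W \<inter> W" "chart_u P \<noteq> 0" for P
  proof (rule regular_on_eq[of "U \<inter> {P \<in> W. chart_u P \<noteq> 0}"])
    let ?O = "U \<inter> {P \<in> W. chart_u P \<noteq> 0}"
    have op: "open_Y ?O" using openU open_Y_nonzero[OF regular_chart_u] by (rule open_Y_Int)
    show "regular_on ?O f" using op by (rule regular_on_subset[OF U(1)]) blast
    show "regular_on ?O (\<lambda>P. chart_u P powi n * h P)" using op
      by (intro regular_on_mult regular_on_powi regular_on_subset[OF regular_chart_u] regular_on_subset[OF regh]) auto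
    show "f (embed x) = chart_u (embed x) powi n * h (embed x)" if "x \<in> L" "embed x \<in> ?O" for x
      using fh that by blast
  qed (use P in blast)
  then show "\<exists>W t. uniformizer (D_flat F) W t \<and> (\<exists>(W', h)\<in>local_ring (D_flat F) - max_ideal (D_flat F).
        \<forall>P\<in>U \<inter> W \<inter> W'. t P \<noteq> 0 \<longrightarrow> f P = t P powi n * h P)"
    using uniformizer_chart_u h by (intro exI[of _ W] exI[of _ chart_u] conjI bexI[of _ "(W, h)"]) auto
  fix m
  assume "\<exists>W t. uniformizer (D_flat F) W t \<and> (\<exists>(W', h)\<in>local_ring (D_flat F) - max_ideal (D_flat F).
        \<forall>P\<in>U \<inter> W \<inter> W'. t P \<noteq> 0 \<longrightarrow> f P = t P powi m * h P)"
  then obtain W1 t W1' h1 where t: "uniformizer (D_flat F) W1 t"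
    and h1: "(W1', h1) \<in> local_ring (D_flat F) - max_ideal (D_flat F)"
    and fh1: "\<And>P. P \<in> U \<inter> W1 \<inter> W1' \<Longrightarrow> t P \<noteq> 0 \<Longrightarrow> f P = t P powi m * h1 P" by auto
  have t_max: "(W1, t) \<in> max_ideal (D_flat F)" using t unfolding uniformizer_def by blast
  obtain W2 a where a: "(W2, a) \<in> local_ring (D_flat F)"
    and ta: "\<And>P. P \<in> W1 \<inter> W \<inter> W2 \<Longrightarrow> chart_u P = t P * a P"
    using t chart_u_max_ideal unfolding uniformizer_def by blast
  obtain W3 b where b: "(W3, b) \<in> local_ring (D_flat F)"
    and ub: "\<And>P. P \<in> W \<inter> W1 \<inter> W3 \<Longrightarrow> t P = chart_u P * b P"
    using uniformizer_chart_u t_max unfolding uniformizer_def by blast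
  have reg: "regular_on W1 t" "regular_on W2 a" "regular_on W3 b" "regular_on W1' h1"
    using t_max a b h1 unfolding max_ideal_def local_ring_def by auto
  define V where "V = {P \<in> W. h P \<noteq> 0}"
  define V1 where "V1 = {P \<in> W1'. h1 P \<noteq> 0}"
  have V: "open_Y V" "V \<inter> D_flat F \<noteq> {}" "open_Y V1" "V1 \<inter> D_flat F \<noteq> {}"
    using open_Y_nonzero[OF regh] open_Y_nonzero[OF reg(4)] h h1
    unfolding V_def V1_def max_ideal_def local_ring_def by auto
  have op: "open_Y W1" "W1 \<inter> D_flat F \<noteq> {}" "open_Y W2" "W2 \<inter> D_flat F \<noteq> {}"
    "open_Y W3" "W3 \<inter> D_flat F \<noteq> {}"
    using t_max a b unfolding max_ideal_def local_ring_def by auto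
  \<comment> \<open>A neighbourhood of a point of the orbit on which everything is defined.\<close>
  define Q where "Q = V \<inter> V1 \<inter> W1 \<inter> W2 \<inter> W3"
  have openQ: "open_Y Q" unfolding Q_def using V op by (intro open_Y_Int)
  have "Q \<inter> D_flat F \<noteq> {}"
    unfolding Q_def using V op by (intro D_irreducible open_Y_Int)
  then obtain y where y: "y \<in> L" "orbit_point y \<in> Q" using open_meets_D[OF openQ] by blast
  have sub: "Q \<subseteq> W" "Q \<subseteq> W1" "Q \<subseteq> W2" "Q \<subseteq> W3" "Q \<subseteq> W1'" unfolding Q_def V_def V1_def by blast+
  have rQ: "regular_on Q chart_u" "regular_on Q t" "regular_on Q a" "regular_on Q b"
     "regular_on Q h" "regular_on Q h1"
    using regular_on_subset[OF _ openQ] regular_chart_u reg regh sub by blast+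
  have em: "a (embed x) * b (embed x) = 1"
    "chart_u (embed x) powi m * b (embed x) powi m * h1 (embed x) = chart_u (embed x) powi n * h (embed x)"
    if x: "x \<in> L" "embed x \<in> Q" for x
  proof -
    have u: "chart_u (embed x) \<noteq> 0" using embed_u x sub by blast
    have e1: "chart_u (embed x) = t (embed x) * a (embed x)" using ta x sub by blast
    have e2: "t (embed x) = chart_u (embed x) * b (embed x)" using ub x sub by blast
    have "chart_u (embed x) * (a (embed x) * b (embed x)) = chart_u (embed x) * 1"
      using e1 e2 by (metis mult.assoc mult.commute mult_1)
    then show "a (embed x) * b (embed x) = 1" using u by simp
    have "t (embed x) \<noteq> 0" using e1 u by auto
    then have "f (embed x) = t (embed x) powi m * h1 (embed x)" using fh1 x sub U(2) by blast
    then show "chart_u (embed x) powi m * b (embed x) powi m * h1 (embed x) = chart_u (embed x) powi n * h (embed x)"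
      using fh[of x] x sub e2 by (auto simp: power_int_mult_distrib)
  qed
  have ab: "a P * b P = 1" if "P \<in> Q" for P
    using regular_on_eq[OF regular_on_mult[OF rQ(3,4)] regular_on_const[OF openQ, of 1] _ that] em(1) by simp
  then have b0: "b P \<noteq> 0" if "P \<in> Q" for P using that by force
  have rb: "regular_on Q (\<lambda>P. b P powi m)" by (rule regular_on_powi[OF rQ(4) b0])
  have hy: "h (orbit_point y) \<noteq> 0" "h1 (orbit_point y) \<noteq> 0" using y unfolding Q_def V_def V1_def by blast+
  show "m = n"
  proof (rule ccontr)
    assume "m \<noteq> n"
    then consider "m < n" | "n < m" by linarith
    then show False
    proof cases
      case 1
      define j where "j = nat (n - m)"
      have j: "n = m + int j" "j > 0" using 1 unfolding j_def by auto
      have "b (orbit_point y) powi m * h1 (orbit_point y) = chart_u (orbit_point y) ^ j * h (orbit_point y)"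
      proof (rule regular_on_eq[OF regular_on_mult[OF rb rQ(6)] regular_on_mult[OF regular_on_power[OF rQ(1)] rQ(5)] _ y(2)])
        fix x assume x: "x \<in> L" "embed x \<in> Q"
        have u: "chart_u (embed x) \<noteq> 0" using embed_u x sub by blast
        have "chart_u (embed x) powi m * (b (embed x) powi m * h1 (embed x))
           = chart_u (embed x) powi m * (chart_u (embed x) ^ j * h (embed x))"
          using em(2)[OF x] u unfolding j(1) by (simp add: power_int_add mult.assoc)
        then show "b (embed x) powi m * h1 (embed x) = chart_u (embed x) ^ j * h (embed x)" using u by simp
      qed
      then show False using b0[OF y(2)] hy j(2) chart_u_orbit_point[of y] by (simp add: power_0_left)
    next
      case 2
      define j where "j = nat (m - n)"
      have j: "m = n + int j" "j > 0" using 2 unfolding j_def by auto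
      have "chart_u (orbit_point y) ^ j * (b (orbit_point y) powi m * h1 (orbit_point y)) = h (orbit_point y)"
      proof (rule regular_on_eq[OF regular_on_mult[OF regular_on_power[OF rQ(1)] regular_on_mult[OF rb rQ(6)]] rQ(5) _ y(2)])
        fix x assume x: "x \<in> L" "embed x \<in> Q"
        have u: "chart_u (embed x) \<noteq> 0" using embed_u x sub by blast
        have "chart_u (embed x) powi n * (chart_u (embed x) ^ j * (b (embed x) powi m * h1 (embed x)))
           = chart_u (embed x) powi m * b (embed x) powi m * h1 (embed x)"
          using u unfolding j(1) by (simp add: power_int_add mult.assoc)
        also have "\<dots> = chart_u (embed x) powi n * h (embed x)" using em(2)[OF x] .
        finally show "chart_u (embed x) ^ j * (b (embed x) powi m * h1 (embed x)) = h (embed x)" using u by simp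
      qed
      then show False using hy j(2) chart_u_orbit_point[of y] by (simp add: power_0_left)
    qed
  qed
qed

lemma polyfun_chart_algebra:
  assumes "f \<in> polyfuns" shows "(\<lambda>z. f (fst z)) \<in> chart_algebra"
  unfolding chart_algebra_def
  by (rule generated_algebra_pullback[OF assms]) (use chart_fst chart_algebra_def in auto)

text \<open>With \<open>f (y + t \<alpha>) = c\<^sub>0 y + c\<^sub>1 y t + \<dots> + c\<^sub>N y t\<^sup>N\<close> and \<open>t = 1 / u\<close> one gets
  \<open>f = u\<^sup>-\<^sup>N (c\<^sub>N y + u (\<dots>))\<close>, where the second factor is a unit of the local ring if \<open>c\<^sub>N\<close> does not
  vanish identically. Thus the order of the pole of \<open>f\<close> is the degree of \<open>f\<close> in direction \<open>\<alpha>\<close>.\<close>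
theorem ord_along_polyfun:
  assumes f: "f \<in> polyfuns" and nz: "\<exists>x\<in>L. f x \<noteq> 0"
  shows "\<exists>N. (\<forall>U g. regular_on U g \<longrightarrow> embed ` L \<subseteq> U \<longrightarrow> (\<forall>x\<in>L. g (embed x) = f x) \<longrightarrow>
        ord_along (D_flat F) U g = - int N) \<and> (\<forall>q. deg_below f \<alpha> q \<longleftrightarrow> N < q)"
proof -
  obtain M c where c: "\<And>j. c j \<in> polyfuns" "\<And>y t. f (y + scale t \<alpha>) = (\<Sum>j\<le>M. c j y * t ^ j)"
    using polyfun_expand_along[OF f, of \<alpha>] by metis
  \<comment> \<open>The degree is the largest index whose coefficient survives on \<open>L\<close>; the coefficients are taken at \<open>\<tau> y\<close> since these are the values of \<open>chart_y\<close>.\<close>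
  define J where "J = {j. j \<le> M \<and> (\<exists>y\<in>L. c j (\<tau> y) \<noteq> 0)}"
  have expand: "f x = (\<Sum>j\<le>M. c j (\<tau> x) * (coord e0 x / coord e0 \<alpha>) ^ j)" for x
    using c(2)[of "\<tau> x" "coord e0 x / coord e0 \<alpha>"] \<tau>_add_\<alpha>[of x] by simp
  have "J \<noteq> {}"
  proof
    assume "J = {}"
    then have "c j (\<tau> y) = 0" if "j \<le> M" "y \<in> L" for j y using that unfolding J_def by blast
    then have "f x = 0" if "x \<in> L" for x using expand[of x] that by simp
    then show False using nz by blast
  qed
  moreover have finJ: "finite J" unfolding J_def by simp
  ultimately have "Max J \<in> J" by simp
  define N where "N = Max J"
  obtain y0 where y0: "y0 \<in> L" "c N (\<tau> y0) \<noteq> 0" and NM: "N \<le> M"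
    using \<open>Max J \<in> J\<close> unfolding J_def N_def by auto
  have above: "c j (\<tau> y) = 0" if "j > N" "j \<le> M" "y \<in> L" for j y
  proof (rule ccontr)
    assume "c j (\<tau> y) \<noteq> 0"
    then have "j \<in> J" using that unfolding J_def by blast
    then show False using Max_ge[OF finJ, of j] that unfolding N_def by linarith
  qed
  have expandN: "f (\<tau> x + scale t \<alpha>) = (\<Sum>j\<le>N. c j (\<tau> x) * t ^ j)" if "x \<in> L" for x t
    unfolding c(2) by (rule sum.mono_neutral_right) (use NM above that in auto)
  define g where "g = (\<lambda>z. \<Sum>j\<le>N. c j (fst z) * snd z ^ (N - j))"
  have g: "g \<in> chart_algebra"
  proof -
    note chart_snd
    moreover have "(\<lambda>z. c j (fst z)) \<in> chart_algebra" for j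
      using polyfun_chart_algebra[OF c(1)] .
    ultimately have "(\<lambda>z. \<Sum>j\<le>N. c j (fst z) * snd z ^ (N - j)) \<in> chart_algebra"
      unfolding chart_algebra_def
      by (intro generated_algebra_sum generated_algebra.mult generated_algebra_power)
    then show ?thesis unfolding g_def .
  qed
  define h where "h P = g (chart_y P, chart_u P)" for P
  have g0: "g (y, 0) = c N y" for y
  proof -
    have "g (y, 0) = (\<Sum>j\<le>N. if j = N then c j y else 0)"
      unfolding g_def fst_conv snd_conv by (intro sum.cong refl) (auto simp: power_0_left)
    then show ?thesis by simp
  qed
  have "h (orbit_point y0) \<noteq> 0" unfolding h_def using chart_u_orbit_point chart_y_orbit_point[OF y0(1)] y0(2) g0 by simp
  then have h: "(W, h) \<in> local_ring (D_flat F) - max_ideal (D_flat F)"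
    using W_local_ring regular_chart[OF g] orbit_point_W[OF y0(1)] orbit_point_D[OF y0(1)]
    unfolding max_ideal_def local_ring_def h_def by auto
  have fh: "f x = chart_u (embed x) powi (- int N) * h (embed x)" if x: "x \<in> L" "embed x \<in> W" for x
  proof -
    define t where "t = coord e0 x / coord e0 \<alpha>"
    have t0: "t \<noteq> 0" using x embed_in_W_iff \<alpha>_off_F[OF e0] unfolding t_def by simp
    have u: "chart_u (embed x) = inverse t" unfolding t_def by (simp add: chart_u_embed)
    have "f x = (\<Sum>j\<le>N. c j (\<tau> x) * t ^ j)"
      using expandN[OF x(1), of t] \<tau>_add_\<alpha>[of x] unfolding t_def by simp
    also have "\<dots> = (\<Sum>j\<le>N. t ^ N * (c j (\<tau> x) * inverse t ^ (N - j)))"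
    proof (intro sum.cong refl)
      fix j assume "j \<in> {..N}"
      then have "t ^ N = t ^ j * t ^ (N - j)" by (simp flip: power_add)
      then show "c j (\<tau> x) * t ^ j = t ^ N * (c j (\<tau> x) * inverse t ^ (N - j))"
        using t0 by (simp add: field_simps)
    qed
    also have "\<dots> = t ^ N * g (\<tau> x, inverse t)" by (simp add: g_def sum_distrib_left)
    also have "t ^ N = chart_u (embed x) powi (- int N)" unfolding u by (simp add: power_int_minus power_inverse)
    finally show ?thesis unfolding h_def u chart_y_embed[OF x(1)] .
  qed
  have deg: "deg_below f \<alpha> q \<longleftrightarrow> N < q" for q
  proof
    assume q: "deg_below f \<alpha> q"
    obtain p where p: "\<forall>t. poly p t = (\<Sum>j\<le>N. c j (\<tau> y0) * t ^ j)"
      "\<forall>j. coeff p j = (if j \<le> N then c j (\<tau> y0) else 0)"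
      using poly_of_coeffs[where N = N and c = "\<lambda>j. c j (\<tau> y0)"] by blast
    have "\<forall>t. f (\<tau> y0 + scale t \<alpha>) = poly p t" using expandN[OF y0(1)] p(1) by simp
    then have "\<forall>j\<ge>q. coeff p j = 0" using q \<tau>_L[OF y0(1)] unfolding deg_below_def by blast
    then show "N < q" using p(2) y0(2) by (metis le_refl linorder_not_le)
  next
    assume q: "N < q"
    show "deg_below f \<alpha> q" unfolding deg_below_def
    proof (intro ballI allI impI)
      fix x p j assume x: "x \<in> L" and p: "\<forall>t. f (x + scale t \<alpha>) = poly p t" and j: "q \<le> j"
      define s where "s = coord e0 x / coord e0 \<alpha>"
      obtain r where r: "degree r \<le> N" "\<forall>t. poly r t = (\<Sum>j\<le>N. c j (\<tau> x) * t ^ j)"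
        using poly_of_coeffs[where N = N and c = "\<lambda>j. c j (\<tau> x)"] by blast
      have "p = pcompose r [:s, 1:]"
      proof (rule poly_eq_except)
        fix t
        have "x + scale t \<alpha> = \<tau> x + scale (s + t) \<alpha>"
          using \<tau>_add_\<alpha>[of x, folded s_def] by (simp only: scale_left_distrib add.assoc[symmetric])
        then have "poly p t = poly r (s + t)" using p r(2) expandN[OF x, of "s + t"] by metis
        then show "poly p t = poly (pcompose r [:s, 1:]) t" by (simp add: poly_pcompose)
      qed
      then have "degree p \<le> N" using r(1) by (simp add: degree_pcompose)
      then show "coeff p j = 0" using q j by (intro coeff_eq_0) linarith
    qed
  qed
  have "ord_along (D_flat F) U k = - int N"
    if "regular_on U k" "embed ` L \<subseteq> U" "\<forall>x\<in>L. k (embed x) = f x" for U k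
    using that fh by (intro ord_along_eq[OF _ _ h]) auto
  with deg show ?thesis by blast
qed

end

section \<open>Degrees and differential operators\<close>

lemma iterated_pderiv_eq_0_iff:
  fixes p :: "'a::field_char_0 poly"
  shows "(pderiv ^^ n) p = 0 \<longleftrightarrow> (\<forall>j\<ge>n. coeff p j = 0)"
proof (induction n arbitrary: p)
  case 0
  show ?case by (auto simp: poly_eq_iff)
next
  case (Suc n)
  have "(pderiv ^^ Suc n) p = 0 \<longleftrightarrow> (\<forall>j\<ge>n. of_nat (Suc j) * coeff p (Suc j) = 0)"
    unfolding funpow_Suc_right o_def Suc.IH by (simp add: coeff_pderiv)
  also have "\<dots> \<longleftrightarrow> (\<forall>j\<ge>Suc n. coeff p j = 0)"
    by (metis Suc_le_D Suc_le_mono mult_eq_0_iff of_nat_neq_0)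
  finally show ?case .
qed

lemma pcompose_power: "pcompose (p ^ n) q = pcompose p q ^ n"
  by (induction n) (auto simp: pcompose_mult pcompose_1)

lemma coeff_1_shift: "coeff (pcompose q [:t, 1:]) 1 = poly (pderiv q) t"
proof -
  have "coeff (pcompose q [:t, 1:]) 1 = coeff (pderiv (pcompose q [:t, 1:])) 0"
    by (simp add: coeff_pderiv)
  also have "\<dots> = poly (pderiv (pcompose q [:t, 1:])) 0" by (simp add: poly_0_coeff_0)
  also have "\<dots> = poly (pderiv q) t" by (simp add: pderiv_pcompose poly_pcompose pderiv_pCons)
  finally show ?thesis .
qed

lemma sum_order_le_degree:
  fixes p :: "'a::idom poly"
  assumes "p \<noteq> 0" "finite A"
  shows "(\<Sum>a\<in>A. order a p) \<le> degree p"
proof -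
  have "(\<Sum>a\<in>A. order a p) = (\<Sum>a\<in>A \<inter> set_mset (proots p). count (proots p) a)"
    using assms by (intro sum.mono_neutral_cong_right) (auto simp: order_root)
  also have "\<dots> \<le> (\<Sum>a\<in>set_mset (proots p). count (proots p) a)"
    by (rule sum_mono2) auto
  also have "\<dots> = size (proots p)" by (simp add: size_multiset_overloaded_eq)
  also have "\<dots> \<le> degree p" by (rule size_proots_le)
  finally show ?thesis .
qed

context linear_space
begin

lemma deriv_along_poly:
  assumes "x \<in> L" "\<alpha> \<in> L" "\<And>t. g (x + scale t \<alpha>) = poly q t"
  shows "deriv_along \<alpha> g (x + scale t \<alpha>) = poly (pderiv q) t"
proof -
  have eq: "g ((x + scale t \<alpha>) + scale s \<alpha>) = poly (pcompose q [:t, 1:]) s" for s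
    using assms(3)[of "t + s"] by (simp add: poly_pcompose scale_left_distrib add_ac)
  have "(THE p. \<forall>s. poly p s = g ((x + scale t \<alpha>) + scale s \<alpha>)) = pcompose q [:t, 1:]"
    unfolding eq by (rule the_equality) (auto intro: poly_eq_except)
  then show ?thesis
    unfolding deriv_along_def using assms(1,2) by (simp only: L_closed restrict_apply' coeff_1_shift)
qed

lemma iterated_deriv_along:
  assumes "x \<in> L" "\<alpha> \<in> L" "\<And>t. f (x + scale t \<alpha>) = poly p t"
  shows "(deriv_along \<alpha> ^^ n) (restrict f L) (x + scale t \<alpha>) = poly ((pderiv ^^ n) p) t"
proof (induction n arbitrary: t)
  case 0
  show ?case using assms by (simp add: L_closed)
next
  case (Suc n)
  from deriv_along_poly[OF assms(1,2) Suc.IH] show ?case by simp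
qed

text \<open>On each line parallel to \<open>\<alpha>\<close> the operator is the derivative of polynomials in one variable, and in
  characteristic 0 the kernel of its \<open>n\<close>-th power consists of the polynomials of degree less than \<open>n\<close>.\<close>
lemma iterated_deriv_along_eq_0_iff:
  assumes f: "f \<in> polyfuns" and \<alpha>: "\<alpha> \<in> L"
  shows "(deriv_along \<alpha> ^^ n) (restrict f L) = (\<lambda>x\<in>L. 0) \<longleftrightarrow> deg_below f \<alpha> n"
proof
  assume 0: "(deriv_along \<alpha> ^^ n) (restrict f L) = (\<lambda>x\<in>L. 0)"
  show "deg_below f \<alpha> n" unfolding deg_below_def
  proof (intro ballI allI impI)
    fix x p j assume x: "x \<in> L" and p: "\<forall>t. f (x + scale t \<alpha>) = poly p t" and j: "n \<le> j"
    have "poly ((pderiv ^^ n) p) t = 0" for t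
    proof -
      have "poly ((pderiv ^^ n) p) t = (deriv_along \<alpha> ^^ n) (restrict f L) (x + scale t \<alpha>)"
        using iterated_deriv_along[where f = f and p = p, OF x \<alpha>] p by metis
      then show ?thesis unfolding 0 using x \<alpha> by (simp add: L_closed)
    qed
    then have "(pderiv ^^ n) p = 0" using poly_all_0_iff_0 by blast
    then show "coeff p j = 0" using j iterated_pderiv_eq_0_iff by blast
  qed
next
  assume deg: "deg_below f \<alpha> n"
  show "(deriv_along \<alpha> ^^ n) (restrict f L) = (\<lambda>x\<in>L. 0)"
  proof
    fix x
    show "(deriv_along \<alpha> ^^ n) (restrict f L) x = (\<lambda>x\<in>L. 0) x"
    proof (cases "x \<in> L")
      case True
      obtain p where p: "\<And>t. f (x + scale t \<alpha>) = poly p t" using polyfun_line[OF f] by metis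
      then have "(pderiv ^^ n) p = 0"
        using deg True unfolding deg_below_def iterated_pderiv_eq_0_iff by blast
      then show ?thesis using iterated_deriv_along[OF True \<alpha> p, of n 0] True by simp
    next
      case False
      then show ?thesis by (cases n) (auto simp: deriv_along_def)
    qed
  qed
qed

lemma C_space_iff:
  "h \<in> C_space k \<longleftrightarrow> (\<exists>f\<in>polyfuns. h = restrict f L \<and>
     (\<forall>\<alpha>\<in>L - {0}. deg_below f \<alpha> (nat (int (mult_supp \<alpha>) + k + 1))))"
proof -
  have "h \<in> C_space k \<longleftrightarrow> (\<exists>f\<in>polyfuns. h = restrict f L \<and>
     (\<forall>\<alpha>\<in>L - {0}. (deriv_along \<alpha> ^^ nat (int (mult_supp \<alpha>) + k + 1)) h = (\<lambda>x\<in>L. 0)))"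
    unfolding C_space_def using Sym_L_dual_iff by auto
  also have "\<dots> \<longleftrightarrow> (\<exists>f\<in>polyfuns. h = restrict f L \<and>
     (\<forall>\<alpha>\<in>L - {0}. deg_below f \<alpha> (nat (int (mult_supp \<alpha>) + k + 1))))"
    by (intro bex_cong refl conj_cong ball_cong) (auto simp: iterated_deriv_along_eq_0_iff)
  finally show ?thesis .
qed

lemma mult_supp_coord: "mult_supp \<alpha> = card {e \<in> E. coord e \<alpha> \<noteq> 0}"
  unfolding mult_supp_def by (rule arg_cong[where f = card]) (auto simp: component_eq_0_iff)

lemma rho_le: assumes "\<alpha> \<in> L - {0}" shows "rho \<le> mult_supp \<alpha>"
proof -
  have "mult_supp ` (L - {0}) \<subseteq> {..card E}"
    unfolding mult_supp_def using finite_E by (auto intro!: card_mono)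
  then have "finite (mult_supp ` (L - {0}))" by (rule finite_subset) simp
  then show ?thesis unfolding rho_def using assms by (intro Min_le) auto
qed

lemma deg_below_scale:
  assumes "c \<noteq> 0" "deg_below f (scale c \<alpha>) q"
  shows "deg_below f \<alpha> q"
  unfolding deg_below_def
proof (intro ballI allI impI)
  fix x p j assume x: "x \<in> L" and p: "\<forall>t. f (x + scale t \<alpha>) = poly p t" and j: "q \<le> j"
  have "\<forall>t. f (x + scale t (scale c \<alpha>)) = poly (pcompose p [:0, c:]) t"
    using p by (simp add: poly_pcompose)
  then have "coeff (pcompose p [:0, c:]) j = 0" using assms(2) x j unfolding deg_below_def by blast
  then show "coeff p j = 0" using assms(1) by (simp add: coeff_pcompose_linear)
qed

end

section \<open>Degrees on a plane\<close>

context linear_space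
begin

text \<open>The terms of \<open>f\<close> on a plane, sorted by total degree.\<close>
lemma polyfun_plane:
  assumes "f \<in> polyfuns"
  shows "\<exists>K q. (\<forall>i j. i + j > K \<longrightarrow> q i j = 0) \<and>
    (\<forall>a b. f (x + scale a \<alpha> + scale b \<beta>) = (\<Sum>D\<le>K. \<Sum>i\<le>D. q i (D - i) * a ^ i * b ^ (D - i)))"
proof -
  from polyfun_expand_along[OF assms, of \<alpha>] obtain I c where
    C: "(\<forall>j. c j \<in> polyfuns) \<and> (\<forall>j>I. \<forall>y. c j y = 0) \<and>
      (\<forall>y t. f (y + scale t \<alpha>) = (\<Sum>j\<le>I. c j y * t ^ j))" by (elim exE)
  have c: "\<And>j. c j \<in> polyfuns" "\<And>j y. j > I \<Longrightarrow> c j y = 0"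
    "\<And>y t. f (y + scale t \<alpha>) = (\<Sum>j\<le>I. c j y * t ^ j)" using C by auto
  have "\<exists>p. \<forall>s. c i (x + scale s \<beta>) = poly p s" for i using polyfun_line[OF c(1)] by metis
  then obtain P where P: "\<And>i s. c i (x + scale s \<beta>) = poly (P i) s" by metis
  define J where "J = (\<Sum>i\<le>I. degree (P i))"
  define q where "q i j = coeff (P i) j" for i j
  have P0: "P i = 0" if "i > I" for i using c(2)[OF that] P[of i] poly_all_0_iff_0[of "P i"] by simp
  have degP: "degree (P i) \<le> J" if "i \<le> I" for i
    unfolding J_def using that by (intro member_le_sum) auto
  have q0: "q i j = 0" if "i > I \<or> j > J" for i j
    using that P0[of i] degP[of i] unfolding q_def by (cases "i > I") (auto intro!: coeff_eq_0)
  have q1: "i \<le> I" "j \<le> J" if "q i j \<noteq> 0" for i j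
    using q0[of i j] that by (metis linorder_not_le)+
  have "f (x + scale a \<alpha> + scale b \<beta>) = (\<Sum>D\<le>I + J. \<Sum>i\<le>D. q i (D - i) * a ^ i * b ^ (D - i))" for a b
  proof -
    have "f (x + scale a \<alpha> + scale b \<beta>) = f ((x + scale b \<beta>) + scale a \<alpha>)" by (simp add: add_ac)
    also have "\<dots> = (\<Sum>i\<le>I. poly (P i) b * a ^ i)" unfolding c(3) P ..
    also have "\<dots> = (\<Sum>i\<le>I. \<Sum>j\<le>J. q i j * a ^ i * b ^ j)"
    proof (intro sum.cong refl)
      fix i assume "i \<in> {..I}"
      then have "poly (P i) b = (\<Sum>j\<le>J. q i j * b ^ j)"
        unfolding q_def poly_altdef using degP[of i]
        by (intro sum.mono_neutral_left) (auto simp: coeff_eq_0)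
      then show "poly (P i) b * a ^ i = (\<Sum>j\<le>J. q i j * a ^ i * b ^ j)"
        by (simp add: sum_distrib_left mult_ac)
    qed
    also have "\<dots> = (\<Sum>(i, j)\<in>{..I} \<times> {..J}. q i j * a ^ i * b ^ j)"
      by (simp add: sum.cartesian_product)
    also have "\<dots> = (\<Sum>(i, j)\<in>{(i, j). i + j \<le> I + J}. q i j * a ^ i * b ^ j)"
    proof (rule sum.mono_neutral_left)
      have "{(i, j). i + j \<le> I + J} \<subseteq> {..I + J} \<times> {..I + J}" by auto
      then show "finite {(i, j). i + j \<le> I + J}" by (rule finite_subset) simp
    qed (use q1 in auto)
    also have "\<dots> = (\<Sum>D\<le>I + J. \<Sum>i\<le>D. q i (D - i) * a ^ i * b ^ (D - i))"
      by (rule sum.triangle_reindex_eq)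
    finally show ?thesis .
  qed
  moreover have "q i j = 0" if "i + j > I + J" for i j using q0 that by (metis add_le_mono linorder_not_le)
  ultimately show ?thesis by blast
qed

text \<open>On a translate of the plane spanned by \<open>\<alpha>\<close> and \<open>\<beta>\<close>, write the homogeneous part of degree \<open>D\<close> of \<open>f\<close> in
  terms of \<open>z = a / b\<close> as \<open>b\<^sup>D g\<^sub>D z\<close>. The bound on the degree along \<open>\<beta> - c \<alpha>\<close> says that \<open>g\<^sub>D\<close> has a zero
  of order at least \<open>D + 1 - p c\<close> at \<open>-c\<close>. If these orders add up to more than \<open>D\<close>, then \<open>g\<^sub>D = 0\<close>.
  The coefficient of \<open>z\<^sup>D\<close> in \<open>g\<^sub>D\<close> is the coefficient of degree \<open>D\<close> of \<open>f\<close> on the line parallel to \<open>\<alpha>\<close>.\<close>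
lemma plane_degree:
  assumes f: "f \<in> polyfuns" and \<alpha>: "\<alpha> \<in> L" and \<beta>: "\<beta> \<in> L" and "finite C"
    and deg: "\<And>c. c \<in> C \<Longrightarrow> deg_below f (\<beta> - scale c \<alpha>) (p c)"
    and large: "\<And>D. N \<le> D \<Longrightarrow> D < (\<Sum>c\<in>C. Suc D - p c)"
  shows "deg_below f \<alpha> N"
  unfolding deg_below_def
proof (intro ballI allI impI)
  fix x r j assume x: "x \<in> L" and r: "\<forall>t. f (x + scale t \<alpha>) = poly r t" and j: "N \<le> j"
  from polyfun_plane[OF f, of x \<alpha> \<beta>] obtain K q where
    Q: "(\<forall>i j. i + j > K \<longrightarrow> q i j = 0) \<and>
      (\<forall>a b. f (x + scale a \<alpha> + scale b \<beta>) = (\<Sum>D\<le>K. \<Sum>i\<le>D. q i (D - i) * a ^ i * b ^ (D - i)))"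
    by (elim exE)
  have q0: "q i j = 0" if "i + j > K" for i j using Q that by blast
  have q: "f (x + scale a \<alpha> + scale b \<beta>) = (\<Sum>D\<le>K. \<Sum>i\<le>D. q i (D - i) * a ^ i * b ^ (D - i))" for a b
    using Q by blast
  have "\<exists>g. degree g \<le> D \<and> (\<forall>t. poly g t = (\<Sum>i\<le>D. q i (D - i) * t ^ i)) \<and>
     (\<forall>i. coeff g i = (if i \<le> D then q i (D - i) else 0))" for D
    by (rule poly_of_coeffs)
  then obtain g where g: "\<And>D. degree (g D) \<le> D" "\<And>D t. poly (g D) t = (\<Sum>i\<le>D. q i (D - i) * t ^ i)"
    "\<And>D i. coeff (g D) i = (if i \<le> D then q i (D - i) else 0)" by metis
  have g_above: "g D = 0" if "D > K" for D using that q0 by (intro poly_eqI) (auto simp: g(3))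
  have root: "[:c, 1:] ^ (Suc D - p c) dvd g D" if c: "c \<in> C" for c D
  proof -
    define G where "G D = pcompose (g D) [:- c, 1:]" for D
    have degG: "degree (G D) \<le> D" for D using g(1)[of D] by (simp add: G_def degree_pcompose)
    have G0: "coeff (G D) k = 0" if k: "k \<le> D" "p c \<le> D - k" "D \<le> K" for D k
    proof -
      have w: "(\<Sum>D\<in>{D - k..K}. coeff (G D) (D - (D0 - k)) * w ^ (D - (D0 - k))) = 0" if "D0 = D" for w D0
      proof -
        define l where "l = D - k"
        define R where "R = (\<Sum>D\<le>K. \<Sum>k\<le>D. monom (coeff (G D) k * w ^ k) (D - k))"
        obtain u where u: "\<And>t. f ((x + scale w \<alpha>) + scale t (\<beta> - scale c \<alpha>)) = poly u t"
          using polyfun_line[OF f] by metis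
        have "u = R"
        proof (rule poly_eq_except)
          \<comment> \<open>Only \<open>s \<noteq> 0\<close>, where the quotient \<open>w / s\<close> is available.\<close>
          fix s :: 'a assume s: "s \<noteq> 0"
          have "poly u s = f (x + scale (w - c * s) \<alpha> + scale s \<beta>)"
            unfolding u[symmetric]
            by (simp add: scale_right_diff_distrib scale_left_diff_distrib mult.commute algebra_simps)
          also have "\<dots> = (\<Sum>D\<le>K. s ^ D * poly (G D) (w / s))"
            unfolding q
          proof (intro sum.cong refl)
            fix D
            have "poly (G D) (w / s) = poly (g D) ((w - c * s) / s)"
              using s by (simp add: G_def poly_pcompose diff_divide_distrib)
            also have "\<dots> = (\<Sum>i\<le>D. q i (D - i) * ((w - c * s) / s) ^ i)" by (rule g(2))
            finally have "s ^ D * poly (G D) (w / s)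
                = (\<Sum>i\<le>D. s ^ D * (q i (D - i) * ((w - c * s) / s) ^ i))"
              by (simp add: sum_distrib_left)
            also have "\<dots> = (\<Sum>i\<le>D. q i (D - i) * (w - c * s) ^ i * s ^ (D - i))"
              using s by (intro sum.cong refl) (simp add: power_divide power_diff field_simps)
            finally show "(\<Sum>i\<le>D. q i (D - i) * (w - c * s) ^ i * s ^ (D - i)) = s ^ D * poly (G D) (w / s)"
              by (rule sym)
          qed
          also have "\<dots> = poly R s"
            unfolding R_def poly_sum poly_monom
          proof (intro sum.cong refl)
            fix D
            have "poly (G D) (w / s) = (\<Sum>k\<le>D. coeff (G D) k * (w / s) ^ k)"
              unfolding poly_altdef using degG[of D]
              by (intro sum.mono_neutral_left) (auto simp: coeff_eq_0)
            then have "s ^ D * poly (G D) (w / s) = (\<Sum>k\<le>D. s ^ D * (coeff (G D) k * (w / s) ^ k))"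
              by (simp add: sum_distrib_left)
            also have "\<dots> = (\<Sum>k\<le>D. coeff (G D) k * w ^ k * s ^ (D - k))"
              using s by (intro sum.cong refl) (simp add: power_divide power_diff field_simps)
            finally show "s ^ D * poly (G D) (w / s) = (\<Sum>k\<le>D. coeff (G D) k * w ^ k * s ^ (D - k))" .
          qed
          finally show "poly u s = poly R s" .
        qed
        have "x + scale w \<alpha> \<in> L" using x \<alpha> by (simp add: L_closed)
        then have "coeff u l = 0"
          using deg[OF c] u k unfolding deg_below_def l_def by blast
        then have "0 = coeff R l" using \<open>u = R\<close> by simp
        also have "\<dots> = (\<Sum>D\<le>K. \<Sum>k\<le>D. if k = D - l \<and> l \<le> D then coeff (G D) k * w ^ k else 0)"
          unfolding R_def coeff_sum coeff_monom by (intro sum.cong refl) auto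
        also have "\<dots> = (\<Sum>D\<le>K. if l \<le> D then coeff (G D) (D - l) * w ^ (D - l) else 0)"
        proof (intro sum.cong refl)
          fix D
          show "(\<Sum>k\<le>D. if k = D - l \<and> l \<le> D then coeff (G D) k * w ^ k else 0)
            = (if l \<le> D then coeff (G D) (D - l) * w ^ (D - l) else 0)"
            by (cases "l \<le> D") (auto simp: sum.delta)
        qed
        also have "\<dots> = (\<Sum>D\<in>{l..K}. coeff (G D) (D - l) * w ^ (D - l))"
          by (rule sum.mono_neutral_cong_right) auto
        finally show ?thesis unfolding l_def that by simp
      qed
      define l where "l = D - k"
      define S where "S = (\<Sum>D\<in>{l..K}. monom (coeff (G D) (D - l)) (D - l))"
      have "poly S w = 0" for w
        using w[of D w] unfolding S_def l_def by (simp add: poly_sum poly_monom)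
      then have "S = 0" using poly_all_0_iff_0 by blast
      then have "0 = coeff S k" by simp
      also have "\<dots> = (\<Sum>D'\<in>{l..K}. if D' = D then coeff (G D') k else 0)"
        unfolding S_def coeff_sum coeff_monom l_def using k by (intro sum.cong refl) auto
      also have "\<dots> = coeff (G D) k" using k unfolding l_def by simp
      finally show ?thesis by simp
    qed
    have "monom 1 (Suc D - p c) dvd G D"
    proof (cases "D \<le> K")
      case True
      then show ?thesis unfolding monom_1_dvd_iff' using G0 by auto
    next
      case False
      then show ?thesis using g_above[of D] by (simp add: G_def)
    qed
    then obtain h where "G D = monom 1 (Suc D - p c) * h" by (elim dvdE)
    then have "pcompose (G D) [:c, 1:] = [:c, 1:] ^ (Suc D - p c) * pcompose h [:c, 1:]"
      by (simp add: pcompose_mult monom_altdef pcompose_power pcompose_pCons)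
    moreover have "pcompose (G D) [:c, 1:] = g D"
      unfolding G_def by (simp add: pcompose_assoc[symmetric] pcompose_pCons)
    ultimately show ?thesis by simp
  qed
  have "g D = 0" if D: "N \<le> D" for D
  proof (rule ccontr)
    assume nz: "g D \<noteq> 0"
    have "(\<Sum>c\<in>C. Suc D - p c) \<le> (\<Sum>c\<in>C. order (- c) (g D))"
      using root[of _ D] nz by (intro sum_mono) (metis minus_minus order_divides)
    also have "\<dots> = (\<Sum>a\<in>uminus ` C. order a (g D))"
      by (subst sum.reindex) auto
    also have "\<dots> \<le> degree (g D)" using nz \<open>finite C\<close> by (intro sum_order_le_degree) auto
    also have "\<dots> \<le> D" by (rule g(1))
    finally show False using large[OF D] by simp
  qed
  then have qj: "q j 0 = 0" using g(3)[of j j] j by simp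
  have "r = (\<Sum>D\<le>K. monom (q D 0) D)"
  proof (rule poly_eq_except)
    fix t
    have "poly r t = f (x + scale t \<alpha> + scale 0 \<beta>)" using r by simp
    also have "\<dots> = (\<Sum>D\<le>K. \<Sum>i\<le>D. if i = D then q i (D - i) * t ^ i else 0)"
      unfolding q by (intro sum.cong refl) (auto simp: power_0_left)
    also have "\<dots> = poly (\<Sum>D\<le>K. monom (q D 0) D) t" by (simp add: poly_sum poly_monom)
    finally show "poly r t = poly (\<Sum>D\<le>K. monom (q D 0) D) t" .
  qed
  then show "coeff r j = 0" using qj by (simp add: coeff_sum)
qed

end

section \<open>Flats of corank one\<close>

context linear_space
begin

interpretation VV: vector_space_pair scale scale ..

abbreviation vanishing :: "'e set \<Rightarrow> 'v set" where
  "vanishing S \<equiv> {x \<in> L. \<forall>e\<in>S. coord e x = 0}"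

lemma finite_dim_basis: "\<exists>B. finite_dimensional_vector_space scale B"
proof -
  obtain B where "independent B" "UNIV \<subseteq> span B" by (metis basis_exists)
  then have "finite_dimensional_vector_space scale B"
    using finite_independent by unfold_locales auto
  then show ?thesis by blast
qed

lemma dim_zero_space: "dim {0} = 0"
  using dim_le_card[of "{0}" "{}"] by simp

lemma dim_line: "x \<noteq> 0 \<Longrightarrow> dim (span {x}) = 1"
  using dim_span_eq_card_independent[of "{x}"] by simp

lemma subspace_vanishing: assumes "S \<subseteq> E" shows "subspace (vanishing S)"
  using assms by (intro subspaceI) (auto simp: L_closed coord_add coord_scale coord_diff subset_iff)

lemma proj_eq: assumes "S \<subseteq> E" shows "proj S v = (\<Sum>e\<in>S. scale (coord e v) (bvec e))"
  unfolding proj_def using assms by (intro sum.cong refl) (auto simp: component_coord)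

lemma coord_proj: "S \<subseteq> E \<Longrightarrow> e \<in> E \<Longrightarrow> coord e (proj S v) = (if e \<in> S then coord e v else 0)"
  using coord_sum[of e S "\<lambda>e. coord e v"] finite_subset[OF _ finite_E] by (simp add: proj_eq)

lemma rank_nullity:
  assumes S: "S \<subseteq> E"
  shows "rk S + dim (vanishing S) = dim L"
proof -
  obtain B where B: "finite_dimensional_vector_space scale B" using finite_dim_basis by blast
  interpret fd: finite_dimensional_vector_space scale B by (rule B)
  interpret fdp: finite_dimensional_vector_space_pair_1 scale B scale ..
  have lin: "Vector_Spaces.linear scale scale (proj S)"
    by (rule endo_linearI; rule coord_eqI) (auto simp: coord_proj[OF S] coord_add coord_scale coord_diff)
  interpret p: Vector_Spaces.linear scale scale "proj S" by (rule lin)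
  obtain g where g: "g ` UNIV \<subseteq> L" "Vector_Spaces.linear scale scale g" "\<forall>v\<in>proj S ` L. proj S (g v) = v"
    using VV.linear_exists_right_inverse_on[OF lin L_subspace] by blast
  interpret g: Vector_Spaces.linear scale scale g by (rule g(2))
  have gp: "proj S (g (proj S x)) = proj S x" if "x \<in> L" for x using g(3) that by blast
  have ker: "x \<in> vanishing S \<longleftrightarrow> proj S x = 0" if "x \<in> L" for x
  proof
    assume "x \<in> vanishing S"
    then show "proj S x = 0" by (intro coord_eqI) (auto simp: coord_proj[OF S])
  next
    assume "proj S x = 0"
    then have "coord e x = 0" if "e \<in> S" for e
      using coord_proj[OF S, of e x] that S by auto
    then show "x \<in> vanishing S" using that by blast
  qed
  define T where "T = g ` proj S ` L"
  have subT: "subspace T" unfolding T_def using L_subspace by (intro g.subspace_image p.subspace_image)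
  have TL: "T \<subseteq> L" unfolding T_def using g(1) by blast
  have pT: "proj S ` T = proj S ` L" unfolding T_def image_image using gp by (simp cong: image_cong)
  have "inj_on (proj S) (span T)"
    unfolding span_eq_iff[THEN iffD2, OF subT]
  proof (rule inj_onI)
    fix x y assume "x \<in> T" "y \<in> T" and eq: "proj S x = proj S y"
    then obtain a b where "a \<in> L" "x = g (proj S a)" "b \<in> L" "y = g (proj S b)" unfolding T_def by blast
    then show "x = y" using gp eq by metis
  qed
  from fdp.dim_image_eq[OF lin this] have "dim T = rk S" unfolding rk_def pT by simp
  moreover have "{x + y |x y. x \<in> vanishing S \<and> y \<in> T} = L"
  proof (intro equalityI subsetI)
    fix x assume x: "x \<in> L"
    have gx: "g (proj S x) \<in> T" using x unfolding T_def by blast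
    then have d: "x - g (proj S x) \<in> L" using x TL by (auto simp: L_closed)
    have "proj S (x - g (proj S x)) = 0" using gp[OF x] by (simp add: p.diff)
    then have "x - g (proj S x) \<in> vanishing S" using ker[OF d] by blast
    then show "x \<in> {x + y |x y. x \<in> vanishing S \<and> y \<in> T}"
      using gx by (intro CollectI exI[of _ "x - g (proj S x)"] exI[of _ "g (proj S x)"]) auto
  qed (use TL L_closed(1) in blast)
  moreover have "vanishing S \<inter> T = {0}"
  proof (intro equalityI subsetI)
    fix y assume y: "y \<in> vanishing S \<inter> T"
    then obtain x where x: "x \<in> L" "y = g (proj S x)" unfolding T_def by blast
    have "proj S y = 0" using y ker TL by blast
    then have "proj S x = 0" using gp[OF x(1)] x(2) by simp
    then show "y \<in> {0}" using x(2) by simp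
  qed (use subT subspace_vanishing[OF S] subspace_0 in auto)
  ultimately show ?thesis
    using fd.dim_sums_Int[OF subspace_vanishing[OF S] subT] dim_zero_space by simp
qed

lemma vanishing_E: "vanishing E = {0}"
proof (intro equalityI subsetI)
  fix x assume "x \<in> vanishing E"
  then have "x = 0" by (intro coord_eqI) auto
  then show "x \<in> {0}" by simp
qed (use L_closed(4) in auto)

lemma rk_E: "rk E = dim L"
  using rank_nullity[of E] dim_zero_space unfolding vanishing_E by simp

lemma stabilizer_eq_vanishing:
  assumes "F \<subseteq> E" shows "L \<inter> coord_subspace (E - F) = vanishing F"
  unfolding coord_subspace_def using assms by (auto simp: component_eq_0_iff subset_iff)

text \<open>The stabilizer of the orbit of a flat of corank 1 is a line, by \<open>rank_nullity\<close>.\<close>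
lemma alpha_flat:
  assumes F: "corank1_flat F"
  shows "alpha_flat F \<noteq> 0" "span {alpha_flat F} = vanishing F"
proof -
  have FE: "F \<subseteq> E" using F unfolding corank1_flat_def flat_def by blast
  have dim1: "dim (vanishing F) = 1"
    using rank_nullity[OF FE] rk_E F unfolding corank1_flat_def by simp
  obtain B where B: "B \<subseteq> vanishing F" "independent B" "vanishing F \<subseteq> span B" "card B = dim (vanishing F)"
    by (rule basis_exists[of "vanishing F"])
  then obtain b where b: "B = {b}" unfolding dim1 by (auto simp: card_1_singleton_iff)
  have "b \<noteq> 0 \<and> span {b} = L \<inter> coord_subspace (E - F)"
    using B b subspace_vanishing[OF FE] stabilizer_eq_vanishing[OF FE] by (metis dependent_single span_subspace)
  then show "alpha_flat F \<noteq> 0" "span {alpha_flat F} = vanishing F"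
    unfolding alpha_flat_def stabilizer_eq_vanishing[OF FE, symmetric]
    by (metis (mono_tags, lifting) someI)+
qed

text \<open>The coordinates of \<open>alpha_flat F\<close> outside \<open>F\<close> are nonzero: if one of them vanished, then adding its
  index to \<open>F\<close> would not change the rank.\<close>
lemma corank1_flat_chart:
  assumes F: "corank1_flat F"
  shows "\<exists>e0. corank1_chart scale E Vl L F (alpha_flat F) e0"
proof -
  define \<alpha> where "\<alpha> = alpha_flat F"
  have \<alpha>: "\<alpha> \<noteq> 0" "span {\<alpha>} = vanishing F" using alpha_flat[OF F] unfolding \<alpha>_def by auto
  have FE: "F \<subseteq> E" using F unfolding corank1_flat_def flat_def by blast
  have \<alpha>V: "\<alpha> \<in> vanishing F" using \<alpha>(2) span_base[of \<alpha> "{\<alpha>}"] by blast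
  have off: "coord e \<alpha> \<noteq> 0" if e: "e \<in> E - F" for e
  proof
    assume 0: "coord e \<alpha> = 0"
    have "coord e x = 0" if "x \<in> vanishing F" for x
    proof -
      have "x \<in> span {\<alpha>}" unfolding \<alpha>(2) by (rule that)
      then obtain c where "x = scale c \<alpha>" unfolding span_singleton by blast
      then show ?thesis using 0 e by (simp add: coord_add coord_scale coord_diff)
    qed
    then have "vanishing (insert e F) = vanishing F" by auto
    then have "rk (insert e F) = rk F"
      using rank_nullity[OF FE] rank_nullity[of "insert e F"] FE e by simp
    moreover have "rk F < rk (insert e F)" using F e unfolding corank1_flat_def flat_def by blast
    ultimately show False by simp
  qed
  have "\<exists>e0\<in>E. coord e0 \<alpha> \<noteq> 0"
  proof (rule ccontr)
    assume "\<not> ?thesis"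
    then have "\<alpha> = 0" by (intro coord_eqI) auto
    then show False using \<alpha>(1) by blast
  qed
  then obtain e0 where e0: "e0 \<in> E" "coord e0 \<alpha> \<noteq> 0" by blast
  have "corank1_chart scale E Vl L F \<alpha> e0"
  proof unfold_locales
    show "e0 \<in> E - F" using e0 \<alpha>V by blast
    show "\<exists>c. x = scale c \<alpha>" if "x \<in> L" "\<And>e. e \<in> F \<Longrightarrow> coord e x = 0" for x
    proof -
      have "x \<in> span {\<alpha>}" unfolding \<alpha>(2) using that by blast
      then show ?thesis unfolding span_singleton by blast
    qed
  qed (use FE \<alpha>V off in auto)
  then show ?thesis unfolding \<alpha>_def by blast
qed

lemma mult_supp_scale: "c \<noteq> 0 \<Longrightarrow> mult_supp (scale c \<alpha>) = mult_supp \<alpha>"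
  unfolding mult_supp_coord by (rule arg_cong[where f = card]) (auto simp: coord_add coord_scale coord_diff)

text \<open>Let \<open>F\<close> be the set of coordinates at which \<open>\<alpha>\<close> vanishes. By minimality the vectors of \<open>L\<close> vanishing on
  \<open>F\<close> are the multiples of \<open>\<alpha>\<close>, and only 0 is left when one more coordinate has to vanish. So \<open>F\<close> has
  corank 1 and is closed.\<close>
lemma minimal_support_flat:
  assumes \<alpha>: "\<alpha> \<in> L" "\<alpha> \<noteq> 0"
    and minimal: "\<And>\<beta>. \<beta> \<in> L \<Longrightarrow> (\<And>e. e \<in> E \<Longrightarrow> coord e \<alpha> = 0 \<Longrightarrow> coord e \<beta> = 0) \<Longrightarrow> \<exists>c. \<beta> = scale c \<alpha>"
  shows "\<exists>F c. corank1_flat F \<and> c \<noteq> 0 \<and> alpha_flat F = scale c \<alpha>"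
proof -
  define F where "F = {e \<in> E. coord e \<alpha> = 0}"
  have FE: "F \<subseteq> E" unfolding F_def by blast
  have V: "vanishing F = span {\<alpha>}"
  proof (intro equalityI subsetI)
    fix x assume x: "x \<in> vanishing F"
    then have "\<exists>c. x = scale c \<alpha>" unfolding F_def by (intro minimal) auto
    then show "x \<in> span {\<alpha>}" unfolding span_singleton by blast
  next
    fix x assume "x \<in> span {\<alpha>}"
    then show "x \<in> vanishing F"
      unfolding span_singleton F_def using \<alpha> by (auto simp: L_closed coord_add coord_scale coord_diff)
  qed
  have rkF: "rk F + 1 = dim L" using rank_nullity[OF FE] dim_line[OF \<alpha>(2)] unfolding V by simp
  have "rk F < rk (insert e F)" if e: "e \<in> E - F" for e
  proof -
    have "vanishing (insert e F) = {0}"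
    proof (intro equalityI subsetI)
      fix x assume x: "x \<in> vanishing (insert e F)"
      then have "x \<in> vanishing F" by blast
      then obtain c where c: "x = scale c \<alpha>" unfolding V span_singleton by blast
      then have "c * coord e \<alpha> = 0" using x e by (auto simp: coord_add coord_scale coord_diff)
      then have "c = 0" using e unfolding F_def by auto
      then show "x \<in> {0}" using c by simp
    qed (use L_closed(4) FE e in auto)
    then have "rk (insert e F) = dim L"
      using rank_nullity[of "insert e F"] FE e dim_zero_space by simp
    then show ?thesis using rkF by simp
  qed
  then have F: "corank1_flat F" unfolding corank1_flat_def flat_def using FE rkF rk_E by simp
  have "alpha_flat F \<in> span {\<alpha>}" using alpha_flat(2)[OF F] V span_base[of "alpha_flat F" "{alpha_flat F}"] by simp
  then obtain c where "alpha_flat F = scale c \<alpha>" unfolding span_singleton by blast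
  then show ?thesis using F alpha_flat(1)[OF F] by (intro exI[of _ F] exI[of _ c]) auto
qed

end

section \<open>From minimal supports to all directions\<close>

lemma sum_card_fibres:
  assumes "finite S"
  shows "(\<Sum>c\<in>s ` S. card {e \<in> S. s e = c}) = card S"
  using sum.group[OF assms finite_imageI[OF assms], of s s "\<lambda>_. 1::nat"] by simp

context linear_space
begin

text \<open>Induction on the size \<open>m\<close> of the support. If \<open>\<alpha>\<close> does not have minimal support, there is a
  \<open>\<beta>\<close>, not a multiple of \<open>\<alpha>\<close>, whose support is contained in that of \<open>\<alpha>\<close>. The vectors \<open>\<beta> - c \<alpha>\<close>, where \<open>c\<close> runs
  through the quotients of the coordinates of \<open>\<beta>\<close> and \<open>\<alpha>\<close>, have smaller support: \<open>n c\<close> coordinates vanish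
  in addition, and the numbers \<open>n c\<close> add up to \<open>m\<close>. At least two values \<open>c\<close> occur, since otherwise
  \<open>\<beta>\<close> would be a multiple of \<open>\<alpha>\<close>. For \<open>D > m + k\<close> the orders required by \<open>plane_degree\<close> then add up to
  \<open>r (D - m - k) + m \<ge> 2 (D - m - k) + m > D\<close>, where \<open>r\<close> is the number of values; the last step
  uses \<open>k \<le> 0\<close>.\<close>
theorem deg_below_all_directions:
  assumes f: "f \<in> polyfuns" and k: "- (int rho + 1) \<le> k" "k \<le> 0"
    and flats: "\<And>F. corank1_flat F \<Longrightarrow>
      deg_below f (alpha_flat F) (nat (int (mult_supp (alpha_flat F)) + k + 1))"
  shows "\<alpha> \<in> L - {0} \<Longrightarrow> deg_below f \<alpha> (nat (int (mult_supp \<alpha>) + k + 1))"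
proof (induction "mult_supp \<alpha>" arbitrary: \<alpha> rule: less_induct)
  case less
  then have \<alpha>: "\<alpha> \<in> L" "\<alpha> \<noteq> 0" by auto
  show ?case
  proof (cases "\<exists>\<beta>\<in>L. (\<forall>e\<in>E. coord e \<alpha> = 0 \<longrightarrow> coord e \<beta> = 0) \<and> (\<nexists>c. \<beta> = scale c \<alpha>)")
    case False
    have multiple: "\<exists>c. \<beta> = scale c \<alpha>"
      if "\<beta> \<in> L" "\<And>e. e \<in> E \<Longrightarrow> coord e \<alpha> = 0 \<Longrightarrow> coord e \<beta> = 0" for \<beta>
      by (rule ccontr) (use False that in blast)
    have "\<exists>F c. corank1_flat F \<and> c \<noteq> 0 \<and> alpha_flat F = scale c \<alpha>"
      by (rule minimal_support_flat[OF \<alpha>]) (rule multiple)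
    then obtain F c where
      F: "corank1_flat F" "c \<noteq> 0" "alpha_flat F = scale c \<alpha>" by (elim exE conjE) (rule that)
    have "deg_below f (scale c \<alpha>) (nat (int (mult_supp \<alpha>) + k + 1))"
      using flats[OF F(1)] unfolding F(3) mult_supp_scale[OF F(2)] .
    with F(2) show ?thesis by (rule deg_below_scale)
  next
    case True
    then obtain \<beta> where \<beta>: "\<beta> \<in> L" "\<And>e. e \<in> E \<Longrightarrow> coord e \<alpha> = 0 \<Longrightarrow> coord e \<beta> = 0"
      "\<And>c. \<beta> \<noteq> scale c \<alpha>" by blast
    define S where "S = {e \<in> E. coord e \<alpha> \<noteq> 0}"
    have finS: "finite S" unfolding S_def using finite_E by simp
    define s where "s e = coord e \<beta> / coord e \<alpha>" for e
    define n where "n c = card {e \<in> S. s e = c}" for c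
    define \<gamma> where "\<gamma> c = \<beta> - scale c \<alpha>" for c
    have mS: "mult_supp \<alpha> = card S" unfolding mult_supp_coord S_def ..
    have \<gamma>: "\<gamma> c \<in> L - {0}" for c
      using \<alpha> \<beta> unfolding \<gamma>_def by (auto simp: L_closed)
    have supp: "mult_supp (\<gamma> c) + n c = card S" for c
    proof -
      have "{e \<in> E. coord e (\<gamma> c) \<noteq> 0} = {e \<in> S. s e \<noteq> c}"
      proof (rule Collect_cong)
        fix e
        show "e \<in> E \<and> coord e (\<gamma> c) \<noteq> 0 \<longleftrightarrow> e \<in> S \<and> s e \<noteq> c"
          unfolding S_def s_def \<gamma>_def using \<beta>(2)[of e]
          by (cases "coord e \<alpha> = 0") (auto simp: coord_add coord_scale coord_diff nonzero_divide_eq_eq)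
      qed
      then have "mult_supp (\<gamma> c) + n c = card ({e \<in> S. s e \<noteq> c} \<union> {e \<in> S. s e = c})"
        unfolding mult_supp_coord n_def using finS by (subst card_Un_disjoint) auto
      also have "{e \<in> S. s e \<noteq> c} \<union> {e \<in> S. s e = c} = S" by blast
      finally show ?thesis .
    qed
    have npos: "n c > 0" if "c \<in> s ` S" for c
      using that finS unfolding n_def by (auto simp: card_gt_0_iff)
    have dg: "deg_below f (\<beta> - scale c \<alpha>) (nat (int (mult_supp (\<gamma> c)) + k + 1))" if c: "c \<in> s ` S" for c
      using less.hyps[of "\<gamma> c"] supp[of c] npos[OF c] \<gamma> unfolding mS \<gamma>_def by simp
    have "card (s ` S) \<ge> 2"
    proof (rule ccontr)
      assume "\<not> ?thesis"
      moreover have "S \<noteq> {}"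
      proof
        assume "S = {}"
        then have "\<alpha> = 0" unfolding S_def by (intro coord_eqI) auto
        then show False using \<alpha> by blast
      qed
      then have "card (s ` S) > 0" using finS by (simp add: card_gt_0_iff)
      ultimately have "card (s ` S) = 1" by linarith
      then obtain c where c: "s ` S = {c}" by (auto simp: card_1_singleton_iff)
      then have "{e \<in> S. s e = c} = S" by blast
      then have "mult_supp (\<gamma> c) = 0" using supp[of c] unfolding n_def by simp
      then have "{e \<in> E. coord e (\<gamma> c) \<noteq> 0} = {}" unfolding mult_supp_coord using finite_E by simp
      then have "\<gamma> c = 0" by (intro coord_eqI) auto
      then show False using \<gamma> by blast
    qed
    \<comment> \<open>Count the zeros on the plane; \<open>x + 1\<close> is \<open>D - m - k\<close>.\<close>
    show ?thesis
    proof (rule plane_degree[OF f \<alpha>(1) \<beta>(1) finite_imageI[OF finS] dg])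
      fix D assume D: "nat (int (mult_supp \<alpha>) + k + 1) \<le> D"
      define x where "x = int D - (int (mult_supp \<alpha>) + k + 1)"
      have Dx: "int D = x + (int (card S) + k + 1)" unfolding x_def mS by simp
      have x: "x \<ge> 0" using D unfolding x_def by linarith
      have summand: "int (Suc D - nat (int (mult_supp (\<gamma> c)) + k + 1)) \<ge> (x + 1) + int (n c)" for c
        using rho_le[OF \<gamma>[of c]] k(1) supp[of c] mS unfolding x_def by linarith
      have "x + (int (card S) + k + 1) < 2 * (x + 1) + int (card S)" using x k(2) by simp
      then have "int D < 2 * (x + 1) + int (card S)" unfolding Dx .
      also have "\<dots> \<le> int (card (s ` S)) * (x + 1) + int (card S)"
        using \<open>card (s ` S) \<ge> 2\<close> x by (intro add_right_mono mult_right_mono) auto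
      also have "\<dots> = (\<Sum>c\<in>s ` S. (x + 1) + int (n c))"
        using sum_card_fibres[OF finS, of s] unfolding n_def
        by (simp add: sum.distrib flip: of_nat_sum)
      also have "\<dots> \<le> (\<Sum>c\<in>s ` S. int (Suc D - nat (int (mult_supp (\<gamma> c)) + k + 1)))"
        by (intro sum_mono summand)
      finally have "int D < (\<Sum>c\<in>s ` S. int (Suc D - nat (int (mult_supp (\<gamma> c)) + k + 1)))" .
      then show "D < (\<Sum>c\<in>s ` S. Suc D - nat (int (mult_supp (\<gamma> c)) + k + 1))"
        by (metis of_nat_less_iff of_nat_sum)
    qed
  qed
qed

end

section \<open>Sections and the space cut out by differential operators\<close>

context linear_space
begin

lemma deg_below_zero:
  assumes "\<And>x. x \<in> L \<Longrightarrow> f x = 0" "\<alpha> \<in> L"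
  shows "deg_below f \<alpha> q"
  unfolding deg_below_def
proof (intro ballI allI impI)
  fix x p j assume "x \<in> L" "\<forall>t. f (x + scale t \<alpha>) = poly p t"
  then have "poly p t = 0" for t using assms by (metis L_closed(1,2))
  then have "p = 0" using poly_all_0_iff_0 by blast
  then show "coeff p j = 0" by simp
qed

lemma pole_order_iff:
  assumes F: "corank1_flat F" and f: "f \<in> polyfuns" "\<exists>x\<in>L. f x \<noteq> 0"
    and g: "regular_on U g" "embed ` L \<subseteq> U" "\<And>x. x \<in> L \<Longrightarrow> g (embed x) = f x"
  shows "- D_coeff k F \<le> ord_along (D_flat F) U g \<longleftrightarrow>
    deg_below f (alpha_flat F) (nat (int (mult_supp (alpha_flat F)) + k + 1))"
proof -
  obtain e0 where "corank1_chart scale E Vl L F (alpha_flat F) e0" using corank1_flat_chart[OF F] by blast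
  from corank1_chart.ord_along_polyfun[OF this f] obtain N where
    N: "ord_along (D_flat F) U g = - int N" "\<And>q. deg_below f (alpha_flat F) q \<longleftrightarrow> N < q"
    using g by blast
  show ?thesis unfolding N D_coeff_def by linarith
qed

theorem H0_eq_C_space:
  assumes k: "- (int rho + 1) \<le> k" "k \<le> 0"
  shows "H0 k = C_space k"
proof (intro equalityI subsetI)
  fix h assume "h \<in> H0 k"
  then obtain U g where h: "h = (\<lambda>x\<in>L. g (embed x))" and sec: "is_section k U g" unfolding H0_def by blast
  have U: "regular_on U g" "embed ` L \<subseteq> U" using sec unfolding is_section_def rational_fun_def by auto
  obtain f where f: "f \<in> polyfuns" "\<And>x. x \<in> L \<Longrightarrow> g (embed x) = f x"
    using regular_on_L_is_polyfun[OF U] by blast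
  have "deg_below f \<alpha> (nat (int (mult_supp \<alpha>) + k + 1))" if \<alpha>: "\<alpha> \<in> L - {0}" for \<alpha>
  proof (cases "\<exists>x\<in>L. f x \<noteq> 0")
    case True
    then have "\<not> (\<forall>P\<in>U. g P = 0)" using f(2) U(2) by force
    then have "deg_below f (alpha_flat F) (nat (int (mult_supp (alpha_flat F)) + k + 1))"
      if "corank1_flat F" for F
      using sec that pole_order_iff[OF that f(1) True U f(2)] unfolding is_section_def by blast
    then show ?thesis using deg_below_all_directions[OF f(1) k _ \<alpha>] by blast
  qed (use deg_below_zero \<alpha> in blast)
  moreover have "h = restrict f L" unfolding h using f(2) by (intro restrict_ext)
  ultimately show "h \<in> C_space k" unfolding C_space_iff using f(1) by blast
next
  fix h assume "h \<in> C_space k"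
  then obtain f where f: "f \<in> polyfuns" "h = restrict f L"
    "\<And>\<alpha>. \<alpha> \<in> L - {0} \<Longrightarrow> deg_below f \<alpha> (nat (int (mult_supp \<alpha>) + k + 1))"
    unfolding C_space_iff by blast
  obtain U g where U: "regular_on U g" "embed ` L \<subseteq> U" and g: "\<And>x. x \<in> L \<Longrightarrow> g (embed x) = f x"
    using polyfun_extends_regular[OF f(1)] by blast
  have "U \<noteq> {}" using U(2) L_closed(4) by blast
  then have rat: "rational_fun U g" unfolding rational_fun_def using U(1) regular_on_open by blast
  have "(\<forall>P\<in>U. g P = 0) \<or> (\<forall>F. corank1_flat F \<longrightarrow> - D_coeff k F \<le> ord_along (D_flat F) U g)"
  proof (cases "\<exists>x\<in>L. f x \<noteq> 0")
    case True
    have "alpha_flat F \<in> L - {0}" if "corank1_flat F" for F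
      using alpha_flat[OF that] span_base[of "alpha_flat F" "{alpha_flat F}"] by blast
    then show ?thesis using pole_order_iff[OF _ f(1) True U g] f(3) by blast
  next
    case False
    have "g P = 0" if "P \<in> U" for P
      by (rule regular_on_eq[OF U(1) regular_on_const[OF regular_on_open[OF U(1)]] _ that])
         (use g False in auto)
    then show ?thesis by blast
  qed
  then have "is_section k U g" unfolding is_section_def using rat U(2) by blast
  moreover have "h = (\<lambda>x\<in>L. g (embed x))" unfolding f(2) using g by (intro restrict_ext) simp
  ultimately show "h \<in> H0 k" unfolding H0_def by blast
qed

end

theorem theorem1p14:
  fixes scale :: "'a::{alg_closed_field,field_char_0} \<Rightarrow> 'v::ab_group_add \<Rightarrow> 'v"
    and E :: "'e set" and Vl :: "'e \<Rightarrow> 'v set" and L :: "'v set" and k :: int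
  assumes "linear_space scale E Vl L"
    and "- (int (linear_space.rho E Vl L) + 1) \<le> k" and "k \<le> 0"
  shows "linear_space.H0 scale E Vl L k = linear_space.C_space scale E Vl L k"
  using assms by (rule linear_space.H0_eq_C_space)

end
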